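(* Let $q$ be a prime power, let $(\boldsymbol\lambda,k),(\boldsymbol\mu,s),(\boldsymbol\nu,t)\in\widehat{\mathscr P}^{\mathsf a}(\Phi_q)$ and $n\ge 1$. (1) $\mathfrak p_{(\boldsymbol\lambda,k),(\boldsymbol\mu,s)}^{(\boldsymbol\nu,t)}(n)=0$ unless $\|(\boldsymbol\nu,t)\|\le \|(\boldsymbol\lambda,k)\|+\|(\boldsymbol\mu,s)\|$. (2) If $\|(\boldsymbol\nu,t)\|=\|(\boldsymbol\lambda,k)\|+\|(\boldsymbol\mu,s)\|$, then $\mathfrak p_{(\boldsymbol\lambda,k),(\boldsymbol\mu,s)}^{(\boldsymbol\nu,t)}(n)$ is independent of $n$.
   Context: Let $q$ be a prime power; vectors in $\mathbb F_q^n$ are columns. $\Phi_q$ is the set of monic irreducible polynomials in $\mathbb F_q[t]$ other than $t$. $\mathscr P(\Phi_q)$ is the set of maps $\boldsymbol\lambda$ from $\Phi_q$ to partitions with $\boldsymbol\lambda(f)$ nonempty for only finitely many $f$; $\|\boldsymbol\lambda\|=\sum_{f}\deg(f)\,|\boldsymbol\lambda(f)|$; $\mathscr P_n(\Phi_q)=\{\boldsymbol\lambda:\|\boldsymbol\lambda\|=n\}$. Type in $GL_n(q)$: $g\in GL_n(q)$ has type $\boldsymbol\lambda\in\mathscr P_n(\Phi_q)$ if $\mathbb F_q^n$, with $t$ acting as $g$, is isomorphic to $\bigoplus_{f,i}\mathbb F_q[t]/(f)^{\boldsymbol\lambda_i(f)}$ as an $\mathbb F_q[t]$-module, where $\boldsymbol\lambda(f)=(\boldsymbol\lambda_1(f),\boldsymbol\lambda_2(f),\dots)$.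 The modified type of $g$ is $\mathring{\boldsymbol\lambda}\in\mathscr P(\Phi_q)$, where $\mathring{\boldsymbol\lambda}(f)=\boldsymbol\lambda(f)$ for $f\ne t-1$ and $\mathring{\boldsymbol\lambda}(t-1)$ is obtained from $\boldsymbol\lambda(t-1)$ by subtracting $1$ from every (positive) part. $GA_n(q)$ is the subgroup of $GL_n(q)$ of matrices $\begin{bmatrix}1&0\\ \alpha&g\end{bmatrix}$ with $g\in GL_{n-1}(q)$, $\alpha\in\mathbb F_q^{n-1}$. Canonical forms. For $f=t^d-\sum_{i=1}^d a_it^{i-1}\in\Phi_q$, $J(f)$ is the companion matrix with $1$'s on the superdiagonal, last row $(a_1,\dots,a_d)$, and other entries $0$; $J_m(f)$ is the $dm\times dm$ block matrix with $m$ diagonal blocks $J(f)$, blocks $I_d$ on the block superdiagonal, and zeros elsewhere. For $\boldsymbol\lambda\in\mathscr P_{n-1}(\Phi_q)$ with $\boldsymbol\lambda(t-1)=(1^{m_1}2^{m_2}\cdots r^{m_r})$, $J_{\boldsymbol\lambda}=\mathrm{diag}(E^{(1)}_{\boldsymbol\lambda},\dots,E^{(r)}_{\boldsymbol\lambda},J^-_{\boldsymbol\lambda})$, where $E^{(i)}_{\boldsymbol\lambda}$ is the diagonal sum of $m_i$ copies of $J_i(t-1)$ and $J_{\boldsymbol\lambda}^-$ is the diagonal sum of the $J_{\boldsymbol\lambda_i(f)}(f)$ over $f\ne t-1$ and $i\geq 1$ (in a fixed order). For $k=0$ or $k$ a part of $\boldsymbol\lambda(t-1)$, put $J_{(\boldsymbol\lambda,k)}=\begin{bmatrix}1&0\\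 \epsilon_k&J_{\boldsymbol\lambda}\end{bmatrix}\in GA_n(q)$, where $\epsilon_0=0$ and, for $k\ge1$, $\epsilon_k\in\mathbb F_q^{n-1}$ has entry $1$ in the last coordinate of the rows of $E^{(k)}_{\boldsymbol\lambda}$ (position $m_1+2m_2+\cdots+km_k$) and zeros elsewhere. Every $A\in GA_n(q)$ is conjugate in $GA_n(q)$ to exactly one $J_{(\boldsymbol\lambda,k)}$ with $\boldsymbol\lambda\in\mathscr P_{n-1}(\Phi_q)$ and $k=0$ or $k$ a part of $\boldsymbol\lambda(t-1)$; then $A$ is said to have type $(\boldsymbol\lambda,k)$ and modified type $(\mathring{\boldsymbol\lambda},k)$. Let $\widehat{\mathscr P}^{\mathsf a}(\Phi_q)$ be the set of pairs $(\boldsymbol\lambda,k)\in\mathscr P(\Phi_q)\times\mathbb Z_{\ge0}$ such that $k-1$ is a part of $\boldsymbol\lambda(t-1)$ whenever $k\ge1$, where $0$ is regarded as a part of every partition (so $k=1$ is always allowed). Set $\|(\boldsymbol\mu,l)\|=\|\boldsymbol\mu\|$ if $l=0$ and $\|\boldsymbol\mu\|+1$ if $l\ge1$. For $(\boldsymbol\lambda,k)\in\widehat{\mathscr P}^{\mathsf a}(\Phi_q)$, $P_{(\boldsymbol\lambda,k)}(n)$ is the sum in $\mathbb Z[GA_n(q)]$ of all elements of $GA_n(q)$ of modified type $(\boldsymbol\lambda,k)$ (it is $0$ if there are none, and otherwise is a conjugacy class sum). $\mathcal A_n(q)$ is the center of $\mathbb Z[GA_n(q)]$. The structure constants are defined by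 $$P_{(\boldsymbol\lambda,k)}(n)P_{(\boldsymbol\mu,s)}(n)=\sum_{(\boldsymbol\nu,t)}\mathfrak p_{(\boldsymbol\lambda,k),(\boldsymbol\mu,s)}^{(\boldsymbol\nu,t)}(n)\,P_{(\boldsymbol\nu,t)}(n)\quad\text{in }\mathcal A_n(q).$$ Convention: $\mathfrak p_{(\boldsymbol\lambda,k),(\boldsymbol\mu,s)}^{(\boldsymbol\nu,t)}(n)$ is defined only for those $n\ge1$ such that $P_{(\boldsymbol\lambda,k)}(n)$, $P_{(\boldsymbol\mu,s)}(n)$, $P_{(\boldsymbol\nu,t)}(n)$ are all nonzero; statements about it concern such $n$. *)

theory Defs
  imports
    "HOL-Library.Multiset"
    "HOL-Computational_Algebra.Polynomial_Factorial"
    "Jordan_Normal_Form.Matrix"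
begin

text \<open>
  Throughout, the finite field with \<open>q\<close> elements is a type \<open>'a\<close> of sort \<open>{field, finite}\<close>, so that
  \<open>q = CARD('a)\<close>.
\<close>

definition Phi :: "'a::field poly set" where
  "Phi = {f. irreducible f \<and> lead_coeff f = 1 \<and> f \<noteq> [:0, 1:]}"

abbreviation t_minus_1 :: "'a::field poly" where
  "t_minus_1 \<equiv> [:-1, 1:]"

text \<open>
  A partition is the multiset of its (positive) parts. A map from \<^term>\<open>Phi\<close> to partitions is a
  function on all polynomials that takes the value \<open>{#}\<close> (the empty partition) outside \<^term>\<open>Phi\<close>.
\<close>

type_synonym 'a ptn_fun = "'a poly \<Rightarrow> nat multiset"

definition ptn_funs :: "'a::field ptn_fun set" where
  "ptn_funs = {lam. (\<forall>f. f \<notin> Phi \<longrightarrow> lam f = {#}) \<and> (\<forall>f. 0 \<notin># lam f) \<and> finite {f. lam f \<noteq> {#}}}"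

definition ptn_norm :: "'a::field ptn_fun \<Rightarrow> nat" where
  "ptn_norm lam = (\<Sum>f \<in> {f. lam f \<noteq> {#}}. degree f * \<Sum>\<^sub># (lam f))"

definition ptn_funs_of_norm :: "nat \<Rightarrow> 'a::field ptn_fun set" where
  "ptn_funs_of_norm n = {lam \<in> ptn_funs. ptn_norm lam = n}"

definition modify :: "'a::field ptn_fun \<Rightarrow> 'a ptn_fun" where
  "modify lam =
    (\<lambda>f. if f = t_minus_1 then filter_mset (\<lambda>i. 0 < i) (image_mset (\<lambda>i. i - 1) (lam f)) else lam f)"

definition GL :: "nat \<Rightarrow> 'a::field mat set" where
  "GL n = {g \<in> carrier_mat n n. invertible_mat g}"

text \<open>Only used for \<open>n \<ge> 1\<close>.\<close>

definition GA :: "nat \<Rightarrow> 'a::field mat set" where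
  "GA n = {four_block_mat (1\<^sub>m 1) (0\<^sub>m 1 (n - 1)) \<alpha> g | \<alpha> g.
             \<alpha> \<in> carrier_mat (n - 1) 1 \<and> g \<in> GL (n - 1)}"

definition GA_conjugate :: "nat \<Rightarrow> 'a::field mat \<Rightarrow> 'a mat \<Rightarrow> bool" where
  "GA_conjugate n A B \<longleftrightarrow> (\<exists>P \<in> GA n. \<exists>Q \<in> GA n. similar_mat_wit A B P Q)"

text \<open>
  For \<open>f = t\<^sup>d - (a\<^sub>1 + a\<^sub>2 t + \<dots> + a\<^sub>d t\<^bsup>d-1\<^esup>)\<close>, the entry of the last row in column \<open>j\<close>
  (counted from \<open>0\<close>) is \<open>a\<^bsub>j+1\<^esub> = - coeff f j\<close>.
\<close>

definition companion :: "'a::field poly \<Rightarrow> 'a mat" where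
  "companion f = mat (degree f) (degree f)
     (\<lambda>(i, j). if i + 1 = degree f then - coeff f j else if j = i + 1 then 1 else 0)"

text \<open>Row \<open>i\<close> lies in block row \<open>i div d\<close>, at position \<open>i mod d\<close> within the block.\<close>

definition J_block :: "nat \<Rightarrow> 'a::field poly \<Rightarrow> 'a mat" where
  "J_block m f = (let d = degree f in mat (d * m) (d * m)
     (\<lambda>(i, j). if j div d = i div d then companion f $$ (i mod d, j mod d)
               else if j div d = i div d + 1 \<and> j mod d = i mod d then 1
               else 0))"

definition E_part :: "'a::field ptn_fun \<Rightarrow> nat \<Rightarrow> 'a mat" where
  "E_part lam i = diag_block_mat (replicate (count (lam t_minus_1) i) (J_block i t_minus_1))"

text \<open>The fixed order of the polynomials \<open>f \<noteq> t - 1\<close> with \<open>lam f\<close> nonempty is an arbitrary one.\<close>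

definition support_list :: "'a::field ptn_fun \<Rightarrow> 'a poly list" where
  "support_list lam = (SOME fs. distinct fs \<and> set fs = {f. f \<noteq> t_minus_1 \<and> lam f \<noteq> {#}})"

definition J_minus :: "'a::field ptn_fun \<Rightarrow> 'a mat" where
  "J_minus lam = diag_block_mat
     (concat (map (\<lambda>f. map (\<lambda>m. J_block m f) (rev (sorted_list_of_multiset (lam f))))
       (support_list lam)))"

text \<open>
  The blocks \<^term>\<open>E_part lam i\<close> for \<open>i\<close> not a part of \<open>lam (t - 1)\<close> are \<open>0 \<times> 0\<close> and are left out.
\<close>

definition J_linear :: "'a::field ptn_fun \<Rightarrow> 'a mat" where
  "J_linear lam = diag_block_mat
     (map (E_part lam) (sorted_list_of_set (set_mset (lam t_minus_1))) @ [J_minus lam])"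

text \<open>Row \<open>i\<close>, counted from \<open>0\<close>, is the coordinate \<open>i + 1\<close>.\<close>

definition eps :: "'a::field ptn_fun \<Rightarrow> nat \<Rightarrow> 'a mat" where
  "eps lam k = mat (ptn_norm lam) 1
     (\<lambda>(i, j). if 1 \<le> k \<and> i + 1 = (\<Sum>l = 1..k. l * count (lam t_minus_1) l) then 1 else 0)"

definition J_affine :: "'a::field ptn_fun \<times> nat \<Rightarrow> 'a mat" where
  "J_affine = (\<lambda>(lam, k).
     four_block_mat (1\<^sub>m 1) (0\<^sub>m 1 (ptn_norm lam)) (eps lam k) (J_linear lam))"

definition has_type :: "nat \<Rightarrow> 'a::field mat \<Rightarrow> 'a ptn_fun \<times> nat \<Rightarrow> bool" where
  "has_type n A = (\<lambda>(lam, k).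
     A \<in> GA n \<and> lam \<in> ptn_funs_of_norm (n - 1) \<and> (k = 0 \<or> k \<in># lam t_minus_1) \<and>
     GA_conjugate n A (J_affine (lam, k)))"

definition has_modified_type :: "nat \<Rightarrow> 'a::field mat \<Rightarrow> 'a ptn_fun \<times> nat \<Rightarrow> bool" where
  "has_modified_type n A = (\<lambda>(mu, k). \<exists>lam. has_type n A (lam, k) \<and> mu = modify lam)"

definition affine_types :: "('a::field ptn_fun \<times> nat) set" where
  "affine_types = {(lam, k). lam \<in> ptn_funs \<and>
     (1 \<le> k \<longrightarrow> k - 1 = 0 \<or> k - 1 \<in># lam t_minus_1)}"

definition affine_norm :: "'a::field ptn_fun \<times> nat \<Rightarrow> nat" where
  "affine_norm = (\<lambda>(mu, l). if l = 0 then ptn_norm mu else ptn_norm mu + 1)"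

text \<open>
  An element of the integral group ring of \<open>GA n\<close> is given by its coefficient function, which
  vanishes outside \<open>GA n\<close>; the product is convolution.
\<close>

definition gr_mult :: "nat \<Rightarrow> ('a::{field,finite} mat \<Rightarrow> int) \<Rightarrow> ('a mat \<Rightarrow> int) \<Rightarrow> 'a mat \<Rightarrow> int" where
  "gr_mult n x y = (\<lambda>C. \<Sum>(A, B) \<in> {(A, B). A \<in> GA n \<and> B \<in> GA n \<and> A * B = C}. x A * y B)"

definition class_sum :: "'a::{field,finite} ptn_fun \<times> nat \<Rightarrow> nat \<Rightarrow> 'a mat \<Rightarrow> int" where
  "class_sum L n = (\<lambda>A. if A \<in> GA n \<and> has_modified_type n A L then 1 else 0)"

text \<open>The (finite) set of indices of the nonzero class sums.\<close>

definition occurring_types :: "nat \<Rightarrow> ('a::{field,finite} ptn_fun \<times> nat) set" where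
  "occurring_types n = {N \<in> affine_types. class_sum N n \<noteq> (\<lambda>_. 0)}"

text \<open>
  The coefficient of \<^term>\<open>class_sum N n\<close> in the expansion of
  \<^term>\<open>gr_mult n (class_sum L n) (class_sum M n)\<close>. It is meaningful only if \<open>L\<close>, \<open>M\<close> and \<open>N\<close> all
  belong to \<^term>\<open>occurring_types n\<close>.
\<close>

definition structure_constant ::
  "'a::{field,finite} ptn_fun \<times> nat \<Rightarrow> 'a ptn_fun \<times> nat \<Rightarrow> 'a ptn_fun \<times> nat \<Rightarrow> nat \<Rightarrow> int" where
  "structure_constant L M N n = (THE c. \<exists>p.
     gr_mult n (class_sum L n) (class_sum M n)
       = (\<lambda>A. \<Sum>N' \<in> occurring_types n. p N' * class_sum N' n A) \<and>
     c = p N)"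

definition sc_defined ::
  "'a::{field,finite} ptn_fun \<times> nat \<Rightarrow> 'a ptn_fun \<times> nat \<Rightarrow> 'a ptn_fun \<times> nat \<Rightarrow> nat \<Rightarrow> bool" where
  "sc_defined L M N n \<longleftrightarrow> 1 \<le> n \<and>
     class_sum L n \<noteq> (\<lambda>_. 0) \<and> class_sum M n \<noteq> (\<lambda>_. 0) \<and> class_sum N n \<noteq> (\<lambda>_. 0)"

end

theory Submission
  imports Defs "HOL-Library.Function_Algebras" "HOL-Library.Cardinality" "Jordan_Normal_Form.Determinant"
begin

text \<open>
  The proof turns the affine group into linear algebra over the polynomial ring and then compares ranks.

  A matrix \<open>A\<close> of \<open>GA n\<close> acts on row vectors from the right and fixes the first unit row \<open>e\<close>. The row space is thus a
  module over the polynomials, with \<open>t\<close> acting as \<open>A\<close>, and it has a marked vector \<open>e\<close> with \<open>(t - 1) e = 0\<close>. Two elements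
  of \<open>GA n\<close> are conjugate in \<open>GA n\<close> if and only if their modules are isomorphic with marked vectors corresponding to
  each other. Such a pair is a direct sum of primary cyclic modules in which \<open>e\<close> is the last vector of a chain
  \<open>v, (t - 1) v, \<dots>, (t - 1)\<^sup>k v\<close> (\<open>cyclic_summand\<close>, \<open>affine_sum_exists\<close>). The number \<open>k\<close> and the blocks are unique: \<open>k\<close> is the
  height of \<open>e\<close>, and the cardinalities of torsion subgroups determine the blocks (\<open>affine_sum_unique\<close>). These data are the
  type, because a cyclic module with annihilator \<open>f\<^sup>m\<close> is the same as a block \<open>J_block m f\<close> (\<open>block_basis\<close>,
  \<open>block_basis_imp_cyclic\<close>). The latter depends on a splitting \<open>t = x + s\<close> with \<open>f (x) = 0\<close> and \<open>s\<close> nilpotent, and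
  over a finite field a Frobenius power of \<open>t\<close> serves as \<open>x\<close>. It follows that every element of \<open>GA n\<close> has exactly one modified
  type and that elements of the same modified type are conjugate, so a structure constant counts the factorizations
  \<open>A * B = C\<close> of a fixed \<open>C\<close> with \<open>A\<close> and \<open>B\<close> of given modified types (\<open>structure_constant_eq\<close>).

  The norm of the modified type of \<open>A\<close> is the rank of \<open>A - 1\<close> (\<open>card_moved_rows\<close>). The image of \<open>A * B - 1\<close> lies in the sum of
  the images of \<open>A - 1\<close> and \<open>B - 1\<close>, so the norm is subadditive and the first claim holds. If
  \<open>A * B = C\<close> and the norms add up, then \<open>A\<close> and \<open>B\<close> fix all vectors that \<open>C\<close> fixes, and the images of \<open>A - 1\<close> and \<open>B - 1\<close>
  lie in the image of \<open>C - 1\<close> (\<open>affine_norm_subadditive\<close>). Enlarge \<open>C\<close> by an identity block; this does not change its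
  modified type. Then \<open>A\<close> and \<open>B\<close> fix the new unit rows and move vectors only within the old coordinates, hence they
  are enlarged by an identity block as well. So the factorizations of \<open>C\<close> and of the enlarged \<open>C\<close> correspond to each
  other (\<open>factorizations_extend_mat\<close>), and their number does not depend on \<open>n\<close>.
\<close>

section \<open>Counting in finite groups\<close>

lemma card_kernel_times_card_image:
  fixes h :: "'b::ab_group_add \<Rightarrow> 'c::ab_group_add"
  assumes fin: "finite V" and diff: "\<And>u v. u \<in> V \<Longrightarrow> v \<in> V \<Longrightarrow> u - v \<in> V"
    and add: "\<And>u v. u \<in> V \<Longrightarrow> v \<in> V \<Longrightarrow> h (u - v) = h u - h v"
  shows "card V = card {v \<in> V. h v = 0} * card (h ` V)"
proof -
  have fibre: "card {v \<in> V. h v = y} = card {v \<in> V. h v = 0}" if "y \<in> h ` V" for y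
  proof -
    from that obtain w where w: "w \<in> V" "h w = y" by blast
    have zero: "0 \<in> V" "h 0 = 0" using diff[OF w(1) w(1)] add[OF w(1) w(1)] by auto
    have neg: "- w \<in> V" "h (- w) = - h w"
      using diff[OF zero(1) w(1)] add[OF zero(1) w(1)] zero(2) by auto
    have plus: "v + w \<in> V" "h (v + w) = h v + h w" if "v \<in> V" for v
      using diff[OF that neg(1)] add[OF that neg(1)] neg(2) by auto
    have "{v \<in> V. h v = y} = (\<lambda>v. v + w) ` {v \<in> V. h v = 0}"
    proof (intro equalityI subsetI)
      fix v assume v: "v \<in> {v \<in> V. h v = y}"
      have "v - w \<in> {v \<in> V. h v = 0}" using v diff[of v w] add[of v w] w by simp
      moreover have "v = (v - w) + w" by simp
      ultimately show "v \<in> (\<lambda>v. v + w) ` {v \<in> V. h v = 0}" by (rule rev_image_eqI)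
    next
      fix v assume "v \<in> (\<lambda>v. v + w) ` {v \<in> V. h v = 0}"
      then obtain u where "u \<in> V" "h u = 0" "v = u + w" by blast
      then show "v \<in> {v \<in> V. h v = y}" using plus w(2) by simp
    qed
    then show ?thesis by (simp add: card_image)
  qed
  have "card V = (\<Sum>v \<in> V. 1)" by simp
  also have "\<dots> = (\<Sum>y \<in> h ` V. \<Sum>v | v \<in> V \<and> h v = y. 1)"
    by (rule sum.image_gen[OF fin])
  also have "\<dots> = (\<Sum>y \<in> h ` V. card {v \<in> V. h v = y})" by simp
  also have "\<dots> = card (h ` V) * card {v \<in> V. h v = 0}"
    using fibre by simp
  finally show ?thesis by simp
qed

section \<open>Polynomials over a finite field\<close>

definition polys_below :: "nat \<Rightarrow> 'a::zero poly set" where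
  "polys_below D = {p. \<forall>i\<ge>D. coeff p i = 0}"

lemma polys_below_iff: "p \<in> polys_below D \<longleftrightarrow> p = 0 \<or> degree p < D"
proof
  assume "p \<in> polys_below D"
  then show "p = 0 \<or> degree p < D"
    unfolding polys_below_def using leading_coeff_0_iff[of p] not_less by blast
qed (auto simp: polys_below_def coeff_eq_0)

lemma zero_in_polys_below [simp]: "0 \<in> polys_below D"
  by (simp add: polys_below_def)

lemma diff_in_polys_below: "p \<in> polys_below D \<Longrightarrow> r \<in> polys_below D \<Longrightarrow> p - r \<in> polys_below D"
  for p :: "'a::ab_group_add poly"
  by (simp add: polys_below_def)

lemma mod_in_polys_below: "g \<noteq> 0 \<Longrightarrow> p mod g \<in> polys_below (degree g)"
  for g :: "'a::field poly"
  using degree_mod_less[of g p] by (auto simp: polys_below_iff)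

lemma polys_below_Suc: "polys_below (Suc D) = (\<lambda>(a, p). pCons a p) ` (UNIV \<times> polys_below D)"
proof (intro equalityI subsetI)
  fix p :: "'a poly" assume p: "p \<in> polys_below (Suc D)"
  obtain a r where "p = pCons a r" by (cases p)
  moreover from this p have "r \<in> polys_below D"
    unfolding polys_below_def by (auto simp: coeff_pCons split: nat.splits)
  ultimately show "p \<in> (\<lambda>(a, p). pCons a p) ` (UNIV \<times> polys_below D)" by auto
next
  fix p :: "'a poly" assume "p \<in> (\<lambda>(a, p). pCons a p) ` (UNIV \<times> polys_below D)"
  then obtain a r where "p = pCons a r" "r \<in> polys_below D" by auto
  then show "p \<in> polys_below (Suc D)"
    unfolding polys_below_def by (simp add: coeff_pCons split: nat.split)
qed

lemma card_polys_below:
  "finite (polys_below D :: 'a::{field,finite} poly set)"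
  "card (polys_below D :: 'a poly set) = CARD('a) ^ D"
proof (induction D)
  case 0
  have "polys_below 0 = {0::'a poly}" by (auto simp: polys_below_iff)
  then show "finite (polys_below 0 :: 'a poly set)" "card (polys_below 0 :: 'a poly set) = CARD('a) ^ 0"
    by auto
next
  case (Suc D)
  show "finite (polys_below (Suc D) :: 'a poly set)"
    using Suc.IH(1) by (simp add: polys_below_Suc)
  have "inj_on (\<lambda>(a::'a, p). pCons a p) (UNIV \<times> polys_below D)"
    by (auto simp: inj_on_def)
  then show "card (polys_below (Suc D) :: 'a poly set) = CARD('a) ^ Suc D"
    by (simp add: polys_below_Suc card_image card_cartesian_product Suc.IH(2))
qed

lemma card_field_gt_1: "1 < CARD('a::{field,finite})"
proof -
  have "card {0::'a, 1} \<le> CARD('a)" by (rule card_mono) auto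
  then show ?thesis by simp
qed

lemma mult_in_polys_below_iff:
  fixes f :: "'a::field poly"
  assumes "f \<noteq> 0" "degree f = d"
  shows "f * r \<in> polys_below (d + D) \<longleftrightarrow> r \<in> polys_below D"
  using assms by (cases "r = 0") (auto simp: polys_below_iff degree_mult_eq)

text \<open>
  This and the next lemma count the \<open>g\<^sup>i\<close>-torsion of the cyclic module of annihilator \<open>f\<^sup>m\<close>, whose elements are
  represented by the polynomials of degree less than \<open>m\<close> times the degree of \<open>f\<close>.
\<close>

lemma card_power_torsion_same:
  fixes f :: "'a::{field,finite} poly"
  assumes f: "f \<noteq> 0"
  shows "card {p \<in> polys_below (degree f * m). f ^ m dvd f ^ i * p} = CARD('a) ^ (degree f * min i m)"
proof (cases "i < m")
  case False
  then have "{p \<in> polys_below (degree f * m). f ^ m dvd f ^ i * p} = polys_below (degree f * m)"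
    by (auto intro!: dvd_mult2 le_imp_power_dvd)
  then show ?thesis using False by (simp add: card_polys_below)
next
  case True
  have dv: "f ^ m dvd f ^ i * p \<longleftrightarrow> f ^ (m - i) dvd p" for p
  proof -
    have "f ^ m = f ^ i * f ^ (m - i)" using True by (simp flip: power_add)
    then show ?thesis using f by simp
  qed
  have eq: "degree f * m = degree (f ^ (m - i)) + degree f * i"
  proof -
    have "degree f * m = degree f * ((m - i) + i)" using True by simp
    then show ?thesis by (simp only: degree_power_eq[OF f] distrib_left mult.commute[of "m - i"])
  qed
  have "{p \<in> polys_below (degree f * m). f ^ m dvd f ^ i * p}
      = (\<lambda>r. f ^ (m - i) * r) ` polys_below (degree f * i)"
    unfolding dv eq using f
    by (auto simp: mult_in_polys_below_iff dvd_def image_iff)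
  moreover have "inj_on (\<lambda>r. f ^ (m - i) * r) (polys_below (degree f * i))"
    using f by (auto simp: inj_on_def)
  ultimately show ?thesis
    using True by (simp add: card_image card_polys_below)
qed

lemma card_power_torsion_other:
  fixes f g :: "'a::{field,finite} poly"
  assumes f: "irreducible f" and g: "\<not> f dvd g"
  shows "card {p \<in> polys_below (degree f * m). f ^ m dvd g ^ i * p} = 1"
proof -
  have prime: "prime_elem f" using f by (rule field_poly_irreducible_imp_prime)
  have f0: "f \<noteq> 0" using f by auto
  have "f ^ m dvd p" if "f ^ m dvd g ^ i * p" for p
  proof (cases "m = 0")
    case False
    have "\<not> f dvd g ^ i" using g prime prime_elem_dvd_power by blast
    then show ?thesis using prime_power_dvd_multD[OF prime that] False by simp
  qed simp
  then have "p = 0" if "p \<in> polys_below (degree f * m)" "f ^ m dvd g ^ i * p" for p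
  proof -
    have "degree (f ^ m) = degree f * m" using f0 by (simp add: degree_power_eq)
    moreover have "f ^ m dvd p" using that(2) \<open>\<And>p. f ^ m dvd g ^ i * p \<Longrightarrow> f ^ m dvd p\<close> by blast
    ultimately show ?thesis
      using that(1) dvd_imp_degree_le[of "f ^ m" p] by (metis leD polys_below_iff)
  qed
  then have "{p \<in> polys_below (degree f * m). f ^ m dvd g ^ i * p} = {0}"
    by auto
  then show ?thesis by simp
qed

text \<open>
  Multiplication by \<open>r\<close> is injective on the finitely many residues modulo \<open>f\<close>, hence surjective.
\<close>

lemma irreducible_inverse_mod:
  fixes f r :: "'a::{field,finite} poly"
  assumes f: "irreducible f" and r: "\<not> f dvd r"
  shows "\<exists>b. f dvd b * r - 1"
proof -
  have prime: "prime_elem f" using f by (rule field_poly_irreducible_imp_prime)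
  have f0: "f \<noteq> 0" using f by auto
  have deg: "0 < degree f" using f f0 by (auto simp: irreducible_def is_unit_iff_degree)
  let ?S = "polys_below (degree f) :: 'a poly set"
  have "inj_on (\<lambda>b. b * r mod f) ?S"
  proof (rule inj_onI)
    fix x y assume xy: "x \<in> ?S" "y \<in> ?S" "x * r mod f = y * r mod f"
    have "f dvd (x - y) * r" using xy(3) by (simp add: mod_eq_dvd_iff left_diff_distrib)
    then have "f dvd x - y" using r prime by (simp add: prime_elem_dvd_mult_iff)
    moreover have "x - y \<in> ?S" using xy by (simp add: diff_in_polys_below)
    ultimately show "x = y" by (auto simp: polys_below_iff dest: dvd_imp_degree_le)
  qed
  moreover have "(\<lambda>b. b * r mod f) ` ?S \<subseteq> ?S" using f0 by (auto intro: mod_in_polys_below)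
  ultimately have "(\<lambda>b. b * r mod f) ` ?S = ?S"
    by (simp add: card_polys_below endo_inj_surj)
  moreover have "1 \<in> ?S" using deg by (simp add: polys_below_iff)
  ultimately have "1 \<in> (\<lambda>b. b * r mod f) ` ?S" by simp
  then obtain b where "b * r mod f = 1" by (elim imageE) simp
  moreover have "1 mod f = 1" using deg by (simp add: mod_poly_less)
  ultimately have "b * r mod f = 1 mod f" by simp
  then show ?thesis by (auto simp: mod_eq_dvd_iff)
qed

lemma prime_CHAR_finite_field: "prime CHAR('a::{field,finite})"
  by (rule prime_CHAR_semidom) (simp add: finite_imp_CHAR_pos)

text \<open>
  Raising to powers of the characteristic \<open>p\<close> acts on the finite set of pairs consisting of a map of the ground
  field to itself and a residue modulo \<open>f\<close>. So two exponents \<open>i < j\<close> give the same pair, and as the Frobenius map is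
  injective on the field and modulo \<open>f\<close>, already the exponent \<open>j - i\<close> acts trivially. Its multiples do so too, which
  makes the power as large as desired.
\<close>

lemma Frobenius_period:
  fixes f :: "'a::{field,finite} poly"
  assumes f: "irreducible f"
  obtains N where "m \<le> CHAR('a) ^ N" "0 < N" "\<And>a::'a. a ^ CHAR('a) ^ N = a"
    "f dvd [:0, 1:] ^ CHAR('a) ^ N - [:0, 1:]"
proof -
  define p where "p = CHAR('a)"
  have p: "prime p" unfolding p_def by (rule prime_CHAR_finite_field)
  have f0: "f \<noteq> 0" using f by auto
  have primef: "prime_elem f" using f by (rule field_poly_irreducible_imp_prime)
  have dream: "(x - y) ^ p ^ i = x ^ p ^ i - y ^ p ^ i" for x y :: "'a poly" and i
    using freshmans_dream'[where x = "x - y" and y = y and n = i and m = "p ^ i"] p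
    by (simp add: p_def)
  have dream': "(x - y) ^ p ^ i = x ^ p ^ i - y ^ p ^ i" for x y :: "'a" and i
    using freshmans_dream'[where x = "x - y" and y = y and n = i and m = "p ^ i"] p
    by (simp add: p_def)
  let ?h = "\<lambda>i. (\<lambda>a::'a. a ^ p ^ i, [:0, 1:] ^ p ^ i mod f)"
  have "finite (range ?h)"
    by (rule finite_subset[of _ "UNIV \<times> polys_below (degree f)"])
      (auto simp: card_polys_below intro: mod_in_polys_below[OF f0])
  then have "\<not> inj ?h" using range_inj_infinite by blast
  then obtain i j where ij: "?h i = ?h j" "i < j"
    unfolding inj_def by (metis linorder_neqE_nat)
  define c where "c = j - i"
  have j: "j = c + i" "0 < c" using ij(2) by (auto simp: c_def)
  have c1: "a ^ p ^ c = a" for a :: 'a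
  proof -
    have "a ^ p ^ i = a ^ p ^ j" using ij(1) by (metis prod.inject)
    then have "(a ^ p ^ c - a) ^ p ^ i = 0"
      unfolding dream' by (simp add: j power_add flip: power_mult)
    then show ?thesis by simp
  qed
  have c2: "f dvd [:0, 1:] ^ p ^ c - [:0, 1:]"
  proof -
    have "[:0, 1:] ^ p ^ j mod f = [:0, 1:] ^ p ^ i mod f" using ij(1) by simp
    then have "f dvd [:0, 1:] ^ p ^ j - [:0, 1:] ^ p ^ i" by (simp add: mod_eq_dvd_iff)
    then have "f dvd ([:0, 1:] ^ p ^ c - [:0, 1:]) ^ p ^ i"
      unfolding dream by (simp add: j power_add flip: power_mult)
    then show ?thesis by (rule prime_elem_dvd_power[OF primef])
  qed
  have it1: "a ^ p ^ (c * k) = a" for a :: 'a and k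
    by (induction k) (simp_all add: power_add power_mult c1)
  have it2: "f dvd [:0, 1:] ^ p ^ (c * k) - [:0, 1:]" for k
  proof (induction k)
    case (Suc k)
    have "[:0, 1::'a:] ^ p ^ (c * Suc k) - [:0, 1:]
        = ([:0, 1:] ^ p ^ (c * k) - [:0, 1:]) ^ p ^ c + ([:0, 1:] ^ p ^ c - [:0, 1:])"
    proof -
      have "p ^ (c * Suc k) = p ^ (c * k) * p ^ c" by (simp add: power_add mult.commute)
      then have "[:0, 1::'a:] ^ p ^ (c * Suc k) = ([:0, 1:] ^ p ^ (c * k)) ^ p ^ c"
        by (simp only: power_mult)
      then show ?thesis unfolding dream by simp
    qed
    moreover have "f dvd ([:0, 1:] ^ p ^ (c * k) - [:0, 1:]) ^ p ^ c"
      using Suc p by (meson dvd_power dvd_trans prime_gt_0_nat zero_less_power)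
    ultimately show ?case using c2 by (simp only: dvd_add)
  qed simp
  have "m \<le> p ^ (c * Suc m)"
  proof -
    have "m < 2 ^ m" by simp
    also have "\<dots> \<le> p ^ m" using p by (simp add: power_mono prime_ge_2_nat)
    also have "\<dots> \<le> p ^ (c * Suc m)"
    proof (rule power_increasing)
      show "m \<le> c * Suc m" using j(2) by (cases c) auto
      show "1 \<le> p" using p prime_ge_1_nat by blast
    qed
    finally show ?thesis by simp
  qed
  then show ?thesis
    using that[of "c * Suc m"] it1[of _ "Suc m"] it2[of "Suc m"] j(2) by (simp add: p_def)
qed

lemma irreducible_degree_pos: "irreducible f \<Longrightarrow> 0 < degree f" for f :: "'a::field poly"
  by (metis bot_nat_0.not_eq_extremum irreducible_def is_unit_iff_degree)

lemma split_off_power: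
  fixes f p :: "'a::field poly"
  assumes f: "irreducible f" and "p \<noteq> 0"
  shows "\<exists>j r. p = f ^ j * r \<and> \<not> f dvd r"
  using \<open>p \<noteq> 0\<close>
proof (induction "degree p" arbitrary: p rule: less_induct)
  case less
  show ?case
  proof (cases "f dvd p")
    case False
    then have "p = f ^ 0 * p \<and> \<not> f dvd p" by simp
    then show ?thesis by blast
  next
    case True
    then obtain r where r: "p = f * r" by (elim dvdE)
    have "degree r < degree p"
      using less.prems irreducible_degree_pos[OF f] unfolding r by (simp add: degree_mult_eq)
    then obtain j s where "r = f ^ j * s" "\<not> f dvd s"
      using less.hyps[of r] less.prems unfolding r by auto
    then have "p = f ^ Suc j * s \<and> \<not> f dvd s" by (simp add: r)
    then show ?thesis by blast
  qed
qed

lemma polys_below_expand: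
  fixes r :: "'a::comm_ring_1 poly"
  assumes "r \<in> polys_below D"
  shows "r = (\<Sum>i<D. [:coeff r i:] * [:0, 1:] ^ i)"
proof -
  have "r = (\<Sum>i<D. monom (coeff r i) i)"
  proof (rule poly_eqI)
    fix n show "coeff r n = coeff (\<Sum>i<D. monom (coeff r i) i) n"
      using assms by (auto simp: coeff_sum polys_below_def if_distrib cong: if_cong)
  qed
  then show ?thesis by (simp add: monom_altdef)
qed

section \<open>Finite modules over the polynomial ring\<close>

locale poly_module = Modules.module scale
  for scale :: "'a::{field,finite} poly \<Rightarrow> 'b::ab_group_add \<Rightarrow> 'b" (infixr "*s" 75)
begin

text \<open>
  The constant polynomials make the module a vector space over the ground field.
\<close>

sublocale F: Vector_Spaces.vector_space "\<lambda>c. scale [:c:]"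
proof
  fix a b :: 'a and x y :: 'b
  show "[:a:] *s (x + y) = [:a:] *s x + [:a:] *s y" by (rule scale_right_distrib)
  show "[:a + b:] *s x = [:a:] *s x + [:b:] *s x" by (simp flip: scale_left_distrib)
  show "[:1:] *s x = x" by (simp flip: one_pCons)
qed (simp add: mult.commute)

text \<open>
  On vectors annihilated by \<open>f\<close>, polynomials prime to \<open>f\<close> act invertibly.
\<close>

lemma scale_unit_mod:
  assumes "irreducible f" "\<not> f dvd r" "f *s e = 0"
  obtains b where "b *s (r *s e) = e"
proof -
  obtain b c where "b * r - 1 = f * c"
    using irreducible_inverse_mod[OF assms(1,2)] by (auto elim!: dvdE)
  then have "b * r = c * f + 1" by (simp add: algebra_simps)
  then have "b *s (r *s e) = c *s (f *s e) + e" by (simp add: scale_left_distrib)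
  then show ?thesis using that assms(3) by simp
qed

lemma separating_functional:
  assumes U: "subspace U" and e: "e \<notin> U"
  obtains \<phi> :: "'b \<Rightarrow> 'a" where "\<And>x y. \<phi> (x + y) = \<phi> x + \<phi> y" "\<And>c x. \<phi> ([:c:] *s x) = c * \<phi> x"
    "\<phi> e = 1" "\<And>u. u \<in> U \<Longrightarrow> \<phi> u = 0"
proof -
  obtain B where B: "B \<subseteq> U" "F.independent B" "U \<subseteq> F.span B"
    by (rule F.maximal_independent_subset)
  have "F.subspace U" using U by (auto simp: F.subspace_def subspace_def)
  then have span: "F.span B = U" using B(1,3) by (simp add: F.span_subspace)
  define B' where "B' = F.extend_basis (insert e B)"
  have ind: "F.independent (insert e B)" using B(2) e span by (simp add: F.independent_insertI)
  have B': "F.independent B'" "F.span B' = UNIV" "insert e B \<subseteq> B'"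
    using F.independent_extend_basis[OF ind] F.span_extend_basis[OF ind]
      F.extend_basis_superset[OF ind] unfolding B'_def by auto
  define \<phi> where "\<phi> v = F.representation B' v e" for v
  show ?thesis
  proof (rule that[of \<phi>])
    show "\<phi> (x + y) = \<phi> x + \<phi> y" for x y
      using B' by (simp add: \<phi>_def F.representation_add)
    show "\<phi> ([:c:] *s x) = c * \<phi> x" for c x
      using B' by (simp add: \<phi>_def F.representation_scale)
    show "\<phi> e = 1" using B' by (simp add: \<phi>_def F.representation_basis)
    show "\<phi> u = 0" if "u \<in> U" for u
    proof -
      have "\<phi> u = F.representation B u e"
        unfolding \<phi>_def using F.representation_extend[OF B'(1), of u B] that span B'(3) by simp
      moreover have "e \<notin> B" using e B(1) by blast
      ultimately show ?thesis using F.representation_ne_zero[of B u e] by metis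
    qed
  qed
qed

text \<open>
  If two of the vectors \<open>f\<^sup>i v\<close> with \<open>i \<le> k\<close> coincided, then multiplying their difference by a power of \<open>f\<close> would
  show that \<open>e\<close> is a multiple of \<open>f e = 0\<close>.
\<close>

lemma finite_height:
  assumes V: "finite V" "subspace V" and e: "e \<noteq> 0" "f *s e = 0"
    and v: "v \<in> V" "f ^ k *s v = e"
  shows "k < card V"
proof -
  have "inj_on (\<lambda>i. f ^ i *s v) {..k}"
  proof (rule linorder_inj_onI)
    fix i j assume ij: "i < j" "j \<in> {..k}"
    show "f ^ i *s v \<noteq> f ^ j *s v"
    proof
      assume eq: "f ^ i *s v = f ^ j *s v"
      have *: "j = i + Suc (j - i - 1)" "k = (k - i) + i" using ij by auto
      have "e = f ^ (k - i) *s (f ^ i *s v)"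
        using v(2) by (simp flip: power_add) (use *(2) in simp)
      also have "\<dots> = f ^ (k - i) *s (f ^ j *s v)" by (simp only: eq)
      also have "\<dots> = f ^ (j - i - 1) *s (f *s (f ^ (k - i) *s (f ^ i *s v)))"
        by (subst *(1)) (simp add: power_add mult_ac del: power_Suc add: power_Suc2)
      also have "f ^ (k - i) *s (f ^ i *s v) = e"
        using v(2) by (simp flip: power_add) (use *(2) in simp)
      finally show False using e by simp
    qed
  qed auto
  moreover have "(\<lambda>i. f ^ i *s v) ` {..k} \<subseteq> V" using V v by (auto simp: subspace_scale)
  ultimately have "card {..k} \<le> card V" using V(1) card_inj_on_le by blast
  then show ?thesis by simp
qed

text \<open>
  The heart of the structure theory. Take \<open>k\<close> maximal such that \<open>e\<close> is of the form \<open>f\<^sup>k v\<close>, and a functional \<open>\<phi>\<close> that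
  vanishes on \<open>f\<^bsup>k+1\<^esup> V\<close> but not at \<open>e\<close>. The largest submodule \<open>W\<close> in the kernel of \<open>\<phi>\<close> meets the cyclic module of
  \<open>v\<close> trivially, because every nonzero submodule of that cyclic module contains \<open>e\<close>, and \<open>W\<close> is large enough to be a
  complement. No prior splitting into primary components is required, and \<open>e\<close> is prescribed; this is how the
  marked vector of the affine group ends up at the end of a chain.
\<close>

lemma cyclic_summand:
  assumes V: "finite V" "subspace V" and e: "e \<in> V" "e \<noteq> 0" and f: "irreducible f" "f *s e = 0"
  obtains k v W where "v \<in> V" "f ^ k *s v = e" "subspace W" "W \<subseteq> V"
    "V = {p *s v + w | p w. w \<in> W}" "card V = CARD('a) ^ (degree f * (k + 1)) * card W"
proof -
  define H where "H = {k. \<exists>v\<in>V. f ^ k *s v = e}"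
  have "finite H"
    by (rule finite_subset[of _ "{..<card V}"]) (use finite_height[OF V e(2) f(2)] in \<open>auto simp: H_def\<close>)
  moreover have "0 \<in> H" using e(1) by (auto simp: H_def)
  ultimately have Max: "Max H \<in> H" "\<And>k. k \<in> H \<Longrightarrow> k \<le> Max H"
    using Max_in by auto
  define k where "k = Max H"
  obtain v where v: "v \<in> V" "f ^ k *s v = e" using Max(1) by (auto simp: H_def k_def)
  define U where "U = (\<lambda>u. f ^ (k + 1) *s u) ` V"
  have "e \<notin> U"
  proof
    assume "e \<in> U"
    then have "k + 1 \<in> H" by (auto simp: U_def H_def)
    then show False using Max(2) k_def by fastforce
  qed
  moreover have "subspace U"
  proof (rule subspaceI)
    show "0 \<in> U" unfolding U_def using subspace_0[OF V(2)] by force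
  next
    fix x y assume "x \<in> U" "y \<in> U"
    then show "x + y \<in> U"
      unfolding U_def using subspace_add[OF V(2)] by (auto simp flip: scale_right_distrib)
  next
    fix c x assume "x \<in> U"
    then obtain y where "y \<in> V" "x = f ^ (k + 1) *s y" by (auto simp: U_def)
    then have "c *s y \<in> V" "c *s x = f ^ (k + 1) *s (c *s y)"
      using subspace_scale[OF V(2)] scale_left_commute by auto
    then show "c *s x \<in> U" unfolding U_def by blast
  qed
  ultimately obtain \<phi> where add: "\<And>x y. \<phi> (x + y) = \<phi> x + \<phi> y"
    and smult: "\<And>c x. \<phi> ([:c:] *s x) = c * \<phi> x" and one: "\<phi> e = 1" and zero: "\<And>u. u \<in> U \<Longrightarrow> \<phi> u = 0"
    using separating_functional by metis
  interpret \<phi>: additive \<phi> by standard (rule add)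
  have f0: "f \<noteq> 0" using f(1) by auto
  define D where "D = degree f * (k + 1)"
  have D: "D = degree (f ^ (k + 1))" unfolding D_def
    using f(1) by (subst degree_power_eq) (auto simp: mult.commute)
  define W where "W = {u \<in> V. \<forall>p. \<phi> (p *s u) = 0}"
  have W: "subspace W" "W \<subseteq> V"
    using V(2) by (auto simp: W_def subspace_def scale_right_distrib \<phi>.add \<phi>.zero)
  \<comment> \<open>\<open>W\<close> is cut out by the \<open>D\<close> functionals \<open>u \<mapsto> \<phi> (t\<^sup>i u)\<close>, \<open>i < D\<close>: a multiple of \<open>f\<^bsup>k+1\<^esup>\<close> maps \<open>V\<close> into \<open>U\<close>,
      where \<open>\<phi>\<close> vanishes. Hence \<open>W\<close> has codimension at most \<open>D\<close>.\<close>
  define \<theta> where "\<theta> u = (\<Sum>i<D. monom (\<phi> ([:0, 1:] ^ i *s u)) i)" for u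
  have coeff: "coeff (\<theta> u) i = (if i < D then \<phi> ([:0, 1:] ^ i *s u) else 0)" for u i
    by (auto simp: \<theta>_def coeff_sum if_distrib cong: if_cong)
  have ker: "{u \<in> V. \<theta> u = 0} = W"
  proof (intro equalityI subsetI)
    fix u assume u: "u \<in> {u \<in> V. \<theta> u = 0}"
    have "\<phi> (p *s u) = 0" for p
    proof -
      define r where "r = p mod f ^ (k + 1)"
      have "r \<in> polys_below D" using f(1) unfolding D r_def by (intro mod_in_polys_below) auto
      then have "r *s u = (\<Sum>i<D. [:coeff r i:] *s ([:0, 1:] ^ i *s u))"
        by (subst polys_below_expand) (simp_all add: scale_sum_left)
      moreover have "\<phi> ([:0, 1:] ^ i *s u) = 0" if "i < D" for i
        using coeff[of u i] u that by simp
      ultimately have "\<phi> (r *s u) = 0" by (simp add: \<phi>.sum smult del: scale_scale)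
      moreover have "\<phi> ((p div f ^ (k + 1) * f ^ (k + 1)) *s u) = 0"
        using u subspace_scale[OF V(2)] by (intro zero) (auto simp: U_def mult.commute simp flip: scale_scale)
      moreover have "p *s u = (p div f ^ (k + 1) * f ^ (k + 1)) *s u + r *s u"
        by (simp only: r_def div_mult_mod_eq flip: scale_left_distrib)
      ultimately show ?thesis by (simp add: add)
    qed
    then show "u \<in> W" using u by (simp add: W_def)
  qed (auto simp: W_def \<theta>_def)
  have "card V = card {u \<in> V. \<theta> u = 0} * card (\<theta> ` V)"
    using V by (intro card_kernel_times_card_image)
      (auto simp: subspace_diff \<theta>_def scale_right_diff_distrib \<phi>.diff sum_subtractf simp flip: diff_monom)
  moreover have "card (\<theta> ` V) \<le> card (polys_below D :: 'a poly set)"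
    by (rule card_mono[OF card_polys_below(1)]) (auto simp: polys_below_def coeff)
  ultimately have le: "card V \<le> CARD('a) ^ D * card W"
    by (simp add: ker card_polys_below mult.commute)
  \<comment> \<open>If \<open>p v\<close> lies in \<open>W\<close> and \<open>p = f\<^sup>j r\<close> is nonzero modulo \<open>f\<^bsup>k+1\<^esup>\<close>, multiplying by \<open>f\<^bsup>k-j\<^esup>\<close> and inverting \<open>r\<close>
      modulo \<open>f\<close> puts \<open>e\<close> into \<open>W\<close>, although \<open>\<phi> e = 1\<close>.\<close>
  have indep: "p = 0" if p: "p \<in> polys_below D" "p *s v \<in> W" for p
  proof (rule ccontr)
    assume "p \<noteq> 0"
    then obtain j r where r: "p = f ^ j * r" "\<not> f dvd r" using split_off_power[OF f(1)] by blast
    have "j * degree f \<le> degree p"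
      using \<open>p \<noteq> 0\<close> f0 unfolding r(1) by (simp add: degree_mult_eq degree_power_eq)
    also have "\<dots> < (k + 1) * degree f"
      using p(1) \<open>p \<noteq> 0\<close> by (simp add: polys_below_iff D_def mult.commute)
    finally have "j < k + 1" by (simp only: mult_less_cancel2)
    then have "j \<le> k" by simp
    have "f ^ (k - j) *s (p *s v) = (f ^ (k - j + j) * r) *s v"
      unfolding r(1) by (simp add: power_add mult.assoc)
    also have "\<dots> = r *s e"
      using \<open>j \<le> k\<close> v(2) by (simp add: mult.commute flip: scale_scale)
    finally have "r *s e \<in> W" using subspace_scale[OF W(1) p(2)] by metis
    moreover obtain b where "b *s (r *s e) = e" by (rule scale_unit_mod[OF f(1) r(2) f(2)])
    ultimately have "e \<in> W" using subspace_scale[OF W(1)] by metis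
    then have "\<phi> (1 *s e) = 0" unfolding W_def by blast
    then show False using one by simp
  qed
  let ?h = "\<lambda>(p, w). p *s v + w"
  have inj: "inj_on ?h (polys_below D \<times> W)"
  proof (rule inj_onI, clarify)
    fix p w p' w' assume *: "p \<in> polys_below D" "p' \<in> polys_below D" "w \<in> W" "w' \<in> W"
      "p *s v + w = p' *s v + w'"
    have "(p - p') *s v = w' - w" using *(5) by (simp add: algebra_simps)
    then have "(p - p') *s v \<in> W" using subspace_diff[OF W(1)] * by simp
    then have "p - p' = 0" using indep * diff_in_polys_below by blast
    then show "p = p' \<and> w = w'" using * by simp
  qed
  have sub: "?h ` (polys_below D \<times> W) \<subseteq> V"
    using V(2) v(1) W(2) by (auto intro!: subspace_add subspace_scale)
  have card: "card (?h ` (polys_below D \<times> W)) = CARD('a) ^ D * card W"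
    using card_image[OF inj] by (simp add: card_cartesian_product card_polys_below)
  have image: "?h ` (polys_below D \<times> W) = V"
    using sub le card by (intro card_subset_eq[OF V(1)]) (auto dest: card_mono[OF V(1)])
  have "V = {p *s v + w | p w. w \<in> W}"
  proof (intro equalityI subsetI)
    fix x assume "x \<in> V"
    then have "x \<in> ?h ` (polys_below D \<times> W)" using image by simp
    then show "x \<in> {p *s v + w | p w. w \<in> W}" by auto
  next
    fix x assume "x \<in> {p *s v + w | p w. w \<in> W}"
    then obtain p w where "x = p *s v + w" "w \<in> W" by blast
    then show "x \<in> V"
      using W(2) subspace_add[OF V(2) subspace_scale[OF V(2) v(1)]] by blast
  qed
  moreover have "card V = CARD('a) ^ (degree f * (k + 1)) * card W"
    using card[unfolded image] by (simp only: D_def)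
  ultimately show ?thesis using that v W by blast
qed

text \<open>
  Among the nonzero polynomials that annihilate some nonzero vector of \<open>V\<close>, one of least degree is irreducible: of a
  proper factorization \<open>a b\<close> either \<open>b\<close> kills the vector \<open>e\<close>, or \<open>a\<close> kills \<open>b e\<close>.
\<close>

lemma exists_irreducible_torsion:
  assumes V: "finite V" "subspace V" "V \<noteq> {0}"
  obtains f e where "irreducible f" "lead_coeff f = 1" "e \<in> V" "e \<noteq> 0" "f *s e = 0"
proof -
  define P where "P p \<longleftrightarrow> p \<noteq> 0 \<and> (\<exists>u\<in>V. u \<noteq> 0 \<and> p *s u = 0)" for p
  obtain u where u: "u \<in> V" "u \<noteq> 0" using V subspace_0[OF V(2)] by blast
  have "infinite (UNIV :: 'a poly set)"
  proof
    assume fin: "finite (UNIV :: 'a poly set)"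
    have "inj (\<lambda>n. monom (1::'a) n)" by (auto simp: inj_def monom_eq_iff')
    then show False using fin by (meson finite_subset infinite_UNIV_nat inj_on_finite subset_UNIV)
  qed
  moreover have "range (\<lambda>p. p *s u) \<subseteq> V" using u subspace_scale[OF V(2)] by auto
  ultimately have "\<not> inj (\<lambda>p. p *s u)" using V(1) by (meson finite_subset finite_imageD)
  then obtain p p' where "p \<noteq> p'" "p *s u = p' *s u" by (auto simp: inj_def)
  then have "P (p - p')" using u by (auto simp: P_def scale_left_diff_distrib)
  then obtain g where g: "P g" and min: "\<And>p. P p \<Longrightarrow> degree g \<le> degree p"
    using ex_has_least_nat[of P _ degree] by auto
  obtain e where e: "e \<in> V" "e \<noteq> 0" "g *s e = 0" "g \<noteq> 0" using g by (auto simp: P_def)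
  have deg: "0 < degree g"
  proof (rule ccontr)
    assume "\<not> 0 < degree g"
    then obtain c where c: "g = [:c:]" using degree_eq_zeroE by auto
    then have "e = [:inverse c:] *s (g *s e)" using e(4) by (simp flip: one_pCons)
    then show False using e by simp
  qed
  have irr: "irreducible g"
  proof (rule irreducibleI)
    fix a b assume ab: "g = a * b"
    have nz: "a \<noteq> 0" "b \<noteq> 0" using ab e(4) by auto
    show "a dvd 1 \<or> b dvd 1"
    proof (cases "b *s e = 0")
      case True
      then have "P b" using nz e by (auto simp: P_def)
      from min[OF this] have "degree a = 0" unfolding ab using nz by (simp add: degree_mult_eq)
      then show ?thesis using nz by (simp add: is_unit_iff_degree)
    next
      case False
      moreover have "a *s (b *s e) = 0" using e(3) ab by simp
      ultimately have "P a" unfolding P_def using nz e subspace_scale[OF V(2) e(1)] by blast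
      from min[OF this] have "degree b = 0" unfolding ab using nz by (simp add: degree_mult_eq)
      then show ?thesis using nz by (simp add: is_unit_iff_degree)
    qed
  qed (use e(4) deg in \<open>auto simp: is_unit_iff_degree\<close>)
  let ?f = "Polynomial.smult (inverse (lead_coeff g)) g"
  have "irreducible ?f" using irr e(4) irreducible_mult_unit_left[of "[:inverse (lead_coeff g):]" g]
    by (simp add: is_unit_iff_degree)
  moreover have "lead_coeff ?f = 1" using e(4) by simp
  moreover have "?f *s e = 0"
  proof -
    have "?f = [:inverse (lead_coeff g):] * g" by simp
    then show ?thesis using e(3) scale_scale[of "[:inverse (lead_coeff g):]" g e] by simp
  qed
  ultimately show ?thesis using that e by blast
qed

end

section \<open>Decompositions into cyclic modules and their uniqueness\<close>

definition parts_of :: "'a poly \<Rightarrow> ('a::zero poly \<times> nat) multiset \<Rightarrow> nat multiset" where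
  "parts_of f B = image_mset snd {#b \<in># B. fst b = f#}"

definition total_dim :: "('a::zero poly \<times> nat) list \<Rightarrow> nat" where
  "total_dim bl = (\<Sum>(f, m) \<leftarrow> bl. degree f * m)"

lemma total_dim_simps [simp]:
  "total_dim [] = 0" "total_dim ((f, m) # bl) = degree f * m + total_dim bl"
  "total_dim (bl @ bl') = total_dim bl + total_dim bl'"
  by (simp_all add: total_dim_def)

lemma parts_of_add_mset [simp]:
  "parts_of f (add_mset (g, m) B) = (if g = f then add_mset m (parts_of f B) else parts_of f B)"
  "parts_of f {#} = {#}"
  by (simp_all add: parts_of_def)

lemma count_parts_of: "count (parts_of f B) m = count B (f, m)"
proof (induction B)
  case (add b B)
  then show ?case by (cases b) simp
qed simp

lemma parts_of_empty: "g \<notin> fst ` set_mset B \<Longrightarrow> parts_of g B = {#}"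
  by (rule multiset_eqI) (force simp: count_parts_of not_in_iff[symmetric])

lemma parts_of_inject: "(\<And>f. parts_of f B = parts_of f B') \<Longrightarrow> B = B'"
  by (rule multiset_eqI) (metis count_parts_of surj_pair)

lemma sum_min_Suc:
  "(\<Sum>m\<in>#M. min (Suc i) m) = (\<Sum>m\<in>#M. min i m) + size {#m \<in># M. i < m#}"
  by (induction M) auto

lemma sum_min_1: "0 \<notin># M \<Longrightarrow> (\<Sum>m\<in>#M. min 1 m) = size M"
  by (induction M) auto

lemma size_filter_gt_Suc:
  "size {#m \<in># M. i < m#} = count M (Suc i) + size {#m \<in># M. Suc i < m#}"
  by (induction M) auto

text \<open>
  The second difference of \<open>i \<mapsto> \<Sum>m\<in>#M. min i m\<close> counts the entries of \<open>M\<close> that are equal to \<open>i + 1\<close>.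
\<close>

lemma multiset_determined_by_min_sums:
  assumes eq: "\<And>i::nat. (\<Sum>m\<in>#M. min i m) = (\<Sum>m\<in>#N. min i m)" and zero: "0 \<notin># M" "0 \<notin># N"
  shows "M = N"
proof (rule multiset_eqI)
  have size: "size {#m \<in># M. i < m#} = size {#m \<in># N. i < m#}" for i
    using eq[of i] eq[of "Suc i"] by (simp add: sum_min_Suc)
  fix n show "count M n = count N n"
  proof (cases n)
    case 0
    then show ?thesis using zero by (simp add: not_in_iff)
  next
    case (Suc i)
    then show ?thesis using size[of i] size[of "Suc i"] by (simp add: size_filter_gt_Suc[of i])
  qed
qed

lemma Phi_irreducible: "f \<in> Phi \<Longrightarrow> irreducible f" and Phi_nonzero: "f \<in> Phi \<Longrightarrow> f \<noteq> 0"
  by (auto simp: Phi_def)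

lemma Phi_degree_pos: "f \<in> Phi \<Longrightarrow> 0 < degree f"
  by (rule irreducible_degree_pos[OF Phi_irreducible])

lemma Phi_not_dvd:
  assumes "f \<in> Phi" "g \<in> Phi" "f \<noteq> g"
  shows "\<not> f dvd g"
proof
  assume "f dvd g"
  then obtain c where c: "g = f * c" by (elim dvdE)
  have irr: "irreducible g" using assms by (simp add: Phi_def)
  have "\<not> is_unit f" using assms by (auto simp: Phi_def irreducible_def)
  then have "is_unit c" using irreducibleD[OF irr c] by blast
  then have "degree c = 0" using is_unit_iff_degree[of c] by fastforce
  then obtain a where a: "c = [:a:]" by (rule degree_eq_zeroE)
  have "lead_coeff c = 1" using assms unfolding Phi_def c by (simp add: lead_coeff_mult)
  then have "c = 1" by (simp add: a one_pCons)
  then show False using c assms(3) by simp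
qed

lemma t_minus_1_in_Phi: "t_minus_1 \<in> Phi"
proof -
  have "irreducible (t_minus_1 :: 'a poly)" by (rule irreducible_linear_field_poly) simp
  then show ?thesis by (simp add: Phi_def)
qed

context poly_module
begin

abbreviation gens :: "('a poly \<times> nat \<times> 'b) list \<Rightarrow> 'b set" where
  "gens ds \<equiv> (\<lambda>(f, m, v). v) ` set ds"

abbreviation blocks :: "('a poly \<times> nat \<times> 'b) list \<Rightarrow> ('a poly \<times> nat) list" where
  "blocks ds \<equiv> map (\<lambda>(f, m, v). (f, m)) ds"

text \<open>
  The cyclic modules generated by the vectors of \<open>ds\<close> have at most the cardinality appearing here as a product, so
  the condition on \<open>card V\<close> says that their sum is direct and that the annihilators are exactly the powers \<open>f\<^sup>m\<close>.
\<close>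

definition cyclic_sum :: "('a poly \<times> nat \<times> 'b) list \<Rightarrow> 'b set \<Rightarrow> bool" where
  "cyclic_sum ds V \<longleftrightarrow> (\<forall>(f, m, v) \<in> set ds. f \<noteq> 0 \<and> f ^ m *s v = 0) \<and> V = span (gens ds) \<and>
     card V = CARD('a) ^ total_dim (blocks ds)"

lemma scale_mod: "g *s v = 0 \<Longrightarrow> (p mod g) *s v = p *s v"
proof -
  assume g: "g *s v = 0"
  have "p *s v = (p div g * g) *s v + (p mod g) *s v"
    by (simp only: div_mult_mod_eq flip: scale_left_distrib)
  then show ?thesis using g by (simp flip: scale_scale)
qed

lemma span_insert_eq: "span (insert v S) = {p *s v + w | p w. w \<in> span S}"
proof (intro equalityI subsetI)
  fix x assume "x \<in> span (insert v S)"
  then obtain p where "x - p *s v \<in> span S" by (auto simp: span_insert)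
  moreover have "x = p *s v + (x - p *s v)" by simp
  ultimately show "x \<in> {p *s v + w | p w. w \<in> span S}" by blast
next
  fix x assume "x \<in> {p *s v + w | p w. w \<in> span S}"
  then obtain p w where "x = p *s v + w" "w \<in> span S" by blast
  then show "x \<in> span (insert v S)" unfolding span_insert by (auto intro!: exI[of _ p])
qed

lemma span_insert_torsion:
  assumes f: "f \<noteq> 0" and v: "f ^ m *s v = 0"
  shows "span (insert v S) = (\<lambda>(p, w). p *s v + w) ` (polys_below (degree f * m) \<times> span S)"
proof (intro equalityI subsetI)
  fix x assume "x \<in> span (insert v S)"
  then obtain p where p: "x - p *s v \<in> span S" by (auto simp: span_insert)
  have deg: "degree f * m = degree (f ^ m)" using f by (simp add: degree_power_eq mult.commute)
  have "x = (p mod f ^ m) *s v + (x - p *s v)" by (simp add: scale_mod[OF v])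
  moreover have "p mod f ^ m \<in> polys_below (degree f * m)"
    unfolding deg using f by (intro mod_in_polys_below) simp
  ultimately show "x \<in> (\<lambda>(p, w). p *s v + w) ` (polys_below (degree f * m) \<times> span S)"
    using p by (intro image_eqI[of _ _ "(p mod f ^ m, x - p *s v)"]) auto
next
  fix x assume "x \<in> (\<lambda>(p, w). p *s v + w) ` (polys_below (degree f * m) \<times> span S)"
  then obtain p w where "x = p *s v + w" "w \<in> span S" by auto
  then show "x \<in> span (insert v S)" unfolding span_insert by (auto intro!: exI[of _ p])
qed

lemma card_span_gens:
  assumes "\<forall>(f, m, v) \<in> set ds. f \<noteq> 0 \<and> f ^ m *s v = 0"
  shows "finite (span (gens ds)) \<and> card (span (gens ds)) \<le> CARD('a) ^ total_dim (blocks ds)"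
  using assms
proof (induction ds)
  case (Cons a ds)
  obtain f m v where a: "a = (f, m, v)" by (cases a)
  have IH: "finite (span (gens ds))" "card (span (gens ds)) \<le> CARD('a) ^ total_dim (blocks ds)"
    using Cons by auto
  have span: "span (gens (a # ds))
      = (\<lambda>(p, w). p *s v + w) ` (polys_below (degree f * m) \<times> span (gens ds))"
    using Cons.prems unfolding a by (simp add: span_insert_torsion)
  have "card (span (gens (a # ds))) \<le> card ((polys_below (degree f * m) :: 'a poly set) \<times> span (gens ds))"
    unfolding span using IH by (intro card_image_le finite_cartesian_product card_polys_below)
  also have "\<dots> \<le> CARD('a) ^ (degree f * m) * CARD('a) ^ total_dim (blocks ds)"
    using IH by (simp add: card_cartesian_product card_polys_below)
  finally show ?case using IH unfolding span by (simp add: card_polys_below a power_add)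
qed simp

text \<open>
  The upper bounds for the cardinality of the first cyclic module and of the sum of the others are both attained, so
  the first module splits off.
\<close>

lemma cyclic_sum_ConsD:
  assumes "cyclic_sum ((f, m, v) # ds) V"
  shows "cyclic_sum ds (span (gens ds))"
    "inj_on (\<lambda>(p, w). p *s v + w) (polys_below (degree f * m) \<times> span (gens ds))"
    "V = (\<lambda>(p, w). p *s v + w) ` (polys_below (degree f * m) \<times> span (gens ds))"
proof -
  let ?q = "CARD('a)" and ?W = "span (gens ds)"
  let ?h = "\<lambda>(p, w). p *s v + w" and ?P = "(polys_below (degree f * m) :: 'a poly set) \<times> span (gens ds)"
  have ds: "\<forall>(f, m, v) \<in> set ds. f \<noteq> 0 \<and> f ^ m *s v = 0" and f: "f \<noteq> 0" "f ^ m *s v = 0"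
    and V: "V = span (insert v (gens ds))" "card V = ?q ^ (degree f * m + total_dim (blocks ds))"
    using assms by (auto simp: cyclic_sum_def)
  show image: "V = ?h ` ?P" unfolding V(1) by (rule span_insert_torsion[OF f])
  have W: "finite ?W" "card ?W \<le> ?q ^ total_dim (blocks ds)" using card_span_gens[OF ds] by auto
  have fin: "finite ?P" using W by (intro finite_cartesian_product card_polys_below)
  have cardP: "card ?P = ?q ^ (degree f * m) * card ?W"
    by (simp add: card_cartesian_product card_polys_below)
  have "card V \<le> card ?P" unfolding image by (rule card_image_le[OF fin])
  then have "?q ^ total_dim (blocks ds) \<le> card ?W" using V(2) cardP by (simp add: power_add)
  then have cardW: "card ?W = ?q ^ total_dim (blocks ds)" using W by simp
  then show "cyclic_sum ds ?W" using ds by (simp add: cyclic_sum_def)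
  have "card (?h ` ?P) = card ?P"
    using V(2) cardW cardP by (simp add: power_add flip: image)
  then show "inj_on ?h ?P" by (rule eq_card_imp_inj_on[OF fin])
qed

lemma cyclic_sum_ConsI:
  assumes f: "f \<noteq> 0" and v: "f ^ k *s v = e" "f *s e = 0" and ds: "cyclic_sum ds W"
    and sum: "V = {p *s v + w | p w. w \<in> W}" and card: "card V = CARD('a) ^ (degree f * (k + 1)) * card W"
  shows "cyclic_sum ((f, k + 1, v) # ds) V"
proof -
  have "span (gens ds) = W" using ds by (simp add: cyclic_sum_def)
  then have "V = span (insert v (gens ds))" by (simp add: span_insert_eq sum)
  moreover have "f ^ (k + 1) *s v = 0" using v scale_scale[of f "f ^ k" v] by simp
  ultimately show ?thesis using f ds card by (auto simp: cyclic_sum_def power_add)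
qed

text \<open>
  Torsion is computed summand by summand. These cardinalities are isomorphism invariants of \<open>V\<close>, and they
  determine the multiset of blocks.
\<close>

lemma card_torsion_cyclic_sum:
  assumes "cyclic_sum ds V"
  shows "card {u \<in> V. g *s u = 0}
    = (\<Prod>(f, m, v) \<leftarrow> ds. card {p \<in> polys_below (degree f * m). f ^ m dvd g * p})"
  using assms
proof (induction ds arbitrary: V)
  case Nil
  then have "{u \<in> V. g *s u = 0} = {0}" by (auto simp: cyclic_sum_def)
  then show ?case by simp
next
  case (Cons a ds)
  obtain f m v where a: "a = (f, m, v)" by (cases a)
  let ?h = "\<lambda>(p, w). p *s v + w" and ?W = "span (gens ds)"
  let ?D = "polys_below (degree f * m) :: 'a poly set"
  note c = cyclic_sum_ConsD[OF Cons.prems[unfolded a]]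
  have f: "f \<noteq> 0" "f ^ m *s v = 0" using Cons.prems by (auto simp: cyclic_sum_def a)
  have deg: "degree f * m = degree (f ^ m)" using f by (simp add: degree_power_eq mult.commute)
  have tors: "g *s (p *s v + w) = 0 \<longleftrightarrow> f ^ m dvd g * p \<and> g *s w = 0" if "w \<in> ?W" for p w
  proof
    assume "g *s (p *s v + w) = 0"
    then have "?h ((g * p) mod f ^ m, g *s w) = ?h (0, 0)"
      by (simp add: scale_mod[OF f(2)] scale_right_distrib)
    moreover have "(g * p) mod f ^ m \<in> ?D" unfolding deg using f by (intro mod_in_polys_below) simp
    ultimately have "((g * p) mod f ^ m, g *s w) = (0, 0)"
      by (intro inj_onD[OF c(2)]) (auto intro: span_scale span_zero that)
    then show "f ^ m dvd g * p \<and> g *s w = 0" by (auto simp: mod_eq_0_iff_dvd)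
  next
    assume "f ^ m dvd g * p \<and> g *s w = 0"
    moreover from this obtain r where "g * p = r * f ^ m" by (metis dvd_def mult.commute)
    ultimately show "g *s (p *s v + w) = 0"
      by (simp add: scale_right_distrib f(2) flip: scale_scale[of r])
  qed
  have "{u \<in> V. g *s u = 0} = ?h ` ({p \<in> ?D. f ^ m dvd g * p} \<times> {w \<in> ?W. g *s w = 0})"
    unfolding c(3) using tors by auto
  moreover have "inj_on ?h ({p \<in> ?D. f ^ m dvd g * p} \<times> {w \<in> ?W. g *s w = 0})"
    by (rule inj_on_subset[OF c(2)]) auto
  ultimately have "card {u \<in> V. g *s u = 0} = card {p \<in> ?D. f ^ m dvd g * p} * card {w \<in> ?W. g *s w = 0}"
    by (simp add: card_image card_cartesian_product)
  then show ?case using Cons.IH[OF c(1)] by (simp add: a)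
qed

lemma card_torsion_power:
  assumes ds: "cyclic_sum ds V" "\<forall>(f, m, v) \<in> set ds. f \<in> Phi" and g: "g \<in> Phi"
  shows "card {u \<in> V. g ^ i *s u = 0}
    = CARD('a) ^ (degree g * (\<Sum>m\<in>#parts_of g (mset (blocks ds)). min i m))"
  unfolding card_torsion_cyclic_sum[OF ds(1)] using ds(2)
proof (induction ds)
  case (Cons a ds)
  obtain f m v where a: "a = (f, m, v)" by (cases a)
  have f: "f \<in> Phi" using Cons.prems by (simp add: a)
  have IH: "(\<Prod>(f, m, v) \<leftarrow> ds. card {p \<in> polys_below (degree f * m). f ^ m dvd g ^ i * p})
      = CARD('a) ^ (degree g * (\<Sum>m\<in>#parts_of g (mset (blocks ds)). min i m))"
    using Cons by auto
  show ?case
  proof (cases "f = g")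
    case True
    then show ?thesis
      using IH by (simp add: a card_power_torsion_same[OF Phi_nonzero[OF g]] power_add distrib_left)
  next
    case False
    then show ?thesis
      using card_power_torsion_other[OF Phi_irreducible[OF f] Phi_not_dvd[OF f g False], of m i]
      by (simp add: a IH)
  qed
qed simp

lemma cyclic_sum_exists:
  assumes "finite V" "subspace V" "\<And>v. v \<in> V \<Longrightarrow> [:0, 1:] *s v = 0 \<Longrightarrow> v = 0"
  shows "\<exists>ds. cyclic_sum ds V \<and> (\<forall>(f, m, v) \<in> set ds. f \<in> Phi \<and> 0 < m)"
  using assms
proof (induction "card V" arbitrary: V rule: less_induct)
  case less
  note V = less.prems
  show ?case
  proof (cases "V = {0}")
    case True
    then have "cyclic_sum [] V" by (simp add: cyclic_sum_def)
    then show ?thesis by (intro exI[of _ "[]"]) simp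
  next
    case False
    obtain f e where f: "irreducible f" "lead_coeff f = 1" and e: "e \<in> V" "e \<noteq> 0" "f *s e = 0"
      by (rule exists_irreducible_torsion[OF V(1,2) False])
    have Phi: "f \<in> Phi" using f e V(3)[of e] by (auto simp: Phi_def)
    obtain k v W where v: "v \<in> V" "f ^ k *s v = e" and W: "subspace W" "W \<subseteq> V"
      and sum: "V = {p *s v + w | p w. w \<in> W}"
      and card: "card V = CARD('a) ^ (degree f * (k + 1)) * card W"
      by (rule cyclic_summand[OF V(1,2) e(1,2) f(1) e(3)])
    have finW: "finite W" using W(2) V(1) by (rule finite_subset)
    then have "0 < card W" using subspace_0[OF W(1)] by (auto simp: card_gt_0_iff)
    moreover have "1 < CARD('a) ^ (degree f * (k + 1))"
      using card_field_gt_1 Phi_degree_pos[OF Phi] by (intro one_less_power) auto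
    ultimately have "card W < card V" unfolding card by simp
    then obtain ds where ds: "cyclic_sum ds W" "\<forall>(f, m, v) \<in> set ds. f \<in> Phi \<and> 0 < m"
      using less.hyps[of W] finW W V(3) by blast
    have "cyclic_sum ((f, k + 1, v) # ds) V"
      using Phi_nonzero[OF Phi] v(2) e(3) ds(1) sum card by (rule cyclic_sum_ConsI)
    then show ?thesis using ds(2) Phi by (intro exI[of _ "(f, k + 1, v) # ds"]) auto
  qed
qed

text \<open>
  A decomposition adapted to a vector \<open>e\<close> with \<open>(t - 1) e = 0\<close>: this vector is the last one of a chain
  \<open>v, (t - 1) v, \<dots>, (t - 1)\<^sup>k v\<close>. Modulo \<open>e\<close> the chain has length \<open>k\<close>.
\<close>

definition affine_sum :: "nat \<Rightarrow> 'b \<Rightarrow> ('a poly \<times> nat \<times> 'b) list \<Rightarrow> 'b set \<Rightarrow> 'b \<Rightarrow> bool" where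
  "affine_sum k v ds V e \<longleftrightarrow> cyclic_sum ((t_minus_1, k + 1, v) # ds) V \<and> t_minus_1 ^ k *s v = e \<and>
     (\<forall>(f, m, v) \<in> set ds. f \<in> Phi \<and> 0 < m)"

lemma affine_sum_exists:
  assumes V: "finite V" "subspace V" "\<And>v. v \<in> V \<Longrightarrow> [:0, 1:] *s v = 0 \<Longrightarrow> v = 0"
    and e: "e \<in> V" "e \<noteq> 0" "t_minus_1 *s e = 0"
  shows "\<exists>k v ds. affine_sum k v ds V e"
proof -
  have f: "irreducible t_minus_1" by (rule Phi_irreducible[OF t_minus_1_in_Phi])
  obtain k v W where v: "v \<in> V" "t_minus_1 ^ k *s v = e" and W: "subspace W" "W \<subseteq> V"
    and sum: "V = {p *s v + w | p w. w \<in> W}"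
    and card: "card V = CARD('a) ^ (degree (t_minus_1 :: 'a poly) * (k + 1)) * card W"
    by (rule cyclic_summand[OF V(1,2) e(1,2) f e(3)])
  have finW: "finite W" using W(2) V(1) by (rule finite_subset)
  obtain ds where ds: "cyclic_sum ds W" "\<forall>(f, m, v) \<in> set ds. f \<in> Phi \<and> 0 < m"
    using cyclic_sum_exists[of W] finW W V(3) by blast
  have "cyclic_sum ((t_minus_1, k + 1, v) # ds) V"
    using Phi_nonzero[OF t_minus_1_in_Phi] v(2) e(3) ds(1) sum card by (rule cyclic_sum_ConsI)
  then show ?thesis using ds(2) v(2) unfolding affine_sum_def by blast
qed

text \<open>
  The number \<open>k\<close> is the height of \<open>e\<close>, the largest exponent such that \<open>e\<close> is divisible by \<open>(t - 1)\<^sup>k\<close> in \<open>V\<close>.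
\<close>

lemma affine_sum_height:
  assumes "affine_sum k v ds V e" "u \<in> V"
  shows "t_minus_1 ^ (k + 1) *s u \<noteq> e"
proof
  assume eq: "t_minus_1 ^ (k + 1) *s u = e"
  have s: "cyclic_sum ((t_minus_1, k + 1, v) # ds) V" and e: "t_minus_1 ^ k *s v = e"
    using assms(1) by (auto simp: affine_sum_def)
  have zero: "t_minus_1 ^ (k + 1) *s v = 0" using s by (auto simp: cyclic_sum_def)
  note c = cyclic_sum_ConsD[OF s]
  obtain p w where u: "u = p *s v + w" "w \<in> span (gens ds)" using assms(2) c(3) by auto
  have "t_minus_1 ^ (k + 1) *s u = p *s (t_minus_1 ^ (k + 1) *s v) + t_minus_1 ^ (k + 1) *s w"
    unfolding u(1) scale_right_distrib by (simp only: scale_left_commute)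
  then have "(\<lambda>(p, w). p *s v + w) (0, t_minus_1 ^ (k + 1) *s w)
      = (\<lambda>(p, w). p *s v + w) (t_minus_1 ^ k, 0)"
    unfolding eq zero prod.case e by simp
  then have "(0 :: 'a poly, t_minus_1 ^ (k + 1) *s w) = (t_minus_1 ^ k, 0)"
  proof (rule inj_onD[OF c(2)])
    show "(0, t_minus_1 ^ (k + 1) *s w)
        \<in> polys_below (degree (t_minus_1 :: 'a poly) * (k + 1)) \<times> span (gens ds)"
      using u(2) by (auto intro: span_scale simp del: power_Suc)
    show "(t_minus_1 ^ k, 0) \<in> polys_below (degree (t_minus_1 :: 'a poly) * (k + 1)) \<times> span (gens ds)"
      by (auto simp: polys_below_iff degree_power_eq span_zero)
  qed
  then have "t_minus_1 ^ k = (0 :: 'a poly)" by (simp only: prod.inject)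
  then show False by simp
qed

text \<open>
  The height of \<open>e\<close> gives \<open>k\<close>, the cardinalities of torsion give all blocks of \<open>V\<close>, and removing the block of size
  \<open>k + 1\<close> that belongs to the chain of \<open>e\<close> leaves the blocks of \<open>ds\<close>.
\<close>

lemma affine_sum_unique:
  assumes 1: "affine_sum k v ds V e" and 2: "affine_sum k' v' ds' V e"
  shows "k = k'" "mset (blocks ds) = mset (blocks ds')"
proof -
  have le: "k' \<le> k" if "affine_sum k v ds V e" "affine_sum k' v' ds' V e" for k v ds k' v' ds'
  proof (rule ccontr)
    assume "\<not> k' \<le> k"
    then have "k' = (k + 1) + (k' - k - 1)" by simp
    moreover have v': "t_minus_1 ^ k' *s v' = e" "V = span (insert v' (gens ds'))"
      using that(2) by (auto simp: affine_sum_def cyclic_sum_def)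
    ultimately have "t_minus_1 ^ (k + 1) *s (t_minus_1 ^ (k' - k - 1) *s v') = e"
      by (metis power_add scale_scale)
    moreover have "t_minus_1 ^ (k' - k - 1) *s v' \<in> V"
      unfolding v'(2) by (intro span_scale span_base) simp
    ultimately show False using affine_sum_height[OF that(1)] by blast
  qed
  show k: "k = k'" using le[OF 1 2] le[OF 2 1] by simp
  let ?B = "\<lambda>v ds. mset (blocks ((t_minus_1, k + 1, v) # ds))"
  have "parts_of g (?B v ds) = parts_of g (?B v' ds')" for g
  proof (cases "g \<in> Phi")
    case True
    have *: "card {u \<in> V. g ^ i *s u = 0}
        = CARD('a) ^ (degree g * (\<Sum>m\<in>#parts_of g (?B v ds). min i m))"
      if "affine_sum k v ds V e" for v ds i
      by (rule card_torsion_power[OF _ _ True])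
        (use that t_minus_1_in_Phi in \<open>auto simp: affine_sum_def\<close>)
    have zero: "0 \<notin># parts_of g (?B v ds)" if "affine_sum k v ds V e" for v ds
      using that by (auto simp: affine_sum_def parts_of_def)
    show ?thesis
    proof (rule multiset_determined_by_min_sums)
      fix i show "(\<Sum>m\<in>#parts_of g (?B v ds). min i m) = (\<Sum>m\<in>#parts_of g (?B v' ds'). min i m)"
      proof -
        have "CARD('a) ^ (degree g * (\<Sum>m\<in>#parts_of g (?B v ds). min i m))
            = CARD('a) ^ (degree g * (\<Sum>m\<in>#parts_of g (?B v' ds'). min i m))"
          using *[OF 1, of i] *[OF 2[folded k], of i] by (simp only:)
        then have "degree g * (\<Sum>m\<in>#parts_of g (?B v ds). min i m)
            = degree g * (\<Sum>m\<in>#parts_of g (?B v' ds'). min i m)"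
          by (simp only: power_inject_exp[OF card_field_gt_1])
        then show ?thesis by (simp only: nat_mult_eq_cancel1[OF Phi_degree_pos[OF True]])
      qed
    qed (use zero[OF 1] zero[OF 2[folded k]] in auto)
  next
    case False
    have "parts_of g (?B v ds) = {#}" if "affine_sum k v ds V e" for v ds
      using that False t_minus_1_in_Phi
      by (intro parts_of_empty) (auto simp: affine_sum_def)
    then show ?thesis using 1 2[folded k] by simp
  qed
  then have "?B v ds = ?B v' ds'" by (rule parts_of_inject)
  then show "mset (blocks ds) = mset (blocks ds')" by simp
qed

lemma card_fixed_affine_sum:
  assumes "affine_sum k v ds V e"
  shows "card {u \<in> V. t_minus_1 *s u = 0} = CARD('a) ^ (1 + size (parts_of t_minus_1 (mset (blocks ds))))"
proof -
  have "(\<Sum>m\<in>#parts_of g (mset (blocks ds)). min 1 m) = size (parts_of g (mset (blocks ds)))" for g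
  proof -
    have "0 \<notin># parts_of g (mset (blocks ds))"
      using assms by (auto simp: affine_sum_def parts_of_def)
    then show ?thesis by (rule sum_min_1)
  qed
  then show ?thesis
    using card_torsion_power[OF _ _ t_minus_1_in_Phi, of "(t_minus_1, k + 1, v) # ds" V 1] assms t_minus_1_in_Phi
    by (auto simp: affine_sum_def)
qed

end

section \<open>Bases that realize a matrix\<close>

lemma sum_lessThan_split: "(\<Sum>j<m + n. g j) = (\<Sum>j<m. g j) + (\<Sum>j<n. g (m + j))"
  for g :: "nat \<Rightarrow> 'b::comm_monoid_add"
  by (induction n) (simp_all add: add.assoc)

lemma sum_lessThan_mult: "(\<Sum>c<d * m. g c) = (\<Sum>b<m. \<Sum>i<d. g (b * d + i))"
  for g :: "nat \<Rightarrow> 'b::comm_monoid_add"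
proof (induction m)
  case (Suc m)
  have "(\<Sum>c<d * Suc m. g c) = (\<Sum>c<d * m + d. g c)" by (simp add: add.commute)
  also have "\<dots> = (\<Sum>c<d * m. g c) + (\<Sum>i<d. g (m * d + i))"
    by (simp only: sum_lessThan_split mult.commute[of d m])
  finally show ?case by (simp only: Suc.IH sum.lessThan_Suc)
qed simp

lemma J_block_dim [simp]: "dim_row (J_block m f) = degree f * m" "dim_col (J_block m f) = degree f * m"
  by (simp_all add: J_block_def Let_def)

lemma J_block_carrier: "J_block m f \<in> carrier_mat (degree f * m) (degree f * m)"
  by (simp add: J_block_def Let_def)

lemma J_block_index:
  assumes "b < m" "i < degree f" "b' < m" "i' < degree f"
  shows "J_block m f $$ (b * degree f + i, b' * degree f + i') =
    (if b' = b then companion f $$ (i, i') else if b' = b + 1 \<and> i' = i then 1 else 0)"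
proof -
  have less: "b * degree f + i < degree f * m" if "b < m" "i < degree f" for b i
  proof -
    have "b * degree f + i < (b + 1) * degree f" using that by simp
    also have "\<dots> \<le> m * degree f" using that(1) by (intro mult_right_mono) auto
    finally show ?thesis by (simp add: mult.commute)
  qed
  show ?thesis
    unfolding J_block_def Let_def using less[OF assms(1,2)] less[OF assms(3,4)] assms by simp
qed

abbreviation blocks_mat :: "('a::field poly \<times> nat) list \<Rightarrow> 'a mat" where
  "blocks_mat bl \<equiv> diag_block_mat (map (\<lambda>(f, m). J_block m f) bl)"

lemma blocks_mat_carrier: "blocks_mat bl \<in> carrier_mat (total_dim bl) (total_dim bl)"
proof (induction bl)
  case (Cons b bl)
  obtain f m where b: "b = (f, m)" by (cases b)
  show ?case
    using Cons J_block_carrier[of m f] four_block_carrier_mat[OF J_block_carrier Cons]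
    by (simp add: b Let_def)
qed simp

context poly_module
begin

lemma pCons_scale: "pCons a p *s x = [:a:] *s x + [:0, 1:] *s (p *s x)"
proof -
  have "pCons a p = [:a:] + [:0, 1:] * p" by simp
  then show ?thesis by (metis scale_left_distrib scale_scale)
qed

lemma subspace_if_variable_closed:
  assumes F: "F.subspace S" and t: "\<And>x. x \<in> S \<Longrightarrow> [:0, 1:] *s x \<in> S"
  shows "subspace S"
proof (rule subspaceI)
  show "c *s x \<in> S" if "x \<in> S" for c x
  proof (induction c)
    case 0
    then show ?case using F.subspace_0[OF F] by simp
  next
    case (pCons a p)
    show ?case
      unfolding pCons_scale[of a p]
      by (rule F.subspace_add[OF F F.subspace_scale[OF F that] t[OF pCons.IH]])
  qed
qed (use F.subspace_0[OF F] F.subspace_add[OF F] in auto)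

text \<open>
  The variable \<open>t\<close> acts on the family \<open>bs\<close> by the rows of \<open>J\<close>, up to the multiples \<open>cs\<close> of the marked vector \<open>e\<close>. When
  \<open>e\<close> is put in front of \<open>bs\<close>, the matrix of \<open>t\<close> acquires the first column \<open>cs\<close>, as in the affine canonical form.
\<close>

definition realizes :: "'b \<Rightarrow> 'a mat \<Rightarrow> 'a list \<Rightarrow> 'b list \<Rightarrow> bool" where
  "realizes e J cs bs \<longleftrightarrow> J \<in> carrier_mat (length bs) (length bs) \<and> length cs = length bs \<and>
     (\<forall>i<length bs. [:0, 1:] *s (bs ! i)
        = (\<Sum>j<length bs. [:J $$ (i, j):] *s (bs ! j)) + [:cs ! i:] *s e)"

lemma realizes_append:
  assumes J1: "J1 \<in> carrier_mat (length bs1) (length bs1)" "length cs1 = length bs1"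
    and J2: "J2 \<in> carrier_mat (length bs2) (length bs2)" "length cs2 = length bs2"
  shows "realizes e (four_block_mat J1 (0\<^sub>m (length bs1) (length bs2))
      (0\<^sub>m (length bs2) (length bs1)) J2) (cs1 @ cs2) (bs1 @ bs2)
    \<longleftrightarrow> realizes e J1 cs1 bs1 \<and> realizes e J2 cs2 bs2"
proof -
  let ?J = "four_block_mat J1 (0\<^sub>m (length bs1) (length bs2)) (0\<^sub>m (length bs2) (length bs1)) J2"
  have J: "?J \<in> carrier_mat (length bs1 + length bs2) (length bs1 + length bs2)"
    by (rule four_block_carrier_mat[OF J1(1) J2(1)])
  have 1: "(\<Sum>j<length bs1 + length bs2. [:?J $$ (i, j):] *s ((bs1 @ bs2) ! j))
      = (\<Sum>j<length bs1. [:J1 $$ (i, j):] *s (bs1 ! j))" if "i < length bs1" for i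
    using that J1 J2 by (simp add: sum_lessThan_split nth_append)
  have 2: "(\<Sum>j<length bs1 + length bs2. [:?J $$ (length bs1 + i, j):] *s ((bs1 @ bs2) ! j))
      = (\<Sum>j<length bs2. [:J2 $$ (i, j):] *s (bs2 ! j))" if "i < length bs2" for i
    using that J1 J2 by (simp add: sum_lessThan_split nth_append)
  have split: "(\<forall>i<length bs1 + length bs2. P i) \<longleftrightarrow>
      (\<forall>i<length bs1. P i) \<and> (\<forall>i<length bs2. P (length bs1 + i))" for P
  proof (intro iffI allI impI)
    fix i assume *: "(\<forall>i<length bs1. P i) \<and> (\<forall>i<length bs2. P (length bs1 + i))"
      "i < length bs1 + length bs2"
    show "P i"
    proof (cases "i < length bs1")
      case False
      then have "i = length bs1 + (i - length bs1)" "i - length bs1 < length bs2" using *(2) by auto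
      then show ?thesis using *(1) by metis
    qed (use * in simp)
  qed auto
  define P where "P i \<longleftrightarrow> [:0, 1:] *s ((bs1 @ bs2) ! i)
    = (\<Sum>j<length bs1 + length bs2. [:?J $$ (i, j):] *s ((bs1 @ bs2) ! j)) + [:(cs1 @ cs2) ! i:] *s e" for i
  have "realizes e ?J (cs1 @ cs2) (bs1 @ bs2) \<longleftrightarrow> (\<forall>i<length bs1 + length bs2. P i)"
    unfolding realizes_def P_def length_append by (simp only: J J1(2) J2(2) simp_thms)
  moreover have "P i \<longleftrightarrow> [:0, 1:] *s (bs1 ! i)
      = (\<Sum>j<length bs1. [:J1 $$ (i, j):] *s (bs1 ! j)) + [:cs1 ! i:] *s e" if "i < length bs1" for i
    unfolding P_def 1[OF that] using that J1 by (simp add: nth_append)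
  moreover have "P (length bs1 + i) \<longleftrightarrow> [:0, 1:] *s (bs2 ! i)
      = (\<Sum>j<length bs2. [:J2 $$ (i, j):] *s (bs2 ! j)) + [:cs2 ! i:] *s e" if "i < length bs2" for i
    unfolding P_def 2[OF that] using that J1 by (simp add: nth_append)
  ultimately show ?thesis using J1 J2 by (simp add: split realizes_def)
qed

text \<open>
  The linear span of \<open>e\<close> and \<open>bs\<close> is closed under \<open>t\<close>, so the submodule that they generate contains nothing more.
\<close>

lemma span_eq_F_span:
  assumes r: "realizes e J cs bs" and e: "[:0, 1:] *s e = e"
  shows "span (insert e (set bs)) = F.span (insert e (set bs))"
proof
  let ?S = "F.span (insert e (set bs))"
  have gen: "[:0, 1:] *s x \<in> ?S" if "x \<in> insert e (set bs)" for x
  proof (cases "x = e")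
    case True
    then show ?thesis using e by (simp add: F.span_base)
  next
    case False
    then have "x \<in> set bs" using that by simp
    then obtain i where i: "i < length bs" "bs ! i = x" unfolding in_set_conv_nth by blast
    have "[:0, 1:] *s x = (\<Sum>j<length bs. [:J $$ (i, j):] *s (bs ! j)) + [:cs ! i:] *s e"
      using r i unfolding realizes_def by blast
    then show ?thesis by (simp only:) (intro F.span_add F.span_sum F.span_scale F.span_base; simp)
  qed
  have "[:0, 1:] *s x \<in> ?S" if "x \<in> ?S" for x
    using that
  proof (induction rule: F.span_induct_alt)
    case base
    then show ?case by (simp add: F.span_zero)
  next
    case (step c x y)
    have "[:0, 1:] *s ([:c:] *s x + y) = [:c:] *s ([:0, 1:] *s x) + [:0, 1:] *s y"
      by (simp only: scale_right_distrib scale_left_commute)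
    then show ?case using F.span_add[OF F.span_scale[OF gen[OF step(1)]] step(2)] by metis
  qed
  then have "subspace ?S" by (intro subspace_if_variable_closed) auto
  then show "span (insert e (set bs)) \<subseteq> ?S" by (intro span_minimal) (auto intro: F.span_base)
  have "F.subspace (span (insert e (set bs)))"
    using subspace_span[of "insert e (set bs)"] by (auto simp: F.subspace_def subspace_def)
  then show "?S \<subseteq> span (insert e (set bs))" by (intro F.span_minimal) (auto intro: span_base)
qed

end

section \<open>Cyclic primary modules and generalized Jordan blocks\<close>

lemma all_lessThan_mult: "(\<forall>r<d * m. P r) \<longleftrightarrow> (\<forall>b<m. \<forall>i<d. P (b * d + i))" for d m :: nat
proof (intro iffI allI impI)
  fix b i assume *: "\<forall>r<d * m. P r" "b < m" "i < d"
  have "b * d + i < (b + 1) * d" using *(3) by simp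
  also have "\<dots> \<le> m * d" using *(2) by (intro mult_right_mono) auto
  finally show "P (b * d + i)" using *(1) by (simp add: mult.commute)
next
  fix r assume *: "\<forall>b<m. \<forall>i<d. P (b * d + i)" "r < d * m"
  have "0 < d" using *(2) by (cases d) auto
  moreover have "r div d < m" using *(2) by (simp add: less_mult_imp_div_less mult.commute)
  ultimately have "P (r div d * d + r mod d)" using *(1) by (meson mod_less_divisor)
  then show "P r" by simp
qed

lemma const_poly_power: "[:c:] ^ n = [:c ^ n:]" for c :: "'a::comm_semiring_1"
  by (induction n) (simp_all add: one_pCons mult.commute)

lemma poly_power_CHAR:
  fixes f :: "'a::{field,finite} poly"
  assumes a: "\<And>a::'a. a ^ CHAR('a) ^ N = a" and f: "f \<in> polys_below D"
  shows "f ^ CHAR('a) ^ N = (\<Sum>i<D. [:coeff f i:] * ([:0, 1:] ^ CHAR('a) ^ N) ^ i)"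
proof -
  have "f ^ CHAR('a) ^ N = (\<Sum>i<D. [:coeff f i:] * [:0, 1:] ^ i) ^ CHAR('a) ^ N"
    by (subst polys_below_expand[OF f]) (rule refl)
  also have "\<dots> = (\<Sum>i<D. ([:coeff f i:] * [:0, 1:] ^ i) ^ CHAR('a) ^ N)"
    by (rule freshmans_dream_sum'[where n = N]) (simp_all add: prime_CHAR_finite_field)
  also have "\<dots> = (\<Sum>i<D. [:coeff f i:] * ([:0, 1:] ^ CHAR('a) ^ N) ^ i)"
  proof (intro sum.cong refl)
    fix i
    have "([:0, 1::'a:] ^ i) ^ CHAR('a) ^ N = ([:0, 1:] ^ CHAR('a) ^ N) ^ i"
      by (simp only: power_mult[symmetric] mult.commute)
    then show "([:coeff f i:] * [:0, 1:] ^ i) ^ CHAR('a) ^ N = [:coeff f i:] * ([:0, 1:] ^ CHAR('a) ^ N) ^ i"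
      by (simp only: power_mult_distrib const_poly_power a)
  qed
  finally show ?thesis .
qed

text \<open>
  The product of \<open>t\<close> and a residue has at most the degree of the monic polynomial \<open>f\<close>, so subtracting one constant
  multiple of \<open>f\<close> reduces it. This is how the companion matrix arises.
\<close>

lemma shift_mod:
  fixes f w :: "'a::field poly"
  assumes "lead_coeff f = 1" "degree f = Suc d"
  shows "([:0, 1:] * w) mod f = [:0, 1:] * (w mod f) - [:coeff (w mod f) d:] * f"
proof -
  define r where "r = w mod f"
  have "f \<noteq> 0" using assms(2) by auto
  then have r: "r \<in> polys_below (Suc d)"
    using mod_in_polys_below[of f w] assms(2) by (simp add: r_def)
  have "[:0, 1:] * r - [:coeff r d:] * f \<in> polys_below (Suc d)"
    unfolding polys_below_def
  proof (intro CollectI allI impI)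
    fix i assume "Suc d \<le> i"
    then obtain j where j: "i = Suc j" "d \<le> j" by (cases i) auto
    show "coeff ([:0, 1:] * r - [:coeff r d:] * f) i = 0"
    proof (cases "j = d")
      case True
      then show ?thesis using assms by (simp add: j)
    next
      case False
      then have "coeff r j = 0" "coeff f i = 0"
        using j r assms by (auto simp: polys_below_def coeff_eq_0)
      then show ?thesis by (simp add: j)
    qed
  qed
  then have "[:0, 1:] * r - [:coeff r d:] * f = ([:0, 1:] * r - [:coeff r d:] * f) mod f"
    using assms(2) by (auto simp: polys_below_iff mod_poly_less)
  also have "\<dots> = ([:0, 1:] * r) mod f" by (simp add: mod_diff_right_eq[symmetric] del: mult_pCons_left)
  also have "\<dots> = ([:0, 1:] * w) mod f" unfolding r_def by (rule mod_mult_right_eq)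
  finally show ?thesis by (simp only: r_def)
qed

context poly_module
begin

lemma companion_row:
  assumes "i < degree f"
  shows "(\<Sum>j<degree f. [:companion f $$ (i, j):] *s g j)
    = (if i + 1 < degree f then g (i + 1) else - (\<Sum>j<degree f. [:coeff f j:] *s g j))"
proof (cases "i + 1 < degree f")
  case True
  have "(\<Sum>j<degree f. [:companion f $$ (i, j):] *s g j)
      = (\<Sum>j<degree f. if j = i + 1 then g j else 0)"
    using True by (intro sum.cong) (auto simp: companion_def one_pCons[symmetric])
  then show ?thesis using True by simp
next
  case False
  have "(\<Sum>j<degree f. [:companion f $$ (i, j):] *s g j)
      = (\<Sum>j<degree f. - ([:coeff f j:] *s g j))"
  proof (intro sum.cong refl)
    fix j assume "j \<in> {..<degree f}"
    then have "[:companion f $$ (i, j):] = - [:coeff f j:]"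
      using False assms by (simp add: companion_def)
    then show "[:companion f $$ (i, j):] *s g j = - ([:coeff f j:] *s g j)" by (simp only: scale_minus_left)
  qed
  then show ?thesis using False by (simp add: sum_negf)
qed

lemma J_block_row:
  assumes b: "b < m" "i < degree f"
  shows "(\<Sum>c<degree f * m. [:J_block m f $$ (b * degree f + i, c):] *s g c)
    = (if i + 1 < degree f then g (b * degree f + (i + 1))
       else - (\<Sum>j<degree f. [:coeff f j:] *s g (b * degree f + j)))
      + (if b + 1 < m then g ((b + 1) * degree f + i) else 0)"
proof -
  let ?d = "degree f"
  let ?A = "\<Sum>j<?d. [:companion f $$ (i, j):] *s g (b * ?d + j)"
  have inner: "(\<Sum>j<?d. [:J_block m f $$ (b * ?d + i, b' * ?d + j):] *s g (b' * ?d + j))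
      = (if b' = b then ?A else 0) + (if b' = b + 1 then g ((b + 1) * ?d + i) else 0)" if "b' < m" for b'
  proof -
    have "(\<Sum>j<?d. [:J_block m f $$ (b * ?d + i, b' * ?d + j):] *s g (b' * ?d + j))
        = (\<Sum>j<?d. (if b' = b then [:companion f $$ (i, j):] *s g (b * ?d + j) else 0)
            + (if j = i then if b' = b + 1 then g ((b + 1) * ?d + j) else 0 else 0))"
      using b that by (intro sum.cong) (auto simp: J_block_index one_pCons[symmetric])
    then show ?thesis using b(2) by (simp add: sum.distrib)
  qed
  have "(\<Sum>c<?d * m. [:J_block m f $$ (b * ?d + i, c):] *s g c)
      = (\<Sum>b'<m. (if b' = b then ?A else 0) + (if b' = b + 1 then g ((b + 1) * ?d + i) else 0))"
    unfolding sum_lessThan_mult by (rule sum.cong) (simp_all add: inner)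
  also have "\<dots> = ?A + (if b + 1 < m then g ((b + 1) * ?d + i) else 0)"
    using b(1) by (simp add: sum.distrib)
  finally show ?thesis using companion_row[OF b(2), of "\<lambda>j. g (b * ?d + j)"] by simp
qed

lemma realizes_J_block_iff:
  assumes "length bs = degree f * m" "length cs = degree f * m"
  shows "realizes e (J_block m f) cs bs \<longleftrightarrow> (\<forall>b<m. \<forall>i<degree f. [:0, 1:] *s (bs ! (b * degree f + i))
      = (if i + 1 < degree f then bs ! (b * degree f + (i + 1))
         else - (\<Sum>j<degree f. [:coeff f j:] *s (bs ! (b * degree f + j))))
        + (if b + 1 < m then bs ! ((b + 1) * degree f + i) else 0) + [:cs ! (b * degree f + i):] *s e)"
  unfolding realizes_def assms all_lessThan_mult
  using J_block_carrier[of m f] J_block_row[of _ m _ f "\<lambda>c. bs ! c"] by simp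

text \<open>
  On a cyclic module with annihilator \<open>f\<^sup>m\<close> write \<open>t = x + s\<close>, where \<open>x = t\<^sup>Q\<close> for a power \<open>Q \<ge> m\<close> of the
  characteristic that fixes the ground field and satisfies \<open>t\<^sup>Q \<equiv> t\<close> modulo \<open>f\<close>. Then \<open>f (x) = f (t)\<^sup>Q\<close> acts as zero,
  and so does \<open>s\<^sup>m\<close>, since \<open>f\<close> divides \<open>s\<close>. The vectors \<open>x\<^sup>i s\<^sup>b v\<close> therefore realize the block matrix with
  companion blocks on the diagonal and identity blocks next to them.
\<close>

lemma block_basis:
  assumes f: "f \<in> Phi" and m: "0 < m" and v: "f ^ m *s v = 0"
  shows "\<exists>bs. length bs = degree f * m \<and> realizes e (J_block m f) (replicate (degree f * m) 0) bs \<and>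
    v \<in> set bs \<and> set bs \<subseteq> span {v}"
proof -
  let ?d = "degree f" and ?t = "[:0, 1:] :: 'a poly"
  obtain N where N: "m \<le> CHAR('a) ^ N" "\<And>a::'a. a ^ CHAR('a) ^ N = a" "f dvd ?t ^ CHAR('a) ^ N - ?t"
    by (rule Frobenius_period[OF Phi_irreducible[OF f], of m]) blast
  define Q where "Q = CHAR('a) ^ N"
  define X where "X = ?t ^ Q"
  define S where "S = ?t - X"
  have t: "?t = X + S" by (simp add: S_def)
  have d: "0 < ?d" using f by (rule Phi_degree_pos)
  have "f dvd S" using N(3) dvd_minus_iff[of f S] unfolding S_def X_def Q_def by simp
  then have Sm: "S ^ m *s v = 0"
  proof -
    obtain c where "S = c * f" using \<open>f dvd S\<close> by (metis dvd_def mult.commute)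
    then have "S ^ m *s v = c ^ m *s (f ^ m *s v)" by (simp add: power_mult_distrib)
    then show ?thesis using v by simp
  qed
  have fX: "(\<Sum>i<?d. [:coeff f i:] * X ^ i) + X ^ ?d = f ^ Q"
  proof -
    have "f \<in> polys_below (Suc ?d)" by (simp add: polys_below_iff)
    from poly_power_CHAR[OF N(2) this] show ?thesis
      using f unfolding Q_def X_def by (simp add: Phi_def one_pCons[symmetric])
  qed
  have fQ: "f ^ Q *s v = 0"
  proof -
    have "f ^ Q = f ^ (Q - m) * f ^ m" using N(1) by (simp add: Q_def flip: power_add)
    then have "f ^ Q *s v = f ^ (Q - m) *s (f ^ m *s v)" by simp
    then show ?thesis using v by simp
  qed
  have Xd: "X ^ ?d *s w = - (\<Sum>i<?d. [:coeff f i:] *s (X ^ i *s w))" if "f ^ Q *s w = 0" for w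
  proof -
    have "(\<Sum>i<?d. [:coeff f i:] *s (X ^ i *s w)) + X ^ ?d *s w = f ^ Q *s w"
      unfolding fX[symmetric] by (simp add: scale_left_distrib scale_sum_left)
    then show ?thesis using that by (simp add: eq_neg_iff_add_eq_0 add.commute)
  qed
  define bs where "bs = map (\<lambda>r. X ^ (r mod ?d) *s (S ^ (r div ?d) *s v)) [0..<?d * m]"
  have len: "length bs = ?d * m" by (simp add: bs_def)
  have nth: "bs ! (b * ?d + i) = X ^ i *s (S ^ b *s v)" if "b < m" "i < ?d" for b i
  proof -
    have "b * ?d + i < ?d * m" using all_lessThan_mult[of ?d m "\<lambda>r. r < ?d * m"] that by blast
    then show ?thesis using that by (simp add: bs_def del: scale_scale)
  qed
  have "realizes e (J_block m f) (replicate (?d * m) 0) bs"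
  proof (subst realizes_J_block_iff, goal_cases)
    case 3
    show ?case
    proof (intro allI impI)
      fix b i assume b: "b < m" and i: "i < ?d"
      have "b * ?d + i < ?d * m" using all_lessThan_mult[of ?d m "\<lambda>r. r < ?d * m"] b i by blast
      then have zero: "replicate (?d * m) 0 ! (b * ?d + i) = (0::'a)" by simp
      have "?t *s (X ^ i *s (S ^ b *s v)) = X ^ (i + 1) *s (S ^ b *s v) + X ^ i *s (S ^ (b + 1) *s v)"
        by (subst t) (simp add: algebra_simps)
      moreover have "X ^ (i + 1) *s (S ^ b *s v) = (if i + 1 < ?d then bs ! (b * ?d + (i + 1))
         else - (\<Sum>j<?d. [:coeff f j:] *s (bs ! (b * ?d + j))))"
      proof (cases "i + 1 < ?d")
        case False
        then have "i + 1 = ?d" using i by simp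
        moreover have "f ^ Q *s (S ^ b *s v) = 0" using fQ scale_left_commute[of "f ^ Q" "S ^ b" v] by simp
        ultimately show ?thesis
          using False Xd by (simp add: nth[OF b] del: scale_scale power_Suc)
      next
        case True
        then show ?thesis using nth[OF b True] by simp
      qed
      moreover have "X ^ i *s (S ^ (b + 1) *s v) = (if b + 1 < m then bs ! ((b + 1) * ?d + i) else 0)"
      proof (cases "b + 1 < m")
        case True
        then show ?thesis using nth[OF True i] by simp
      next
        case False
        then have "b + 1 = m" using b by simp
        then show ?thesis using Sm by (simp del: scale_scale power_Suc)
      qed
      ultimately show "?t *s (bs ! (b * ?d + i))
          = (if i + 1 < ?d then bs ! (b * ?d + (i + 1))
             else - (\<Sum>j<?d. [:coeff f j:] *s (bs ! (b * ?d + j))))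
            + (if b + 1 < m then bs ! ((b + 1) * ?d + i) else 0)
            + [:replicate (?d * m) 0 ! (b * ?d + i):] *s e"
        unfolding nth[OF b i] zero by (simp only: pCons_0_0 scale_zero_left add_0_right)
    qed
  qed (simp_all add: len)
  moreover have "v \<in> set bs"
  proof -
    have "bs ! (0 * ?d + 0) = v" using nth[OF m d] by simp
    moreover have "0 < length bs" using m d by (simp add: len)
    ultimately show ?thesis using nth_mem[of 0 bs] by simp
  qed
  moreover have "set bs \<subseteq> span {v}" by (auto simp: bs_def span_singleton)
  ultimately show ?thesis using len by blast
qed

text \<open>
  Conversely, let \<open>p b i\<close> satisfy the relations of the block matrix. They extend to a linear map \<open>\<phi>\<close> from polynomials
  in two variables, \<open>x\<close> and \<open>s\<close>, with \<open>\<phi> (x\<^sup>i s\<^sup>b) = p b i\<close>, which turns multiplication by \<open>x + s\<close> into the action of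
  \<open>t\<close> and kills the multiples of \<open>f (x)\<close> and of \<open>s\<^sup>m\<close>. The action of \<open>x\<close> is recovered from that of \<open>t\<close> by a Frobenius
  power, so everything is generated by \<open>\<phi> 1 = p 0 0\<close>. As \<open>f (x + s)\<close> is congruent to a multiple of \<open>s\<close> modulo
  \<open>f (x)\<close>, its \<open>m\<close>-th power acts as zero.
\<close>

lemma block_relations_imp_cyclic:
  assumes f: "f \<in> Phi"
    and rel: "\<And>b i. b < m \<Longrightarrow> i < degree f \<Longrightarrow> [:0, 1:] *s p b i
      = (if i + 1 < degree f then p b (i + 1) else - (\<Sum>j<degree f. [:coeff f j:] *s p b j))
        + (if b + 1 < m then p (b + 1) i else 0)"
    and m: "0 < m"
  shows "f ^ m *s p 0 0 = 0" "\<And>b i. b < m \<Longrightarrow> i < degree f \<Longrightarrow> p b i \<in> span {p 0 0}"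
proof -
  let ?t = "[:0, 1:] :: 'a poly"
  obtain d where d: "degree f = Suc d" using Phi_degree_pos[OF f] by (cases "degree f") auto
  obtain m' where m': "m = Suc m'" using m by (cases m) auto
  have lead: "lead_coeff f = 1" using f by (simp add: Phi_def)
  define x :: "'a poly poly" where "x = [:?t:]"
  define s :: "'a poly poly" where "s = [:0, 1:]"
  define \<phi> where "\<phi> u = (\<Sum>b<m. \<Sum>i<degree f. [:coeff (coeff u b mod f) i:] *s p b i)" for u
  have add: "\<phi> (u + w) = \<phi> u + \<phi> w" for u w
    by (simp add: \<phi>_def poly_mod_add_left F.scale_left_distrib sum.distrib)
  have cong: "\<phi> u = \<phi> w" if "\<And>b. b < m \<Longrightarrow> coeff u b mod f = coeff w b mod f" for u w
    using that by (simp add: \<phi>_def)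
  have null: "\<phi> u = 0" if "\<And>b. b < m \<Longrightarrow> coeff u b mod f = 0" for u
    using that by (simp add: \<phi>_def)
  have const: "\<phi> ([:[:a:]:] * u) = [:a:] *s \<phi> u" for a u
    by (simp add: \<phi>_def mod_smult_left scale_sum_right mult.commute)
  have unit: "\<phi> (monom (monom 1 i) b) = p b i" if "b < m" "i < degree f" for b i
  proof -
    have "monom 1 i mod f = monom 1 i" using that(2) by (simp add: mod_poly_less degree_monom_eq)
    then have "\<phi> (monom (monom 1 i) b) = (\<Sum>b'<m. \<Sum>i'<degree f. if i' = i then if b' = b then p b' i' else 0 else 0)"
      unfolding \<phi>_def by (intro sum.cong refl) (auto simp: one_pCons[symmetric])
    then show ?thesis using that by simp
  qed
  have mult_x: "\<phi> (x * u) = (\<Sum>b<m. \<Sum>i<degree f. [:coeff (coeff u b mod f) i:] *s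
      (if i + 1 < degree f then p b (i + 1) else - (\<Sum>j<degree f. [:coeff f j:] *s p b j)))" for u
  proof -
    have "(\<Sum>i<degree f. [:coeff ((?t * w) mod f) i:] *s g i) = (\<Sum>i<degree f. [:coeff (w mod f) i:] *s
      (if i + 1 < degree f then g (i + 1) else - (\<Sum>j<degree f. [:coeff f j:] *s g j)))" for w and g :: "nat \<Rightarrow> 'b"
    proof -
      define r where "r = w mod f"
      define T where "T = (\<Sum>j<degree f. [:coeff f j:] *s g j)"
      have "[:coeff ((?t * w) mod f) i:] *s g i
          = [:coeff (pCons 0 r) i:] *s g i - [:coeff r d:] *s ([:coeff f i:] *s g i)" for i
        unfolding shift_mod[OF lead d] r_def by (simp add: scale_left_diff_distrib[symmetric])
      then have "(\<Sum>i<degree f. [:coeff ((?t * w) mod f) i:] *s g i)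
          = (\<Sum>i<Suc d. [:coeff (pCons 0 r) i:] *s g i) - [:coeff r d:] *s (\<Sum>i<degree f. [:coeff f i:] *s g i)"
        by (simp add: sum_subtractf scale_sum_right d del: sum.lessThan_Suc scale_scale)
      also have "(\<Sum>i<Suc d. [:coeff (pCons 0 r) i:] *s g i) = (\<Sum>i<d. [:coeff r i:] *s g (i + 1))"
        by (simp add: sum.lessThan_Suc_shift del: sum.lessThan_Suc)
      finally have "(\<Sum>i<degree f. [:coeff ((?t * w) mod f) i:] *s g i)
          = (\<Sum>i<d. [:coeff r i:] *s g (i + 1)) - [:coeff r d:] *s T"
        unfolding T_def .
      moreover have "(\<Sum>i<degree f. [:coeff r i:] *s (if i + 1 < degree f then g (i + 1) else - T))
          = (\<Sum>i<d. [:coeff r i:] *s g (i + 1)) + [:coeff r d:] *s (- T)"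
        by (simp add: d)
      ultimately show ?thesis unfolding T_def[symmetric] r_def[symmetric] by simp
    qed
    then show ?thesis by (simp add: \<phi>_def x_def)
  qed
  have mult_s: "\<phi> (s * u) = (\<Sum>b<m. \<Sum>i<degree f. [:coeff (coeff u b mod f) i:] *s
      (if b + 1 < m then p (b + 1) i else 0))" for u
  proof -
    have "\<phi> (s * u) = (\<Sum>b<m'. \<Sum>i<degree f. [:coeff (coeff u b mod f) i:] *s p (b + 1) i)"
      unfolding \<phi>_def s_def m' sum.lessThan_Suc_shift by simp
    moreover have "(\<Sum>b<m. \<Sum>i<degree f. [:coeff (coeff u b mod f) i:] *s (if b + 1 < m then p (b + 1) i else 0))
        = (\<Sum>b<m'. \<Sum>i<degree f. [:coeff (coeff u b mod f) i:] *s p (b + 1) i)"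
      unfolding m' sum.lessThan_Suc by simp
    ultimately show ?thesis by simp
  qed
  have mult_t: "?t *s \<phi> u = \<phi> ((x + s) * u)" for u
  proof -
    have "?t *s \<phi> u = (\<Sum>b<m. \<Sum>i<degree f. [:coeff (coeff u b mod f) i:] *s (?t *s p b i))"
      unfolding \<phi>_def scale_sum_right by (simp only: scale_left_commute)
    also have "\<dots> = \<phi> (x * u) + \<phi> (s * u)"
      unfolding mult_x mult_s by (simp add: rel scale_right_distrib sum.distrib)
    finally show ?thesis by (simp only: distrib_right add)
  qed
  have mult_power: "?t ^ k *s \<phi> u = \<phi> ((x + s) ^ k * u)" for k u
  proof (induction k)
    case (Suc k)
    have "?t ^ Suc k *s \<phi> u = ?t *s (?t ^ k *s \<phi> u)" by simp
    then show ?case by (simp only: Suc.IH mult_t power_Suc mult.assoc)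
  qed simp
  have low: "\<phi> (s ^ k * u) = 0" if "m \<le> k" for k u
  proof (rule null)
    have "s ^ k = monom 1 k" by (simp add: s_def monom_altdef)
    then show "coeff (s ^ k * u) b mod f = 0" if "b < m" for b
      using that \<open>m \<le> k\<close> by (simp add: coeff_monom_mult)
  qed
  \<comment> \<open>Raised to a suitable power of the characteristic, \<open>x + s\<close> becomes \<open>x\<close> modulo \<open>f\<close> and \<open>s\<^sup>m\<close>; this makes the
      action of \<open>x\<close>, hence that of \<open>s\<close>, a polynomial in \<open>t\<close>.\<close>
  obtain N where N: "m \<le> CHAR('a) ^ N" "f dvd ?t ^ CHAR('a) ^ N - ?t"
    by (rule Frobenius_period[OF Phi_irreducible[OF f], of m]) blast
  define X where "X = ?t ^ CHAR('a) ^ N"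
  have act_X: "X *s \<phi> u = \<phi> (x * u)" for u
  proof -
    have "(x + s) ^ CHAR('a) ^ N = x ^ CHAR('a) ^ N + s ^ CHAR('a) ^ N"
      by (rule freshmans_dream'[where n = N]) (simp_all add: prime_CHAR_finite_field)
    then have "X *s \<phi> u = \<phi> (x ^ CHAR('a) ^ N * u)"
      unfolding X_def mult_power by (simp add: distrib_right add low[OF N(1)])
    also have "\<dots> = \<phi> (x * u)"
    proof (rule cong)
      fix b
      have "X mod f = ?t mod f" using N(2) by (simp add: X_def mod_eq_dvd_iff)
      then have "(X * coeff u b) mod f = (?t * coeff u b) mod f" by (metis mod_mult_left_eq)
      then show "coeff (x ^ CHAR('a) ^ N * u) b mod f = coeff (x * u) b mod f"
        by (simp add: x_def const_poly_power X_def)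
    qed
    finally show ?thesis .
  qed
  have act_S: "(?t - X) *s \<phi> u = \<phi> (s * u)" for u
    by (simp add: scale_left_diff_distrib mult_t act_X distrib_right add)
  have act: "X ^ i *s ((?t - X) ^ b *s \<phi> u) = \<phi> (x ^ i * (s ^ b * u))" for i b u
  proof -
    have S: "(?t - X) ^ b *s \<phi> u = \<phi> (s ^ b * u)" for b u
    proof (induction b)
      case (Suc b)
      have "(?t - X) ^ Suc b *s \<phi> u = (?t - X) *s ((?t - X) ^ b *s \<phi> u)" by simp
      then show ?case by (simp only: Suc.IH act_S power_Suc mult.assoc)
    qed simp
    have "X ^ i *s \<phi> u = \<phi> (x ^ i * u)" for i u
    proof (induction i)
      case (Suc i)
      have "X ^ Suc i *s \<phi> u = X *s (X ^ i *s \<phi> u)" by simp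
      then show ?case by (simp only: Suc.IH act_X power_Suc mult.assoc)
    qed simp
    then show ?thesis by (simp only: S)
  qed
  have one: "\<phi> 1 = p 0 0" using unit[of 0 0] m d by (simp add: monom_0 one_pCons)
  show "p b i \<in> span {p 0 0}" if "b < m" "i < degree f" for b i
  proof -
    have "x ^ i * (s ^ b * 1) = monom (monom 1 i) b"
      by (simp add: x_def s_def const_poly_power monom_altdef)
    then have "p b i = X ^ i *s ((?t - X) ^ b *s \<phi> 1)" unfolding act using unit[OF that] by simp
    then show ?thesis unfolding one by (auto simp: span_singleton)
  qed
  \<comment> \<open>The Taylor expansion \<open>g (x + s) = g (x) + s h\<close>.\<close>
  have "\<exists>h. \<forall>u. g *s \<phi> u = \<phi> ([:g:] * u) + \<phi> (s * (h * u))" for g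
  proof (induction g)
    case 0
    show ?case by (rule exI[of _ 0]) (simp add: null)
  next
    case (pCons a g)
    then obtain h where h: "\<And>u. g *s \<phi> u = \<phi> ([:g:] * u) + \<phi> (s * (h * u))" by blast
    have "pCons a g *s \<phi> u = \<phi> ([:pCons a g:] * u) + \<phi> (s * (([:g:] + x * h + s * h) * u))" for u
    proof -
      have "pCons a g *s \<phi> u = \<phi> ([:[:a:]:] * u) + \<phi> ((x + s) * ([:g:] * u)) + \<phi> ((x + s) * (s * (h * u)))"
        by (simp only: pCons_scale[of a g] const h scale_right_distrib mult_t add.assoc)
      also have "\<dots> = \<phi> ([:[:a:]:] * u + (x + s) * ([:g:] * u) + (x + s) * (s * (h * u)))"
        by (simp only: add)
      also have "[:[:a:]:] * u + (x + s) * ([:g:] * u) + (x + s) * (s * (h * u))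
          = ([:[:a:]:] + x * [:g:]) * u + s * (([:g:] + x * h + s * h) * u)"
        by (simp only: algebra_simps)
      also have "[:[:a:]:] + x * [:g:] = [:pCons a g:]" by (simp add: x_def)
      finally show ?thesis by (simp only: add)
    qed
    then show ?case by blast
  qed
  then obtain h where h: "\<And>u. f *s \<phi> u = \<phi> ([:f:] * u) + \<phi> (s * (h * u))" by blast
  have "f ^ k *s \<phi> u = \<phi> (s ^ k * (h ^ k * u))" for k u
  proof (induction k)
    case (Suc k)
    have "f ^ Suc k *s \<phi> u = f *s (f ^ k *s \<phi> u)" by simp
    also have "\<dots> = \<phi> (s * (h * (s ^ k * (h ^ k * u))))"
      unfolding Suc.IH h by (simp add: null)
    finally show ?case by (simp add: mult_ac)
  qed simp
  then show "f ^ m *s p 0 0 = 0" unfolding one[symmetric] by (simp add: low)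
qed

lemma block_basis_imp_cyclic:
  assumes f: "f \<in> Phi" and m: "0 < m" and len: "length bs = degree f * m"
    and r: "realizes e (J_block m f) (replicate (degree f * m) 0) bs"
  shows "\<exists>v \<in> set bs. f ^ m *s v = 0 \<and> set bs \<subseteq> span {v}"
proof -
  let ?d = "degree f"
  define p where "p b i = bs ! (b * ?d + i)" for b i
  have less: "b * ?d + i < ?d * m" if "b < m" "i < ?d" for b i
    using all_lessThan_mult[of ?d m "\<lambda>r. r < ?d * m"] that by blast
  have rel: "[:0, 1:] *s p b i
      = (if i + 1 < ?d then p b (i + 1) else - (\<Sum>j<?d. [:coeff f j:] *s p b j))
        + (if b + 1 < m then p (b + 1) i else 0)" if "b < m" "i < ?d" for b i
    using r that less[OF that] by (simp add: realizes_J_block_iff len p_def)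
  have "bs ! c \<in> span {p 0 0}" if "c < ?d * m" for c
  proof -
    have "\<forall>c<?d * m. bs ! c \<in> span {p 0 0}"
      unfolding all_lessThan_mult using block_relations_imp_cyclic(2)[OF f rel m] by (simp add: p_def)
    then show ?thesis using that by blast
  qed
  then have "set bs \<subseteq> span {p 0 0}" by (auto simp: set_conv_nth len)
  moreover have "p 0 0 \<in> set bs" using m Phi_degree_pos[OF f] by (simp add: p_def len)
  ultimately show ?thesis using block_relations_imp_cyclic(1)[OF f rel m] by blast
qed

end

section \<open>Partition-valued functions as lists of blocks\<close>

text \<open>
  The diagonal blocks of \<open>J_linear lam\<close>, each given by its polynomial and size, in their order on the diagonal.
\<close>

definition block_list :: "'a::field ptn_fun \<Rightarrow> ('a poly \<times> nat) list" where
  "block_list lam =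
    concat (map (\<lambda>i. replicate (count (lam t_minus_1) i) (t_minus_1, i))
      (sorted_list_of_set (set_mset (lam t_minus_1)))) @
    concat (map (\<lambda>f. map (Pair f) (rev (sorted_list_of_multiset (lam f)))) (support_list lam))"

lemma diag_block_mat_concat: "diag_block_mat (map diag_block_mat Ass) = diag_block_mat (concat Ass)"
  by (induction Ass) (simp_all add: diag_block_mat_append Let_def)

lemma J_linear_eq_blocks_mat: "J_linear lam = blocks_mat (block_list lam)"
proof -
  let ?xs = "sorted_list_of_set (set_mset (lam t_minus_1))"
  have "map (E_part lam) ?xs @ [J_minus lam] = map diag_block_mat
      (map (\<lambda>i. replicate (count (lam t_minus_1) i) (J_block i t_minus_1)) ?xs @
       [concat (map (\<lambda>f. map (\<lambda>m. J_block m f) (rev (sorted_list_of_multiset (lam f)))) (support_list lam))])"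
    by (simp add: E_part_def J_minus_def)
  then show ?thesis
    unfolding J_linear_def by (simp only: diag_block_mat_concat)
      (simp add: block_list_def map_concat comp_def)
qed

lemma support_list:
  assumes "lam \<in> ptn_funs"
  shows "distinct (support_list lam)" "set (support_list lam) = {f. f \<noteq> t_minus_1 \<and> lam f \<noteq> {#}}"
proof -
  have "finite {f. f \<noteq> t_minus_1 \<and> lam f \<noteq> {#}}"
    using assms by (auto simp: ptn_funs_def intro: finite_subset[rotated])
  then have "\<exists>fs. distinct fs \<and> set fs = {f. f \<noteq> t_minus_1 \<and> lam f \<noteq> {#}}"
    using finite_distinct_list by blast
  from someI_ex[OF this] show "distinct (support_list lam)"
    "set (support_list lam) = {f. f \<noteq> t_minus_1 \<and> lam f \<noteq> {#}}"
    by (simp_all add: support_list_def)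
qed

lemma count_block_list:
  assumes lam: "lam \<in> ptn_funs"
  shows "count (mset (block_list lam)) (f, m) = count (lam f) m"
proof -
  have 1: "count (mset (concat (map (\<lambda>i. replicate (c i) (g, i)) xs))) (f, m)
      = (if f = g \<and> m \<in> set xs then c m else 0)" if "distinct xs" for c :: "nat \<Rightarrow> nat" and g xs
    using that by (induction xs) auto
  have P: "count (image_mset (Pair g) M) (f, m) = (if f = g then count M m else 0)"
    for f g :: "'a poly" and M and m :: nat
    by (induction M) auto
  have 2: "count (mset (concat (map (\<lambda>g. map (Pair g) (L g)) fs))) (f, m)
      = (if f \<in> set fs then count (mset (L f)) m else 0)" if "distinct fs" for L fs
    using that
  proof (induction fs)
    case (Cons g fs)
    then have "distinct fs" by simp
    note IH = Cons.IH[OF this]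
    show ?case
      unfolding list.map concat.simps mset_append count_union mset_map P IH using Cons.prems by auto
  qed simp
  have "count (mset (block_list lam)) (f, m)
      = (if f = t_minus_1 \<and> m \<in># lam t_minus_1 then count (lam t_minus_1) m else 0)
        + (if f \<in> set (support_list lam) then count (lam f) m else 0)"
    unfolding block_list_def mset_append count_union 1[OF distinct_sorted_list_of_set]
      2[OF support_list(1)[OF lam]] by simp
  then show ?thesis
    unfolding support_list(2)[OF lam] by (auto simp: not_in_iff)
qed

lemma parts_of_block_list: "lam \<in> ptn_funs \<Longrightarrow> parts_of f (mset (block_list lam)) = lam f"
  by (rule multiset_eqI) (simp add: count_parts_of count_block_list)

lemma block_list_in_Phi:
  assumes "lam \<in> ptn_funs" "(f, m) \<in> set (block_list lam)"
  shows "f \<in> Phi \<and> 0 < m"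
proof -
  have "0 < count (mset (block_list lam)) (f, m)" using assms(2) by simp
  then have "m \<in># lam f" using assms(1) by (simp add: count_block_list)
  moreover have "0 \<notin># lam f" "f \<notin> Phi \<Longrightarrow> lam f = {#}" using assms(1) by (auto simp: ptn_funs_def)
  ultimately show ?thesis by (metis empty_iff gr0I set_mset_empty)
qed

lemma total_dim_eq_sum:
  assumes "finite S" "fst ` set bl \<subseteq> S"
  shows "total_dim bl = (\<Sum>f\<in>S. degree f * \<Sum>\<^sub># (parts_of f (mset bl)))"
  using assms(2)
proof (induction bl)
  case (Cons b bl)
  obtain g m where b: "b = (g, m)" by (cases b)
  have "(\<Sum>f\<in>S. degree f * \<Sum>\<^sub># (parts_of f (mset (b # bl))))
      = (\<Sum>f\<in>S. degree f * \<Sum>\<^sub># (parts_of f (mset bl)) + (if f = g then degree f * m else 0))"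
    by (intro sum.cong) (auto simp: b algebra_simps)
  also have "\<dots> = (\<Sum>f\<in>S. degree f * \<Sum>\<^sub># (parts_of f (mset bl))) + degree g * m"
    using assms(1) Cons.prems by (simp add: sum.distrib b)
  finally show ?case using Cons by (simp add: b)
qed simp

lemma total_dim_block_list:
  assumes "lam \<in> ptn_funs"
  shows "total_dim (block_list lam) = ptn_norm lam"
proof -
  have "finite {f. lam f \<noteq> {#}}" using assms by (simp add: ptn_funs_def)
  moreover have "fst ` set (block_list lam) \<subseteq> {f. lam f \<noteq> {#}}"
  proof
    fix f assume "f \<in> fst ` set (block_list lam)"
    then obtain m where "(f, m) \<in> set (block_list lam)" by auto
    then have "0 < count (mset (block_list lam)) (f, m)" by simp
    then show "f \<in> {f. lam f \<noteq> {#}}" unfolding count_block_list[OF assms] by auto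
  qed
  ultimately show ?thesis
    using total_dim_eq_sum[of "{f. lam f \<noteq> {#}}" "block_list lam"] assms
    by (simp add: ptn_norm_def parts_of_block_list)
qed

lemma parts_of_in_ptn_funs:
  assumes "\<forall>(f, m) \<in> set_mset B. f \<in> Phi \<and> 0 < m"
  shows "(\<lambda>f. parts_of f B) \<in> ptn_funs"
proof -
  have "{f. parts_of f B \<noteq> {#}} \<subseteq> fst ` set_mset B" using parts_of_empty by blast
  moreover have "0 \<notin># parts_of f B" for f using assms by (auto simp: parts_of_def)
  moreover have "parts_of f B = {#}" if "f \<notin> Phi" for f
    using that assms by (intro parts_of_empty) auto
  ultimately show ?thesis by (auto simp: ptn_funs_def intro: finite_subset)
qed

lemma mset_block_list_parts_of:
  assumes "\<forall>(f, m) \<in> set_mset B. f \<in> Phi \<and> 0 < m"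
  shows "mset (block_list (\<lambda>f. parts_of f B)) = B"
  by (rule parts_of_inject) (simp add: parts_of_block_list[OF parts_of_in_ptn_funs[OF assms]])

text \<open>
  The block, and the first column next to it, that carry the marked vector. For \<open>k = 0\<close> the marked vector is itself a
  direct summand and there is no such block.
\<close>

definition special :: "nat \<Rightarrow> ('a::field poly \<times> nat) list" where
  "special k = (if k = 0 then [] else [(t_minus_1, k)])"

definition chain_offsets :: "nat \<Rightarrow> 'a::field list" where
  "chain_offsets k = (if k = 0 then [] else replicate (k - 1) 0 @ [1])"

lemma total_dim_special [simp]: "total_dim (special k) = k"
  by (simp add: special_def)

lemma length_chain_offsets [simp]: "length (chain_offsets k) = k"
  by (simp add: chain_offsets_def)

definition eps_list :: "'a::field ptn_fun \<Rightarrow> nat \<Rightarrow> 'a list" where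
  "eps_list lam k = map (\<lambda>i. eps lam k $$ (i, 0)) [0..<ptn_norm lam]"

text \<open>
  The entry \<open>1\<close> of \<open>eps lam k\<close> stands in the last row of the last block of size \<open>k\<close> belonging to \<open>t - 1\<close>: the blocks
  of size at most \<open>k\<close> come first and together have \<open>\<Sum>l = 1..k. l * count (lam (t - 1)) l\<close> rows.
\<close>

lemma block_list_split:
  assumes lam: "lam \<in> ptn_funs" and k: "k = 0 \<or> k \<in># lam t_minus_1"
  obtains bl1 bl2 where "block_list lam = bl1 @ special k @ bl2"
    "eps_list lam k = replicate (total_dim bl1) 0 @ chain_offsets k @ replicate (total_dim bl2) 0"
proof (cases "k = 0")
  case True
  have "eps_list lam k = replicate (ptn_norm lam) 0"
    by (intro nth_equalityI) (simp_all add: eps_list_def eps_def True)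
  then show ?thesis
    using that[of "block_list lam" "[]"] True total_dim_block_list[OF lam]
    by (simp add: special_def chain_offsets_def)
next
  case False
  let ?c = "count (lam t_minus_1)"
  let ?h = "\<lambda>xs. concat (map (\<lambda>i. replicate (?c i) (t_minus_1 :: 'a poly, i)) xs)"
  let ?xs = "sorted_list_of_set (set_mset (lam t_minus_1))"
  let ?rest = "concat (map (\<lambda>f. map (Pair f) (rev (sorted_list_of_multiset (lam f)))) (support_list lam))"
  have kin: "k \<in># lam t_minus_1" using k False by simp
  then obtain xs1 xs2 where xs: "?xs = xs1 @ k # xs2" by (metis finite_set_mset set_sorted_list_of_set split_list)
  have "sorted_wrt (<) (xs1 @ k # xs2)" unfolding xs[symmetric] by simp
  then have sorted: "\<forall>x\<in>set xs1. x < k" "\<forall>x\<in>set xs2. k < x" "distinct xs1"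
    using strict_sorted_iff[of xs1] by (auto simp: sorted_wrt_append)
  have "set ?xs = set_mset (lam t_minus_1)" by simp
  then have "set_mset (lam t_minus_1) = insert k (set xs1 \<union> set xs2)" unfolding xs by auto
  then have set1: "set xs1 = {l \<in> set_mset (lam t_minus_1). l < k}" using sorted by auto
  define bl1 where "bl1 = ?h xs1 @ replicate (?c k - 1) (t_minus_1, k)"
  define bl2 where "bl2 = ?h xs2 @ ?rest"
  obtain c' where c': "?c k = Suc c'" using kin by (metis count_greater_zero_iff gr0_implies_Suc)
  have "block_list lam = ?h xs1 @ replicate (?c k) (t_minus_1, k) @ ?h xs2 @ ?rest"
    unfolding block_list_def xs by simp
  also have "replicate (?c k) (t_minus_1 :: 'a poly, k) = replicate (?c k - 1) (t_minus_1, k) @ [(t_minus_1, k)]"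
    unfolding c' by (simp add: replicate_append_same)
  finally have bl: "block_list lam = bl1 @ special k @ bl2"
    using False by (simp add: bl1_def bl2_def special_def)
  have rep: "total_dim (replicate n (t_minus_1 :: 'a poly, i)) = n * i" for n i
    by (induction n) auto
  have "total_dim (?h ys) = (\<Sum>l\<in>set ys. l * ?c l)" if "distinct ys" for ys
    using that by (induction ys) (auto simp: rep mult.commute)
  then have "total_dim bl1 + k = (\<Sum>l\<in>set xs1. l * ?c l) + ?c k * k"
    unfolding bl1_def using sorted(3) by (simp add: rep c')
  also have "(\<Sum>l\<in>set xs1. l * ?c l) = (\<Sum>l\<in>{1..<k}. l * ?c l)"
  proof (rule sum.mono_neutral_left)
    have "0 \<notin># lam t_minus_1" using lam by (simp add: ptn_funs_def)
    then show "set xs1 \<subseteq> {1..<k}" unfolding set1 by (auto simp: Suc_le_eq intro: gr0I)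
    show "\<forall>i\<in>{1..<k} - set xs1. i * ?c i = 0" unfolding set1 by (auto simp: not_in_iff)
  qed simp
  also have "(\<Sum>l\<in>{1..<k}. l * ?c l) + ?c k * k = (\<Sum>l = 1..k. l * ?c l)"
  proof -
    have "{1..k} = insert k {1..<k}" using False by auto
    then show ?thesis by (simp add: mult.commute)
  qed
  finally have pos: "(\<Sum>l = 1..k. l * ?c l) = total_dim bl1 + k" by simp
  have norm: "ptn_norm lam = total_dim bl1 + k + total_dim bl2"
    using total_dim_block_list[OF lam] by (simp add: bl)
  have "eps_list lam k = replicate (total_dim bl1) 0 @ chain_offsets k @ replicate (total_dim bl2) 0"
  proof (rule nth_equalityI)
    fix i assume "i < length (eps_list lam k)"
    then have i: "i < total_dim bl1 + k + total_dim bl2" by (simp add: eps_list_def norm)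
    have "eps_list lam k ! i = (if i + 1 = total_dim bl1 + k then 1 else 0)"
      using i False by (simp add: eps_list_def norm eps_def pos[unfolded One_nat_def])
    then show "eps_list lam k ! i
        = (replicate (total_dim bl1) 0 @ chain_offsets k @ replicate (total_dim bl2) 0) ! i"
      using i False by (auto simp: nth_append chain_offsets_def)
  qed (simp add: eps_list_def norm)
  then show ?thesis using that bl by blast
qed

lemma blocks_mat_append:
  "blocks_mat (bl @ bl') = four_block_mat (blocks_mat bl) (0\<^sub>m (total_dim bl) (total_dim bl'))
     (0\<^sub>m (total_dim bl') (total_dim bl)) (blocks_mat bl')"
  using blocks_mat_carrier[of bl] blocks_mat_carrier[of bl'] by (simp add: diag_block_mat_append Let_def)

lemma mset_map_eqE:
  assumes "mset (map f xs) = mset ys"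
  obtains zs where "mset zs = mset xs" "map f zs = ys"
proof -
  have "\<exists>zs. mset zs = mset xs \<and> map f zs = ys"
    using assms
  proof (induction ys arbitrary: xs)
    case (Cons y ys)
    have "y \<in> set (map f xs)" using Cons.prems mset_eq_setD by fastforce
    then obtain x xs1 xs2 where x: "xs = xs1 @ x # xs2" "f x = y" by (auto dest: split_list)
    then have "mset (map f (xs1 @ xs2)) = mset ys" using Cons.prems by simp
    then obtain zs where "mset zs = mset (xs1 @ xs2)" "map f zs = ys" using Cons.IH by blast
    then show ?case using x by (intro exI[of _ "x # zs"]) simp
  qed simp
  then show ?thesis using that by blast
qed

context poly_module
begin

lemma span_Un_cong: "span A = span A' \<Longrightarrow> span B = span B' \<Longrightarrow> span (A \<union> B) = span (A' \<union> B')"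
  by (simp add: span_Un)

lemma span_eqI: "A \<subseteq> span B \<Longrightarrow> B \<subseteq> span A \<Longrightarrow> span A = span B"
  by (simp add: span_eq)

lemma realizes_blocks_append:
  assumes "length bs1 = total_dim bl1" "length cs1 = total_dim bl1"
    "length bs2 = total_dim bl2" "length cs2 = total_dim bl2"
  shows "realizes e (blocks_mat (bl1 @ bl2)) (cs1 @ cs2) (bs1 @ bs2)
    \<longleftrightarrow> realizes e (blocks_mat bl1) cs1 bs1 \<and> realizes e (blocks_mat bl2) cs2 bs2"
  using realizes_append[of "blocks_mat bl1" bs1 cs1 "blocks_mat bl2" bs2 cs2 e] assms
    blocks_mat_carrier[of bl1] blocks_mat_carrier[of bl2]
  by (simp only: blocks_mat_append)

lemma realizes_Nil: "realizes e (blocks_mat []) [] []"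
  by (simp add: realizes_def)

lemma blocks_mat_single: "blocks_mat [(f, m)] = J_block m f"
  by (simp only: list.map prod.case diag_block_mat_singleton)

lemma gens_append: "gens (ds @ ds') = gens ds \<union> gens ds'"
  by (simp add: image_Un)

lemma cyclic_sum_basis:
  assumes "\<forall>(f, m, v) \<in> set ds. f \<in> Phi \<and> 0 < m \<and> f ^ m *s v = 0"
  shows "\<exists>bs. length bs = total_dim (blocks ds) \<and>
    realizes e (blocks_mat (blocks ds)) (replicate (total_dim (blocks ds)) 0) bs \<and>
    span (set bs) = span (gens ds)"
  using assms
proof (induction ds)
  case Nil
  show ?case using realizes_Nil by (intro exI[of _ "[]"]) simp
next
  case (Cons a ds)
  obtain f m v where a: "a = (f, m, v)" by (cases a)
  have f: "f \<in> Phi" "0 < m" "f ^ m *s v = 0" using Cons.prems by (auto simp: a)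
  obtain bs1 where bs1: "length bs1 = degree f * m"
    "realizes e (J_block m f) (replicate (degree f * m) 0) bs1" "v \<in> set bs1" "set bs1 \<subseteq> span {v}"
    using block_basis[OF f] by blast
  obtain bs2 where bs2: "length bs2 = total_dim (blocks ds)"
    "realizes e (blocks_mat (blocks ds)) (replicate (total_dim (blocks ds)) 0) bs2"
    "span (set bs2) = span (gens ds)" using Cons by auto
  have "realizes e (blocks_mat ([(f, m)] @ blocks ds))
      (replicate (degree f * m) 0 @ replicate (total_dim (blocks ds)) 0) (bs1 @ bs2)"
    using bs1 bs2 by (subst realizes_blocks_append) (simp_all del: diag_block_mat.simps add: blocks_mat_single)
  moreover have "span (set bs1) = span {v}" using bs1 by (intro span_eqI) (auto intro: span_base)
  then have "span (set bs1 \<union> set bs2) = span ({v} \<union> gens ds)" by (rule span_Un_cong) (rule bs2(3))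
  ultimately show ?case
    using bs1(1) bs2(1) by (intro exI[of _ "bs1 @ bs2"]) (simp add: a replicate_add)
qed

lemma cyclic_sum_of_basis:
  assumes "\<forall>(f, m) \<in> set bl. f \<in> Phi \<and> 0 < m" "length bs = total_dim bl"
    "realizes e (blocks_mat bl) (replicate (total_dim bl) 0) bs"
  shows "\<exists>ds. blocks ds = bl \<and> (\<forall>(f, m, v) \<in> set ds. f ^ m *s v = 0) \<and> span (gens ds) = span (set bs)"
  using assms
proof (induction bl arbitrary: bs)
  case Nil
  then show ?case by (intro exI[of _ "[]"]) simp
next
  case (Cons a bl)
  obtain f m where a: "a = (f, m)" by (cases a)
  have f: "f \<in> Phi" "0 < m" using Cons.prems by (auto simp: a)
  define bs1 where "bs1 = take (degree f * m) bs"
  define bs2 where "bs2 = drop (degree f * m) bs"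
  have bs: "bs = bs1 @ bs2" "length bs1 = degree f * m" "length bs2 = total_dim bl"
    using Cons.prems(2) by (auto simp: bs1_def bs2_def a)
  have "realizes e (blocks_mat ([(f, m)] @ bl)) (replicate (degree f * m) 0 @ replicate (total_dim bl) 0) (bs1 @ bs2)"
    using Cons.prems(3) by (simp add: a replicate_add bs(1))
  then have r: "realizes e (blocks_mat [(f, m)]) (replicate (degree f * m) 0) bs1"
    "realizes e (blocks_mat bl) (replicate (total_dim bl) 0) bs2"
    using bs by (subst (asm) realizes_blocks_append; simp)+
  obtain v where v: "v \<in> set bs1" "f ^ m *s v = 0" "set bs1 \<subseteq> span {v}"
    using block_basis_imp_cyclic[OF f bs(2)] r(1) unfolding blocks_mat_single by blast
  obtain ds where ds: "blocks ds = bl" "\<forall>(f, m, v) \<in> set ds. f ^ m *s v = 0" "span (gens ds) = span (set bs2)"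
    using Cons.IH[OF _ bs(3) r(2)] Cons.prems(1) by auto
  have "span {v} = span (set bs1)" using v by (intro span_eqI) (auto intro: span_base)
  then have "span ({v} \<union> gens ds) = span (set bs1 \<union> set bs2)" by (rule span_Un_cong) (rule ds(3))
  then show ?case using ds v(2) by (intro exI[of _ "(f, m, v) # ds"]) (simp add: a bs(1))
qed

lemma realizes_special_iff:
  assumes "length bs = k"
  shows "realizes e (blocks_mat (special k)) (chain_offsets k) bs
    \<longleftrightarrow> (\<forall>b<k. [:0, 1:] *s (bs ! b) = bs ! b + (if b + 1 < k then bs ! (b + 1) else e))"
proof (cases "k = 0")
  case True
  then show ?thesis using assms by (simp add: special_def chain_offsets_def realizes_Nil[simplified])
next
  case False
  have r: "realizes e (J_block k t_minus_1) (chain_offsets k) bs \<longleftrightarrow> (\<forall>b<k. [:0, 1:] *s (bs ! b)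
      = - ([:- 1:] *s (bs ! b)) + (if b + 1 < k then bs ! (b + 1) else 0) + [:chain_offsets k ! b:] *s e)"
    using assms by (subst realizes_J_block_iff) auto
  have eq: "- ([:- 1:] *s (bs ! b)) + (if b + 1 < k then bs ! (b + 1) else 0) + [:chain_offsets k ! b:] *s e
      = bs ! b + (if b + 1 < k then bs ! (b + 1) else e)" if "b < k" for b
  proof -
    have "[:- 1:] = - (1 :: 'a poly)" by (simp add: one_pCons)
    then have "- ([:- 1:] *s (bs ! b)) = bs ! b" by (simp only: scale_minus_left scale_one minus_minus)
    moreover have "[:chain_offsets k ! b:] *s e = (if b + 1 < k then 0 else e)"
      using that by (auto simp: chain_offsets_def nth_append one_pCons[symmetric])
    ultimately show ?thesis by simp
  qed
  have sp: "blocks_mat (special k) = J_block k t_minus_1"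
    using False by (simp only: special_def if_False blocks_mat_single)
  show ?thesis unfolding sp r by (rule all_cong) (simp only: eq)
qed

lemma t_minus_1_scale: "t_minus_1 *s x = [:0, 1:] *s x - x"
proof -
  have "t_minus_1 = [:0, 1:] - (1 :: 'a poly)" by (simp add: one_pCons)
  then show ?thesis by (simp only: scale_left_diff_distrib scale_one)
qed

lemma special_basis:
  assumes "t_minus_1 ^ k *s v = e"
  shows "\<exists>bs. length bs = k \<and> realizes e (blocks_mat (special k)) (chain_offsets k) bs \<and>
    span (insert e (set bs)) = span {v}"
proof -
  define bs where "bs = map (\<lambda>b. t_minus_1 ^ b *s v) [0..<k]"
  have len: "length bs = k" by (simp add: bs_def)
  have "realizes e (blocks_mat (special k)) (chain_offsets k) bs"
    unfolding realizes_special_iff[OF len]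
  proof (intro allI impI)
    fix b assume b: "b < k"
    have "t_minus_1 *s (t_minus_1 ^ b *s v) = (if b + 1 < k then bs ! (b + 1) else e)"
    proof (cases "b + 1 < k")
      case False
      then have "Suc b = k" using b by simp
      then show ?thesis using assms by auto
    qed (simp add: bs_def)
    then show "[:0, 1:] *s (bs ! b) = bs ! b + (if b + 1 < k then bs ! (b + 1) else e)"
      unfolding t_minus_1_scale using b by (simp add: bs_def algebra_simps del: mult_pCons_left)
  qed
  moreover have "span (insert e (set bs)) = span {v}"
  proof (rule span_eqI)
    show "insert e (set bs) \<subseteq> span {v}" using assms by (auto simp: bs_def span_singleton)
    have "v \<in> insert e (set bs)"
    proof (cases "k = 0")
      case True
      then show ?thesis using assms by simp
    next
      case False
      then have "bs ! 0 = v" "0 < length bs" by (simp_all add: bs_def)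
      then show ?thesis using nth_mem[of 0 bs] by simp
    qed
    then show "{v} \<subseteq> span (insert e (set bs))" by (auto intro: span_base)
  qed
  ultimately show ?thesis using len by blast
qed

lemma special_of_basis:
  assumes len: "length bs = k" and r: "realizes e (blocks_mat (special k)) (chain_offsets k) bs"
  shows "\<exists>v. t_minus_1 ^ k *s v = e \<and> span (insert e (set bs)) = span {v}"
proof -
  define v where "v = (bs @ [e]) ! 0"
  have pow: "(bs @ [e]) ! b = t_minus_1 ^ b *s v" if "b \<le> k" for b
    using that
  proof (induction b)
    case (Suc b)
    then have b: "b < k" by simp
    have "(bs @ [e]) ! Suc b = (if b + 1 < k then bs ! (b + 1) else e)"
      using len b by (auto simp: nth_append)
    also have "\<dots> = t_minus_1 *s (bs ! b)"
      using r b unfolding realizes_special_iff[OF len] t_minus_1_scale by simp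
    also have "bs ! b = t_minus_1 ^ b *s v" using Suc b len by (simp add: nth_append)
    finally show ?case by simp
  qed (simp add: v_def)
  have e: "t_minus_1 ^ k *s v = e" using pow[of k] len by (simp add: nth_append)
  moreover have "span (insert e (set bs)) = span {v}"
  proof (rule span_eqI)
    have "bs ! b \<in> span {v}" if "b < k" for b
      using pow[of b] that len by (auto simp: nth_append span_singleton)
    then show "insert e (set bs) \<subseteq> span {v}" using e len by (auto simp: set_conv_nth span_singleton)
    have "v \<in> set (bs @ [e])" unfolding v_def by (rule nth_mem) simp
    then show "{v} \<subseteq> span (insert e (set bs))" by (auto intro: span_base)
  qed
  ultimately show ?thesis by blast
qed

text \<open>
  The type of the pair \<open>(V, e)\<close>. The function \<open>lam\<close> describes the quotient of \<open>V\<close> by \<open>e\<close>, where the chain of \<open>e\<close> has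
  length \<open>k\<close> instead of \<open>k + 1\<close>.
\<close>

definition affine_type :: "'b set \<Rightarrow> 'b \<Rightarrow> 'a ptn_fun \<Rightarrow> nat \<Rightarrow> bool" where
  "affine_type V e lam k \<longleftrightarrow> lam \<in> ptn_funs \<and>
     (\<exists>v ds. affine_sum k v ds V e \<and> mset (blocks ds) + mset (special k) = mset (block_list lam))"

lemma affine_type_part:
  assumes "affine_type V e lam k"
  shows "k = 0 \<or> k \<in># lam t_minus_1" "card V = CARD('a) ^ (ptn_norm lam + 1)"
proof -
  obtain v ds where lam: "lam \<in> ptn_funs" and ds: "affine_sum k v ds V e"
    and bl: "mset (blocks ds) + mset (special k) = mset (block_list lam)"
    using assms by (auto simp: affine_type_def)
  show "k = 0 \<or> k \<in># lam t_minus_1"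
  proof (cases "k = 0")
    case False
    then have "0 < count (mset (block_list lam)) (t_minus_1, k)"
      unfolding bl[symmetric] by (simp add: special_def)
    then show ?thesis by (simp add: count_block_list[OF lam])
  qed simp
  have td: "total_dim xs = total_dim ys" if "mset xs = mset ys" for xs ys :: "('a poly \<times> nat) list"
    by (simp only: total_dim_def sum_mset_sum_list[symmetric] mset_map that)
  have "total_dim (blocks ds @ special k) = total_dim (block_list lam)"
    by (rule td) (simp only: mset_append bl)
  then have "total_dim (blocks ds) + k = ptn_norm lam"
    by (simp add: total_dim_block_list[OF lam])
  moreover have "card V = CARD('a) ^ total_dim (blocks ((t_minus_1, k + 1, v) # ds))"
    using ds unfolding affine_sum_def cyclic_sum_def by blast
  ultimately show "card V = CARD('a) ^ (ptn_norm lam + 1)" by (simp add: ac_simps flip: power_Suc)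
qed

lemma affine_type_imp_basis:
  assumes "affine_type V e lam k"
  shows "\<exists>bs. length bs = ptn_norm lam \<and> realizes e (J_linear lam) (eps_list lam k) bs \<and>
    span (insert e (set bs)) = V"
proof -
  obtain v ds where lam: "lam \<in> ptn_funs" and ds: "affine_sum k v ds V e"
    and bl: "mset (blocks ds) + mset (special k) = mset (block_list lam)"
    using assms by (auto simp: affine_type_def)
  obtain bl1 bl2 where split: "block_list lam = bl1 @ special k @ bl2"
    "eps_list lam k = replicate (total_dim bl1) 0 @ chain_offsets k @ replicate (total_dim bl2) 0"
    by (rule block_list_split[OF lam affine_type_part(1)[OF assms]])
  have "mset (blocks ds) = mset (bl1 @ bl2)" using bl by (simp add: split)
  then obtain ds' where ds': "mset ds' = mset ds" "blocks ds' = bl1 @ bl2" by (rule mset_map_eqE)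
  have set': "set ds' = set ds" using ds'(1) by (rule mset_eq_setD)
  define ds1 where "ds1 = take (length bl1) ds'"
  define ds2 where "ds2 = drop (length bl1) ds'"
  have d12: "ds' = ds1 @ ds2" "blocks ds1 = bl1" "blocks ds2 = bl2"
    using ds'(2) by (simp_all add: ds1_def ds2_def flip: take_map drop_map)
  have tors: "\<forall>(f, m, v) \<in> set ds'. f \<in> Phi \<and> 0 < m \<and> f ^ m *s v = 0"
    unfolding set' using ds by (auto simp: affine_sum_def cyclic_sum_def)
  have tors1: "\<forall>(f, m, v) \<in> set ds1. f \<in> Phi \<and> 0 < m \<and> f ^ m *s v = 0"
    and tors2: "\<forall>(f, m, v) \<in> set ds2. f \<in> Phi \<and> 0 < m \<and> f ^ m *s v = 0"
    using tors by (auto simp: d12(1))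
  obtain bs1 where bs1: "length bs1 = total_dim bl1"
    "realizes e (blocks_mat bl1) (replicate (total_dim bl1) 0) bs1" "span (set bs1) = span (gens ds1)"
    using cyclic_sum_basis[OF tors1, of e] unfolding d12 by blast
  obtain bs2 where bs2: "length bs2 = total_dim bl2"
    "realizes e (blocks_mat bl2) (replicate (total_dim bl2) 0) bs2" "span (set bs2) = span (gens ds2)"
    using cyclic_sum_basis[OF tors2, of e] unfolding d12 by blast
  obtain bs0 where bs0: "length bs0 = k" "realizes e (blocks_mat (special k)) (chain_offsets k) bs0"
    "span (insert e (set bs0)) = span {v}"
    using special_basis[of k v e] ds unfolding affine_sum_def by blast
  have "realizes e (J_linear lam) (eps_list lam k) (bs1 @ bs0 @ bs2)"
    unfolding J_linear_eq_blocks_mat split using bs0 bs1 bs2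
    by (simp only: realizes_blocks_append length_replicate length_append length_chain_offsets
        total_dim_simps total_dim_special simp_thms)
  moreover have "span (insert e (set (bs1 @ bs0 @ bs2))) = V"
  proof -
    have "span (set bs1 \<union> (insert e (set bs0) \<union> set bs2)) = span (gens ds1 \<union> ({v} \<union> gens ds2))"
      using bs0 bs1 bs2 by (intro span_Un_cong)
    moreover have "gens ds1 \<union> ({v} \<union> gens ds2) = insert v (gens ds)"
      unfolding set'[symmetric] d12(1) gens_append by blast
    moreover have "span (insert v (gens ds)) = V" using ds by (simp add: affine_sum_def cyclic_sum_def)
    ultimately show ?thesis by (simp add: Un_insert_left Un_insert_right)
  qed
  moreover have "length (bs1 @ bs0 @ bs2) = ptn_norm lam"
    using total_dim_block_list[OF lam] bs0 bs1 bs2 by (simp add: split)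
  ultimately show ?thesis by blast
qed

lemma basis_imp_affine_type:
  assumes lam: "lam \<in> ptn_funs" and k: "k = 0 \<or> k \<in># lam t_minus_1"
    and len: "length bs = ptn_norm lam" and r: "realizes e (J_linear lam) (eps_list lam k) bs"
    and V: "span (insert e (set bs)) = V" "card V = CARD('a) ^ (ptn_norm lam + 1)"
    and e: "[:0, 1:] *s e = e"
  shows "affine_type V e lam k"
proof -
  obtain bl1 bl2 where split: "block_list lam = bl1 @ special k @ bl2"
    "eps_list lam k = replicate (total_dim bl1) 0 @ chain_offsets k @ replicate (total_dim bl2) 0"
    by (rule block_list_split[OF lam k])
  have norm: "ptn_norm lam = total_dim bl1 + (k + total_dim bl2)"
    using total_dim_block_list[OF lam] by (simp add: split)
  define bs1 where "bs1 = take (total_dim bl1) bs"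
  define bs0 where "bs0 = take k (drop (total_dim bl1) bs)"
  define bs2 where "bs2 = drop k (drop (total_dim bl1) bs)"
  have bs: "bs = bs1 @ bs0 @ bs2" "length bs1 = total_dim bl1" "length bs0 = k" "length bs2 = total_dim bl2"
    using len norm unfolding bs1_def bs0_def bs2_def by (auto simp del: drop_drop)
  have rr: "realizes e (blocks_mat bl1) (replicate (total_dim bl1) 0) bs1"
    "realizes e (blocks_mat (special k)) (chain_offsets k) bs0"
    "realizes e (blocks_mat bl2) (replicate (total_dim bl2) 0) bs2"
    using r bs(2,3,4) unfolding J_linear_eq_blocks_mat split bs(1)
    by (simp_all only: realizes_blocks_append length_replicate length_append length_chain_offsets
        total_dim_simps total_dim_special simp_thms)
  have Phi: "\<forall>(f, m) \<in> set (block_list lam). f \<in> Phi \<and> 0 < m" using block_list_in_Phi[OF lam] by blast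
  obtain ds1 where ds1: "blocks ds1 = bl1" "\<forall>(f, m, v) \<in> set ds1. f ^ m *s v = 0" "span (gens ds1) = span (set bs1)"
    using cyclic_sum_of_basis[OF _ bs(2) rr(1)] Phi unfolding split by auto
  obtain ds2 where ds2: "blocks ds2 = bl2" "\<forall>(f, m, v) \<in> set ds2. f ^ m *s v = 0" "span (gens ds2) = span (set bs2)"
    using cyclic_sum_of_basis[OF _ bs(4) rr(3)] Phi unfolding split by auto
  obtain v where v: "t_minus_1 ^ k *s v = e" "span (insert e (set bs0)) = span {v}"
    using special_of_basis[OF bs(3) rr(2)] by blast
  have bl12: "blocks (ds1 @ ds2) = bl1 @ bl2" using ds1(1) ds2(1) by simp
  have Phi': "\<forall>(f, m, v) \<in> set (ds1 @ ds2). f \<in> Phi \<and> 0 < m"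
  proof clarify
    fix f m v assume "(f, m, v) \<in> set (ds1 @ ds2)"
    then have "(f, m) \<in> set (blocks (ds1 @ ds2))" by force
    then show "f \<in> Phi \<and> 0 < m" unfolding bl12 using Phi by (auto simp: split)
  qed
  have "V = span (insert v (gens (ds1 @ ds2)))"
  proof -
    have "span (gens ds1 \<union> ({v} \<union> gens ds2)) = span (set bs1 \<union> (insert e (set bs0) \<union> set bs2))"
      using ds1 ds2 v by (intro span_Un_cong) auto
    moreover have "insert e (set bs) = set bs1 \<union> (insert e (set bs0) \<union> set bs2)" by (auto simp: bs(1))
    moreover have "insert v (gens (ds1 @ ds2)) = gens ds1 \<union> ({v} \<union> gens ds2)"
      unfolding gens_append by blast
    ultimately show ?thesis using V(1) by simp
  qed
  moreover have "t_minus_1 ^ (k + 1) *s v = 0"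
  proof -
    have "t_minus_1 ^ (k + 1) *s v = t_minus_1 *s (t_minus_1 ^ k *s v)" by simp
    then show ?thesis unfolding v(1) t_minus_1_scale e by simp
  qed
  moreover have "card V = CARD('a) ^ (k + 1 + (total_dim bl1 + total_dim bl2))"
    using V(2) norm by (simp add: ac_simps)
  moreover have "\<forall>(f, m, v) \<in> set (ds1 @ ds2). f \<noteq> 0 \<and> f ^ m *s v = 0"
    using ds1(2) ds2(2) Phi' Phi_nonzero by fastforce
  ultimately have "cyclic_sum ((t_minus_1, k + 1, v) # (ds1 @ ds2)) V"
    using bl12 by (auto simp: cyclic_sum_def ac_simps)
  then have "affine_sum k v (ds1 @ ds2) V e" using v(1) Phi' by (simp only: affine_sum_def)
  moreover have "mset (blocks (ds1 @ ds2)) + mset (special k) = mset (block_list lam)"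
    unfolding bl12 split by simp
  ultimately show ?thesis using lam unfolding affine_type_def by blast
qed

lemma affine_type_unique:
  assumes "affine_type V e lam k" "affine_type V e lam' k'"
  shows "lam = lam' \<and> k = k'"
proof -
  obtain v ds v' ds' where *: "affine_sum k v ds V e" "affine_sum k' v' ds' V e"
    "mset (blocks ds) + mset (special k) = mset (block_list lam)"
    "mset (blocks ds') + mset (special k') = mset (block_list lam')"
    "lam \<in> ptn_funs" "lam' \<in> ptn_funs"
    using assms by (auto simp: affine_type_def)
  note u = affine_sum_unique[OF *(1,2)]
  have "mset (block_list lam) = mset (block_list lam')" using *(3,4) u by simp
  then have "lam f = lam' f" for f using *(5,6) parts_of_block_list by metis
  then show ?thesis using u(1) by auto
qed

lemma affine_type_exists:
  assumes "finite V" "subspace V" "\<And>v. v \<in> V \<Longrightarrow> [:0, 1:] *s v = 0 \<Longrightarrow> v = 0"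
    and "e \<in> V" "e \<noteq> 0" "[:0, 1:] *s e = e"
  shows "\<exists>lam k. affine_type V e lam k"
proof -
  obtain k v ds where ds: "affine_sum k v ds V e"
    using affine_sum_exists[OF assms(1-5)] assms(6) by (auto simp: t_minus_1_scale)
  define B where "B = mset (blocks ds @ special k)"
  have B: "\<forall>(f, m) \<in> set_mset B. f \<in> Phi \<and> 0 < m"
    using ds t_minus_1_in_Phi by (auto simp: B_def affine_sum_def special_def)
  then have "affine_type V e (\<lambda>f. parts_of f B) k"
    unfolding affine_type_def mset_block_list_parts_of[OF B]
    using ds parts_of_in_ptn_funs[OF B] by (auto simp: B_def)
  then show ?thesis by blast
qed

end

section \<open>Matrices acting on row vectors\<close>

definition row_space :: "nat \<Rightarrow> (nat \<Rightarrow> 'a::zero) set" where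
  "row_space n = {v. \<forall>i\<ge>n. v i = 0}"

definition unit_row :: "nat \<Rightarrow> nat \<Rightarrow> 'a::zero_neq_one" where
  "unit_row i = (\<lambda>j. if j = i then 1 else 0)"

text \<open>
  The \<open>n \<times> n\<close> matrix \<open>A\<close> acts on row vectors from the right. Coordinates from \<open>n\<close> on are left alone, so that \<open>A\<close> and
  the diagonal sum of \<open>A\<close> with an identity matrix have the same action.
\<close>

definition row_act :: "'a::comm_ring_1 mat \<Rightarrow> (nat \<Rightarrow> 'a) \<Rightarrow> nat \<Rightarrow> 'a" where
  "row_act A v = (\<lambda>j. if j < dim_row A then \<Sum>i<dim_row A. v i * A $$ (i, j) else v j)"

lemma unit_row_in_row_space: "i < n \<Longrightarrow> unit_row i \<in> row_space n"
  by (auto simp: unit_row_def row_space_def)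

lemma row_space_mono: "m \<le> n \<Longrightarrow> row_space m \<subseteq> row_space n"
  by (auto simp: row_space_def)

lemma row_act_add: "row_act A (v + w) = row_act A v + row_act A w"
  by (rule ext) (simp add: row_act_def sum.distrib distrib_right)

lemma row_act_zero: "row_act A 0 = 0"
  by (rule ext) (simp add: row_act_def)

lemma row_act_diff: "row_act A (v - w) = row_act A v - row_act A w"
  by (rule ext) (simp add: row_act_def sum_subtractf left_diff_distrib)

lemma row_act_scale: "row_act A (\<lambda>i. c * v i) = (\<lambda>i. c * row_act A v i)"
  by (rule ext) (simp add: row_act_def sum_distrib_left mult.assoc)

lemma row_act_sum: "row_act A (\<Sum>j\<in>S. g j) = (\<Sum>j\<in>S. row_act A (g j))"
proof (induction S rule: infinite_finite_induct)
  case (insert x F)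
  then show ?case by (simp only: sum.insert[OF insert.hyps] row_act_add)
qed (simp_all only: sum.infinite sum.empty row_act_zero not_False_eq_True)

lemma row_act_row_space:
  "A \<in> carrier_mat m m \<Longrightarrow> m \<le> n \<Longrightarrow> v \<in> row_space n \<Longrightarrow> row_act A v \<in> row_space n"
  by (auto simp: row_space_def row_act_def)

lemma row_act_unit_row:
  assumes "A \<in> carrier_mat n n" "i < n"
  shows "row_act A (unit_row i) = (\<lambda>j. if j < n then A $$ (i, j) else 0)"
proof
  fix j
  have "(\<Sum>l<n. unit_row i l * A $$ (l, j)) = (\<Sum>l<n. if l = i then A $$ (l, j) else 0)"
    by (rule sum.cong) (auto simp: unit_row_def)
  then show "row_act A (unit_row i) j = (if j < n then A $$ (i, j) else 0)"
    using assms by (auto simp: row_act_def unit_row_def)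
qed

lemma row_act_mult:
  assumes "A \<in> carrier_mat n n" "B \<in> carrier_mat n n"
  shows "row_act (A * B) v = row_act B (row_act A v)"
proof
  fix j show "row_act (A * B) v j = row_act B (row_act A v) j"
  proof (cases "j < n")
    case True
    have "row_act (A * B) v j = (\<Sum>i<n. v i * (\<Sum>k<n. A $$ (i, k) * B $$ (k, j)))"
      using assms True by (simp add: row_act_def scalar_prod_def lessThan_atLeast0)
    also have "\<dots> = (\<Sum>i<n. \<Sum>k<n. v i * A $$ (i, k) * B $$ (k, j))"
      by (simp add: sum_distrib_left mult.assoc)
    also have "\<dots> = (\<Sum>k<n. \<Sum>i<n. v i * A $$ (i, k) * B $$ (k, j))"
      by (rule sum.swap)
    also have "\<dots> = (\<Sum>k<n. (\<Sum>i<n. v i * A $$ (i, k)) * B $$ (k, j))"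
      by (simp add: sum_distrib_right)
    also have "\<dots> = row_act B (row_act A v) j"
      using assms True by (simp add: row_act_def)
    finally show ?thesis .
  qed (use assms in \<open>simp add: row_act_def\<close>)
qed

lemma row_act_one:
  fixes v :: "nat \<Rightarrow> 'a::comm_ring_1"
  shows "row_act (1\<^sub>m n) v = v"
proof
  fix j
  show "row_act (1\<^sub>m n) v j = v j"
  proof (cases "j < n")
    case True
    have "(\<Sum>i<n. v i * 1\<^sub>m n $$ (i, j)) = (\<Sum>i<n. if i = j then v i else 0)"
      using True by (intro sum.cong) auto
    then show ?thesis using True by (simp add: row_act_def)
  qed (simp add: row_act_def)
qed

lemma mat_eq_if_row_act_eq:
  assumes "A \<in> carrier_mat n n" "B \<in> carrier_mat n n"
    and eq: "\<And>i. i < n \<Longrightarrow> row_act A (unit_row i) = row_act B (unit_row i)"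
  shows "A = B"
proof (rule eq_matI)
  fix i j assume "i < dim_row B" "j < dim_col B"
  then have ij: "i < n" "j < n" using assms by auto
  have "row_act A (unit_row i) j = row_act B (unit_row i) j" using eq[OF ij(1)] by simp
  then show "A $$ (i, j) = B $$ (i, j)"
    using row_act_unit_row[OF assms(1) ij(1)] row_act_unit_row[OF assms(2) ij(1)] ij by simp
qed (use assms in auto)

lemma row_space_expand:
  fixes v :: "nat \<Rightarrow> 'a::comm_ring_1"
  assumes "v \<in> row_space n"
  shows "v = (\<Sum>i<n. (\<lambda>j. v i * unit_row i j))"
proof
  fix j
  have "(\<Sum>i<n. (\<lambda>j. v i * unit_row i j)) j = (\<Sum>i<n. v i * unit_row i j)"
    by (induction n) simp_all
  also have "\<dots> = (\<Sum>i<n. if i = j then v i else 0)" by (rule sum.cong) (auto simp: unit_row_def)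
  finally show "v j = (\<Sum>i<n. (\<lambda>j. v i * unit_row i j)) j" using assms by (auto simp: row_space_def)
qed

lemma card_row_space:
  "finite (row_space n :: (nat \<Rightarrow> 'a::{field,finite}) set)"
  "card (row_space n :: (nat \<Rightarrow> 'a) set) = CARD('a) ^ n"
proof -
  have "row_space n = coeff ` (polys_below n :: 'a poly set)"
  proof (intro equalityI subsetI)
    fix v :: "nat \<Rightarrow> 'a" assume v: "v \<in> row_space n"
    have c: "coeff (\<Sum>i<n. monom (v i) i) j = v j" for j
      using v by (auto simp: coeff_sum row_space_def if_distrib cong: if_cong)
    then have "v = coeff (\<Sum>i<n. monom (v i) i)" by auto
    moreover have "(\<Sum>i<n. monom (v i) i) \<in> polys_below n"
      using v by (simp add: polys_below_def c row_space_def)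
    ultimately show "v \<in> coeff ` (polys_below n :: 'a poly set)" by blast
  qed (auto simp: row_space_def polys_below_def)
  moreover have "inj_on coeff (polys_below n :: 'a poly set)" by (simp add: inj_on_def coeff_inject)
  ultimately show "finite (row_space n :: (nat \<Rightarrow> 'a) set)" "card (row_space n :: (nat \<Rightarrow> 'a) set) = CARD('a) ^ n"
    by (simp_all add: card_image card_polys_below)
qed

text \<open>
  The module structure for which the variable acts as \<open>A\<close>, evaluated by the Horner scheme.
\<close>

definition poly_act :: "'a::comm_ring_1 mat \<Rightarrow> 'a poly \<Rightarrow> (nat \<Rightarrow> 'a) \<Rightarrow> nat \<Rightarrow> 'a" where
  "poly_act A p = fold_coeffs (\<lambda>a F v. (\<lambda>i. a * v i) + row_act A (F v)) p (\<lambda>v. 0)"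

lemma poly_act_0: "poly_act A 0 v = 0"
  by (simp add: poly_act_def)

lemma poly_act_pCons: "poly_act A (pCons a p) v = (\<lambda>i. a * v i) + row_act A (poly_act A p v)"
proof (cases "p = 0 \<and> a = 0")
  case True
  then show ?thesis by (simp add: poly_act_0 row_act_zero) (simp add: zero_fun_def)
next
  case False
  then show ?thesis
    by (cases "a = 0") (simp_all add: poly_act_def)
qed

lemma poly_act_const: "poly_act A [:c:] v = (\<lambda>i. c * v i)"
  by (simp add: poly_act_pCons poly_act_0 row_act_zero)

lemma poly_act_var: "poly_act A [:0, 1:] v = row_act A v"
  by (simp add: poly_act_pCons poly_act_0 row_act_zero flip: zero_fun_def)

lemma poly_module_poly_act: "poly_module (poly_act (A :: 'a::{field,finite} mat))"
proof -
  have add: "poly_act A p (v + w) = poly_act A p v + poly_act A p w" for p v w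
  proof (induction p)
    case (pCons a p)
    show ?case
      unfolding poly_act_pCons pCons.IH row_act_add by (rule ext) (simp add: algebra_simps)
  qed (simp add: poly_act_0)
  have sum: "poly_act A (p + r) v = poly_act A p v + poly_act A r v" for p r v
  proof (induction p r rule: poly_induct2)
    case (pCons a p b r)
    show ?case
      unfolding add_pCons poly_act_pCons pCons.IH row_act_add by (rule ext) (simp add: algebra_simps)
  qed (simp add: poly_act_0)
  have smult: "poly_act A (Polynomial.smult c p) v = (\<lambda>i. c * poly_act A p v i)" for c p v
  proof (induction p)
    case (pCons a p)
    have "(\<lambda>i. c * (row_act A (poly_act A p v) i)) = row_act A (\<lambda>i. c * poly_act A p v i)"
      by (simp add: row_act_scale)
    then show ?case by (simp add: poly_act_pCons pCons.IH fun_eq_iff algebra_simps)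
  qed (simp add: poly_act_0 fun_eq_iff)
  have mult: "poly_act A p (poly_act A r v) = poly_act A (p * r) v" for p r v
  proof (induction p)
    case (pCons a p)
    show ?case
      unfolding mult_pCons_left sum smult poly_act_pCons pCons.IH by (rule ext) simp
  qed (simp add: poly_act_0)
  show ?thesis
  proof
    show "poly_act A 1 v = v" for v by (simp add: one_pCons poly_act_const)
  qed (simp_all add: add sum mult)
qed

section \<open>The affine group\<close>

lemma invertible_iff_det:
  fixes A :: "'a::field mat"
  assumes A: "A \<in> carrier_mat n n"
  shows "invertible_mat A \<longleftrightarrow> det A \<noteq> 0"
proof
  assume "invertible_mat A"
  then obtain B where B: "A * B = 1\<^sub>m n" "B * A = 1\<^sub>m (dim_row B)"
    using A by (auto simp: invertible_mat_def inverts_mat_def)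
  have "dim_col (B * A) = dim_col (1\<^sub>m (dim_row B) :: 'a mat)" using B(2) by simp
  moreover have "dim_col (A * B) = dim_col (1\<^sub>m n :: 'a mat)" using B(1) by simp
  ultimately have "B \<in> carrier_mat n n" using A by auto
  then have "det A * det B = 1" using det_mult[OF A] B(1) by (metis det_one)
  then show "det A \<noteq> 0" by auto
next
  assume "det A \<noteq> 0"
  from det_non_zero_imp_unit[OF A this, unfolded Units_def ring_mat_def]
  obtain B where "B \<in> carrier_mat n n" "B * A = 1\<^sub>m n" "A * B = 1\<^sub>m n" by auto
  then show "invertible_mat A" using A unfolding invertible_mat_def inverts_mat_def by auto
qed

lemma invertible_matE:
  fixes A :: "'a::field mat"
  assumes "A \<in> carrier_mat n n" "invertible_mat A"
  obtains B where "B \<in> carrier_mat n n" "A * B = 1\<^sub>m n" "B * A = 1\<^sub>m n"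
proof -
  have "det A \<noteq> 0" using assms invertible_iff_det by blast
  from det_non_zero_imp_unit[OF assms(1) this, unfolded Units_def ring_mat_def]
  show ?thesis using that by auto
qed

lemma GA_iff:
  fixes A :: "'a::field mat"
  assumes n: "1 \<le> n"
  shows "A \<in> GA n \<longleftrightarrow> A \<in> carrier_mat n n \<and> invertible_mat A \<and> row_act A (unit_row 0) = unit_row 0"
proof
  assume "A \<in> GA n"
  then obtain \<alpha> g where A: "A = four_block_mat (1\<^sub>m 1) (0\<^sub>m 1 (n - 1)) \<alpha> g"
    and \<alpha>: "\<alpha> \<in> carrier_mat (n - 1) 1" and g: "g \<in> carrier_mat (n - 1) (n - 1)" "invertible_mat g"
    by (auto simp: GA_def GL_def)
  have "1 + (n - 1) = n" using n by simp
  then have c: "A \<in> carrier_mat n n"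
    using four_block_carrier_mat[OF one_carrier_mat[of 1] g(1), of "0\<^sub>m 1 (n - 1)" \<alpha>] unfolding A by simp
  have "det A = det (1\<^sub>m 1 :: 'a mat) * det g"
    unfolding A by (rule det_four_block_mat_upper_right_zero[OF one_carrier_mat refl \<alpha> g(1)])
  then have "invertible_mat A"
    using g by (simp add: invertible_iff_det[OF c] invertible_iff_det[OF g(1)])
  moreover have "row_act A (unit_row 0) = unit_row 0"
    using n \<alpha> g(1) row_act_unit_row[OF c, of 0] by (auto simp: A unit_row_def fun_eq_iff)
  ultimately show "A \<in> carrier_mat n n \<and> invertible_mat A \<and> row_act A (unit_row 0) = unit_row 0"
    using c by simp
next
  assume *: "A \<in> carrier_mat n n \<and> invertible_mat A \<and> row_act A (unit_row 0) = unit_row 0"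
  then have c: "A \<in> carrier_mat n n" by simp
  define \<alpha> where "\<alpha> = mat (n - 1) 1 (\<lambda>(i, j). A $$ (i + 1, 0))"
  define g where "g = mat (n - 1) (n - 1) (\<lambda>(i, j). A $$ (i + 1, j + 1))"
  have row0: "A $$ (0, j) = unit_row 0 j" if "j < n" for j
    using * that n row_act_unit_row[OF c, of 0] by (simp add: fun_eq_iff) metis
  have g: "g \<in> carrier_mat (n - 1) (n - 1)" and \<alpha>: "\<alpha> \<in> carrier_mat (n - 1) 1"
    by (simp_all add: g_def \<alpha>_def)
  have A: "A = four_block_mat (1\<^sub>m 1) (0\<^sub>m 1 (n - 1)) \<alpha> g"
  proof (rule eq_matI)
    fix i j assume "i < dim_row (four_block_mat (1\<^sub>m 1) (0\<^sub>m 1 (n - 1)) \<alpha> g)"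
      "j < dim_col (four_block_mat (1\<^sub>m 1) (0\<^sub>m 1 (n - 1)) \<alpha> g)"
    then have "i < n" "j < n" using n g by auto
    then show "A $$ (i, j) = four_block_mat (1\<^sub>m 1) (0\<^sub>m 1 (n - 1)) \<alpha> g $$ (i, j)"
      using n row0[of j] by (cases i; cases j) (auto simp: g_def \<alpha>_def unit_row_def)
  qed (use c g n in auto)
  have "det A = det (1\<^sub>m 1 :: 'a mat) * det g"
    by (subst A) (rule det_four_block_mat_upper_right_zero[OF one_carrier_mat refl \<alpha> g])
  then have "invertible_mat g"
    using * by (simp add: invertible_iff_det[OF c] invertible_iff_det[OF g])
  then show "A \<in> GA n" using A \<alpha> g by (auto simp: GA_def GL_def)
qed

lemma GA_carrier: "1 \<le> n \<Longrightarrow> A \<in> GA n \<Longrightarrow> A \<in> carrier_mat n n" for A :: "'a::field mat"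
  by (simp add: GA_iff)

lemma GA_mult:
  fixes A B :: "'a::field mat"
  assumes "1 \<le> n" "A \<in> GA n" "B \<in> GA n"
  shows "A * B \<in> GA n"
proof -
  have c: "A \<in> carrier_mat n n" "B \<in> carrier_mat n n" using assms by (auto simp: GA_carrier)
  then have "A * B \<in> carrier_mat n n" by simp
  moreover have "det (A * B) = det A * det B" using c by (rule det_mult)
  ultimately show ?thesis
    using assms c by (simp add: GA_iff invertible_iff_det[of _ n] row_act_mult[OF c])
qed

lemma GA_inverse:
  fixes A :: "'a::field mat"
  assumes "1 \<le> n" "A \<in> GA n"
  obtains B where "B \<in> GA n" "A * B = 1\<^sub>m n" "B * A = 1\<^sub>m n"
proof -
  have c: "A \<in> carrier_mat n n" "invertible_mat A" "row_act A (unit_row 0) = unit_row 0"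
    using assms by (auto simp: GA_iff)
  obtain B where B: "B \<in> carrier_mat n n" "A * B = 1\<^sub>m n" "B * A = 1\<^sub>m n"
    by (rule invertible_matE[OF c(1,2)])
  have "row_act B (unit_row 0) = row_act (A * B) (unit_row 0)"
    by (simp only: row_act_mult[OF c(1) B(1)] c(3))
  then have "row_act B (unit_row 0) = unit_row 0" by (simp add: B(2) row_act_one)
  moreover have "invertible_mat B"
    using B c(1) by (auto simp: invertible_mat_def inverts_mat_def)
  ultimately have "B \<in> GA n" using B(1) assms(1) by (simp add: GA_iff)
  then show ?thesis using that B by blast
qed

lemma finite_GA: "finite (GA n :: 'a::{field,finite} mat set)"
proof (cases "1 \<le> n")
  case True
  have "inj_on (\<lambda>A :: 'a mat. restrict (\<lambda>i. row_act A (unit_row i)) {..<n}) (GA n)"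
  proof (rule inj_onI)
    fix A B :: "'a mat"
    assume AB: "A \<in> GA n" "B \<in> GA n"
      "restrict (\<lambda>i. row_act A (unit_row i)) {..<n} = restrict (\<lambda>i. row_act B (unit_row i)) {..<n}"
    show "A = B"
    proof (rule mat_eq_if_row_act_eq)
      fix i assume "i < n"
      then show "row_act A (unit_row i) = row_act B (unit_row i)"
        using fun_cong[OF AB(3), of i] by simp
    qed (use AB True in \<open>simp_all add: GA_carrier\<close>)
  qed
  moreover have "(\<lambda>A :: 'a mat. restrict (\<lambda>i. row_act A (unit_row i)) {..<n}) ` GA n
      \<subseteq> PiE {..<n} (\<lambda>_. row_space n)"
    by (auto intro!: row_act_row_space[OF GA_carrier[OF True]] unit_row_in_row_space)
  moreover have "finite (PiE {..<n} (\<lambda>_. row_space n :: (nat \<Rightarrow> 'a) set))"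
    by (intro finite_PiE) (simp_all add: card_row_space)
  ultimately show ?thesis by (meson finite_subset inj_on_finite)
next
  case False
  have "carrier_mat 0 c = {A :: 'a mat. dim_row A = 0 \<and> dim_col A = c}" for c by auto
  have one: "A = 0\<^sub>m 0 c" if "A \<in> carrier_mat 0 c" for A :: "'a mat" and c
    using that by (intro eq_matI) auto
  have "GA n \<subseteq> {four_block_mat (1\<^sub>m 1) (0\<^sub>m 1 0) (0\<^sub>m 0 1) (0\<^sub>m 0 0) :: 'a mat}"
    using False by (auto simp: GA_def GL_def dest!: one)
  then show ?thesis by (rule finite_subset) simp
qed

context poly_module
begin

lemma F_span_list:
  assumes "x \<in> F.span (set xs)"
  shows "\<exists>c. x = (\<Sum>j<length xs. [:c j:] *s (xs ! j))"
  using assms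
proof (induction rule: F.span_induct_alt)
  case base
  show ?case by (rule exI[of _ "\<lambda>_. 0"]) simp
next
  case (step a x y)
  obtain i where i: "i < length xs" "x = xs ! i" using step(1) by (auto simp: in_set_conv_nth)
  obtain c where c: "y = (\<Sum>j<length xs. [:c j:] *s (xs ! j))" using step(2) by blast
  have "[:a:] *s x = (\<Sum>j<length xs. if j = i then [:a:] *s (xs ! j) else 0)"
    using i by simp
  also have "\<dots> = (\<Sum>j<length xs. [:if j = i then a else 0:] *s (xs ! j))"
    by (rule sum.cong) auto
  finally have "[:a:] *s x + y = (\<Sum>j<length xs. [:(if j = i then a else 0) + c j:] *s (xs ! j))"
    unfolding c by (simp only: F.scale_left_distrib sum.distrib)
  then show ?case by (rule exI[of _ "\<lambda>j. (if j = i then a else 0) + c j"])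
qed

end

lemma row_space_subspace:
  fixes A :: "'a::{field,finite} mat"
  assumes "A \<in> carrier_mat m m" "m \<le> n"
  shows "Modules.module.subspace (poly_act A) (row_space n)"
proof -
  interpret poly_module "poly_act A" by (rule poly_module_poly_act)
  show ?thesis
  proof (rule subspace_if_variable_closed)
    show "F.subspace (row_space n)"
      by (auto simp: F.subspace_def row_space_def poly_act_const)
  qed (auto simp: poly_act_var intro: row_act_row_space[OF assms])
qed

lemma J_affine_carrier:
  assumes "lam \<in> ptn_funs"
  shows "J_linear lam \<in> carrier_mat (ptn_norm lam) (ptn_norm lam)"
    "J_affine (lam, k) \<in> carrier_mat (ptn_norm lam + 1) (ptn_norm lam + 1)"
proof -
  show c: "J_linear lam \<in> carrier_mat (ptn_norm lam) (ptn_norm lam)"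
    using blocks_mat_carrier[of "block_list lam"]
    by (simp add: J_linear_eq_blocks_mat total_dim_block_list[OF assms])
  show "J_affine (lam, k) \<in> carrier_mat (ptn_norm lam + 1) (ptn_norm lam + 1)"
    using four_block_carrier_mat[OF one_carrier_mat[of 1] c] by (simp add: J_affine_def)
qed

lemma row_act_J_affine:
  fixes lam :: "'a::field ptn_fun"
  assumes lam: "lam \<in> ptn_funs" and i: "i < ptn_norm lam"
  shows "row_act (J_affine (lam, k)) (unit_row (i + 1))
    = (\<Sum>j<ptn_norm lam. (\<lambda>l. J_linear lam $$ (i, j) * unit_row (j + 1) l)) + (\<lambda>l. eps_list lam k ! i * unit_row 0 l)"
proof
  fix l
  let ?N = "ptn_norm lam"
  note c = J_affine_carrier[OF lam]
  have s: "(\<Sum>j<M. (\<lambda>l. f j * unit_row (j + 1) l)) l = (if 0 < l \<and> l \<le> M then f (l - 1) else 0)"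
    for M and f :: "nat \<Rightarrow> 'a"
    by (induction M) (auto simp: unit_row_def le_Suc_eq)
  have dims: "dim_row (J_linear lam) = ?N" "dim_col (J_linear lam) = ?N" using c(1) by auto
  have "row_act (J_affine (lam, k)) (unit_row (i + 1)) l
      = (if l < ?N + 1 then J_affine (lam, k) $$ (i + 1, l) else 0)"
    using row_act_unit_row[OF c(2), of "i + 1"] i by simp
  also have "\<dots> = (if 0 < l \<and> l \<le> ?N then J_linear lam $$ (i, l - 1) else 0) + eps_list lam k ! i * unit_row 0 l"
    using i dims by (auto simp: J_affine_def eps_list_def unit_row_def eps_def)
  finally show "row_act (J_affine (lam, k)) (unit_row (i + 1)) l
    = ((\<Sum>j<?N. (\<lambda>l. J_linear lam $$ (i, j) * unit_row (j + 1) l)) + (\<lambda>l. eps_list lam k ! i * unit_row 0 l)) l"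
    by (simp only: plus_fun_apply s)
qed

lemma row_act_J_affine_0:
  fixes lam :: "'a::field ptn_fun"
  assumes "lam \<in> ptn_funs"
  shows "row_act (J_affine (lam, k)) (unit_row 0) = unit_row 0"
  using row_act_unit_row[OF J_affine_carrier(2)[OF assms], of 0 k] J_affine_carrier(1)[OF assms]
  by (auto simp: J_affine_def unit_row_def fun_eq_iff)

text \<open>
  If \<open>A = P J Q\<close> with \<open>Q = P\<^bsup>-1\<^esup>\<close>, then \<open>Q A = J Q\<close>, which says that the rows of \<open>Q\<close> realize \<open>J\<close>. The first row of \<open>Q\<close>
  is the marked vector exactly because \<open>Q\<close> lies in the affine group.
\<close>

lemma has_type_imp_affine_type:
  fixes A :: "'a::{field,finite} mat"
  assumes n: "1 \<le> n" and type: "has_type n A (lam, k)"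
  shows "poly_module.affine_type (poly_act A) (row_space n) (unit_row 0) lam k"
proof -
  interpret poly_module "poly_act A" by (rule poly_module_poly_act)
  let ?J = "J_affine (lam, k)" and ?N = "ptn_norm lam"
  have lam: "lam \<in> ptn_funs" "ptn_norm lam = n - 1" and k: "k = 0 \<or> k \<in># lam t_minus_1" and A: "A \<in> GA n"
    using type by (auto simp: has_type_def ptn_funs_of_norm_def)
  obtain P Q where PQ: "P \<in> GA n" "Q \<in> GA n" "similar_mat_wit A ?J P Q"
    using type by (auto simp: has_type_def GA_conjugate_def)
  have c: "A \<in> carrier_mat n n" "P \<in> carrier_mat n n" "Q \<in> carrier_mat n n"
    using A PQ n by (auto simp: GA_carrier)
  have w: "P * Q = 1\<^sub>m n" "Q * P = 1\<^sub>m n" "A = P * ?J * Q" and J: "?J \<in> carrier_mat n n"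
    using similar_mat_witD2[OF c(1) PQ(3)] by auto
  have QA: "Q * A = ?J * Q"
  proof -
    have "Q * A = (Q * P) * (?J * Q)"
      unfolding w(3) using c J by (simp add: assoc_mult_mat[of _ n n _ n _ n])
    then show ?thesis using c J by (simp add: w(2))
  qed
  have Q0: "row_act Q (unit_row 0) = unit_row 0" using PQ(2) n by (simp add: GA_iff)
  define bs where "bs = map (\<lambda>i. row_act Q (unit_row (i + 1))) [0..<?N]"
  have len: "length bs = ?N" by (simp add: bs_def)
  have scale: "row_act Q (\<lambda>l. a * v l) = poly_act A [:a:] (row_act Q v)" for a v
    by (simp add: row_act_scale poly_act_const)
  have "poly_act A [:0, 1:] (bs ! i) = (\<Sum>j<?N. poly_act A [:J_linear lam $$ (i, j):] (bs ! j))
      + poly_act A [:eps_list lam k ! i:] (unit_row 0)" if i: "i < ?N" for i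
  proof -
    have "poly_act A [:0, 1:] (bs ! i) = row_act (Q * A) (unit_row (i + 1))"
      using i by (simp add: bs_def poly_act_var row_act_mult[OF c(3,1)])
    also have "\<dots> = row_act Q (row_act ?J (unit_row (i + 1)))"
      unfolding QA by (rule row_act_mult[OF J c(3)])
    also have "\<dots> = (\<Sum>j<?N. poly_act A [:J_linear lam $$ (i, j):] (row_act Q (unit_row (j + 1))))
      + poly_act A [:eps_list lam k ! i:] (row_act Q (unit_row 0))"
      unfolding row_act_J_affine[OF lam(1) i] row_act_add row_act_sum scale ..
    also have "\<dots> = (\<Sum>j<?N. poly_act A [:J_linear lam $$ (i, j):] (bs ! j))
      + poly_act A [:eps_list lam k ! i:] (unit_row 0)"
      unfolding Q0 by (intro arg_cong2[where f = "(+)"] sum.cong refl) (simp add: bs_def)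
    finally show ?thesis .
  qed
  then have r: "realizes (unit_row 0) (J_linear lam) (eps_list lam k) bs"
    unfolding realizes_def len using J_affine_carrier(1)[OF lam(1)] by (simp add: eps_list_def)
  have "span (insert (unit_row 0) (set bs)) = row_space n"
  proof
    have "insert (unit_row 0) (set bs) \<subseteq> row_space n"
      using n lam(2) by (auto simp: bs_def intro!: row_act_row_space[OF c(3)] unit_row_in_row_space)
    then show "span (insert (unit_row 0) (set bs)) \<subseteq> row_space n"
      by (intro span_minimal row_space_subspace[OF c(1)]) auto
    show "row_space n \<subseteq> span (insert (unit_row 0) (set bs))"
    proof
      fix v :: "nat \<Rightarrow> 'a" assume v: "v \<in> row_space n"
      have "row_act P v \<in> row_space n" using row_act_row_space[OF c(2) _ v] by simp
      have "v = row_act Q (row_act P v)"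
        using row_act_mult[OF c(2,3), of v] by (simp add: w(1) row_act_one)
      also have "\<dots> = (\<Sum>i<n. poly_act A [:row_act P v i:] (row_act Q (unit_row i)))"
        by (subst row_space_expand[OF \<open>row_act P v \<in> row_space n\<close>]) (simp only: row_act_sum scale)
      also have "\<dots> \<in> span (insert (unit_row 0) (set bs))"
      proof (intro span_sum span_scale span_base)
        fix i assume "i \<in> {..<n}"
        then show "row_act Q (unit_row i) \<in> insert (unit_row 0) (set bs)"
          using lam(2) Q0 by (cases i) (auto simp: bs_def)
      qed
      finally show "v \<in> span (insert (unit_row 0) (set bs))" .
    qed
  qed
  moreover have "card (row_space n :: (nat \<Rightarrow> 'a) set) = CARD('a) ^ (?N + 1)"
    using lam(2) n by (simp add: card_row_space)
  moreover have "poly_act A [:0, 1:] (unit_row 0) = unit_row 0"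
    using A n by (simp add: poly_act_var GA_iff)
  ultimately show ?thesis using basis_imp_affine_type[OF lam(1) k len r] by blast
qed

lemma affine_type_imp_has_type:
  fixes A :: "'a::{field,finite} mat"
  assumes n: "1 \<le> n" and A: "A \<in> GA n"
    and type: "poly_module.affine_type (poly_act A) (row_space n) (unit_row 0) lam k"
  shows "has_type n A (lam, k)"
proof -
  interpret poly_module "poly_act A" by (rule poly_module_poly_act)
  let ?J = "J_affine (lam, k)" and ?N = "ptn_norm lam"
  have lam: "lam \<in> ptn_funs" using type by (simp add: affine_type_def)
  have "CARD('a) ^ n = CARD('a) ^ (?N + 1)"
    using affine_type_part(2)[OF type] by (simp only: card_row_space)
  then have norm: "n = ?N + 1" using card_field_gt_1[where 'a = 'a] by (simp only: power_inject_exp)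
  have c: "A \<in> carrier_mat n n" and A0: "row_act A (unit_row 0) = unit_row 0"
    using A n by (auto simp: GA_iff)
  have J: "?J \<in> carrier_mat n n" using J_affine_carrier(2)[OF lam] norm by simp
  obtain bs where bs: "length bs = ?N" "realizes (unit_row 0) (J_linear lam) (eps_list lam k) bs"
    "span (insert (unit_row 0) (set bs)) = row_space n"
    using affine_type_imp_basis[OF type] by blast
  define xs where "xs = unit_row 0 # bs"
  have len: "length xs = n" using bs(1) norm by (simp add: xs_def)
  have xs_in: "xs ! i \<in> row_space n" if "i < n" for i
  proof -
    have "xs ! i \<in> insert (unit_row 0) (set bs)" using that len nth_mem[of i xs] by (simp add: xs_def)
    then show ?thesis using bs(3) span_base by blast
  qed
  define Q where "Q = mat n n (\<lambda>(i, j). (xs ! i) j)"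
  have Q: "Q \<in> carrier_mat n n" by (simp add: Q_def)
  have Qi: "row_act Q (unit_row i) = xs ! i" if "i < n" for i
    using row_act_unit_row[OF Q that] xs_in[OF that] that by (auto simp: Q_def row_space_def fun_eq_iff)
  have scale: "row_act Q (\<lambda>l. a * v l) = poly_act A [:a:] (row_act Q v)" for a v
    by (simp add: row_act_scale poly_act_const)
  \<comment> \<open>The rows of \<open>Q\<close> span, so \<open>Q\<close> has a left inverse \<open>P\<close>, whose rows are coefficient vectors of the unit rows.\<close>
  have "row_space n = F.span (set xs)"
    using span_eq_F_span[OF bs(2)] bs(3) A0 by (simp add: poly_act_var xs_def)
  then have "\<exists>d. unit_row i = (\<Sum>j<n. poly_act A [:d j:] (xs ! j))" if "i < n" for i
  proof -
    have "unit_row i \<in> F.span (set xs)"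
      using unit_row_in_row_space[OF that] \<open>row_space n = F.span (set xs)\<close> by blast
    from F_span_list[OF this] show ?thesis unfolding len .
  qed
  then obtain d where d: "\<And>i. i < n \<Longrightarrow> unit_row i = (\<Sum>j<n. poly_act A [:d i j:] (xs ! j))" by metis
  define P where "P = mat n n (\<lambda>(i, j). d i j)"
  have P: "P \<in> carrier_mat n n" by (simp add: P_def)
  have PQ: "P * Q = 1\<^sub>m n"
  proof (rule mat_eq_if_row_act_eq)
    fix i assume i: "i < n"
    have "row_act P (unit_row i) = (\<Sum>j<n. (\<lambda>l. d i j * unit_row j l))"
    proof -
      define r where "r = row_act P (unit_row i)"
      have "r \<in> row_space n" unfolding r_def by (rule row_act_row_space[OF P]) (simp_all add: i unit_row_in_row_space)
      then have "r = (\<Sum>j<n. (\<lambda>l. r j * unit_row j l))" by (rule row_space_expand)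
      moreover have "r j = d i j" if "j < n" for j
        using row_act_unit_row[OF P i] that i by (simp add: r_def P_def)
      ultimately show ?thesis unfolding r_def[symmetric] by simp
    qed
    then have "row_act (P * Q) (unit_row i) = (\<Sum>j<n. poly_act A [:d i j:] (row_act Q (unit_row j)))"
      unfolding row_act_mult[OF P Q] by (simp only: row_act_sum scale)
    also have "\<dots> = (\<Sum>j<n. poly_act A [:d i j:] (xs ! j))" by (rule sum.cong) (simp_all add: Qi)
    finally show "row_act (P * Q) (unit_row i) = row_act (1\<^sub>m n) (unit_row i)"
      using d[OF i] by (simp add: row_act_one)
  qed (use P Q in simp_all)
  have QP: "Q * P = 1\<^sub>m n" by (rule mat_mult_left_right_inverse[OF P Q PQ])
  have "invertible_mat Q" "invertible_mat P"
    using P Q PQ QP by (auto simp: invertible_mat_def inverts_mat_def)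
  moreover have Q0: "row_act Q (unit_row 0) = unit_row 0" using Qi[of 0] n by (simp add: xs_def)
  moreover have "row_act P (unit_row 0) = unit_row 0"
    using row_act_mult[OF Q P, of "unit_row 0"] by (simp add: QP row_act_one Q0)
  ultimately have GA: "P \<in> GA n" "Q \<in> GA n" using P Q n by (simp_all add: GA_iff)
  have "Q * A = ?J * Q"
  proof (rule mat_eq_if_row_act_eq)
    fix i assume i: "i < n"
    have "row_act A (xs ! i) = row_act Q (row_act ?J (unit_row i))"
    proof (cases i)
      case 0
      then show ?thesis using A0 Q0 row_act_J_affine_0[OF lam] by (simp add: xs_def)
    next
      case (Suc i')
      then have i': "i' < ?N" using i norm by simp
      have "row_act A (xs ! i) = (\<Sum>j<?N. poly_act A [:J_linear lam $$ (i', j):] (bs ! j))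
          + poly_act A [:eps_list lam k ! i':] (unit_row 0)"
        using bs(1,2) i' by (simp add: realizes_def Suc xs_def flip: poly_act_var)
      also have "\<dots> = (\<Sum>j<?N. poly_act A [:J_linear lam $$ (i', j):] (row_act Q (unit_row (j + 1))))
          + poly_act A [:eps_list lam k ! i':] (row_act Q (unit_row 0))"
        unfolding Q0 using norm Qi by (intro arg_cong2[where f = "(+)"] sum.cong refl) (simp add: xs_def)
      also have "\<dots> = row_act Q (row_act ?J (unit_row (i' + 1)))"
        unfolding row_act_J_affine[OF lam i'] row_act_add row_act_sum scale ..
      finally show ?thesis by (simp add: Suc)
    qed
    then show "row_act (Q * A) (unit_row i) = row_act (?J * Q) (unit_row i)"
      by (simp add: row_act_mult[OF Q c] row_act_mult[OF J Q] Qi[OF i])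
  qed (use Q c J in simp_all)
  then have "A = P * ?J * Q"
  proof -
    assume eq: "Q * A = ?J * Q"
    have "A = (P * Q) * A" using c by (simp add: PQ)
    also have "\<dots> = P * (Q * A)" using P Q c by (simp add: assoc_mult_mat[of _ n n _ n _ n])
    also have "\<dots> = P * ?J * Q" unfolding eq using P Q J by (simp add: assoc_mult_mat[of _ n n _ n _ n])
    finally show ?thesis .
  qed
  then have "similar_mat_wit A ?J P Q"
    using P Q PQ QP c J by (intro similar_mat_witI[of _ _ n]) simp_all
  then show ?thesis
    using GA A lam norm affine_type_part(1)[OF type]
    by (auto simp: has_type_def GA_conjugate_def ptn_funs_of_norm_def)
qed

lemma has_type_iff:
  fixes A :: "'a::{field,finite} mat"
  assumes "1 \<le> n" "A \<in> GA n"
  shows "has_type n A (lam, k) \<longleftrightarrow> poly_module.affine_type (poly_act A) (row_space n) (unit_row 0) lam k"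
  using has_type_imp_affine_type affine_type_imp_has_type assms by blast

lemma has_type_unique:
  fixes A :: "'a::{field,finite} mat"
  assumes "1 \<le> n" "has_type n A (lam, k)" "has_type n A (lam', k')"
  shows "lam = lam'" "k = k'"
  using poly_module.affine_type_unique[OF poly_module_poly_act has_type_imp_affine_type has_type_imp_affine_type]
    assms by blast+

text \<open>
  Existence of the canonical form. Invertibility of \<open>A\<close> excludes the polynomial \<open>t\<close>.
\<close>

lemma has_type_exists:
  fixes A :: "'a::{field,finite} mat"
  assumes n: "1 \<le> n" and A: "A \<in> GA n"
  shows "\<exists>lam k. has_type n A (lam, k)"
proof -
  interpret poly_module "poly_act A" by (rule poly_module_poly_act)
  have c: "A \<in> carrier_mat n n" and A0: "row_act A (unit_row 0) = unit_row 0"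
    using A n by (auto simp: GA_iff)
  obtain B where B: "B \<in> GA n" "A * B = 1\<^sub>m n" by (rule GA_inverse[OF n A])
  have "v = 0" if "row_act A v = 0" for v
    using row_act_mult[OF c GA_carrier[OF n B(1)], of v] that by (simp add: B(2) row_act_one row_act_zero)
  moreover have "(unit_row 0 :: nat \<Rightarrow> 'a) \<noteq> 0" by (auto simp: unit_row_def fun_eq_iff)
  ultimately have "\<exists>lam k. affine_type (row_space n) (unit_row 0) lam k"
    using n A0 by (intro affine_type_exists row_space_subspace[OF c])
      (auto simp: card_row_space poly_act_var unit_row_in_row_space)
  then show ?thesis using has_type_iff[OF n A] by blast
qed

section \<open>Modified types\<close>

lemma modify_t_minus_1_sum:
  "0 \<notin># M \<Longrightarrow> \<Sum>\<^sub># (filter_mset (\<lambda>i. 0 < i) (image_mset (\<lambda>i. i - 1) M)) + size M = \<Sum>\<^sub># (M :: nat multiset)"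
  by (induction M) auto

text \<open>
  Decreasing all parts by one loses only the number of parts equal to \<open>1\<close>, which the number of parts restores.
\<close>

lemma multiset_from_decrements:
  fixes M :: "nat multiset"
  defines "M' \<equiv> filter_mset (\<lambda>i. 0 < i) (image_mset (\<lambda>i. i - 1) M)"
  assumes "0 \<notin># M"
  shows "M = image_mset Suc M' + replicate_mset (size M - size M') 1"
  using assms(2) unfolding M'_def
proof (induction M)
  case (add x M)
  let ?f = "\<lambda>M. filter_mset (\<lambda>i. 0 < i) (image_mset (\<lambda>i. i - 1) M) :: nat multiset"
  have le: "size (?f M) \<le> size M" by (metis size_filter_mset_lesseq size_image_mset)
  have IH: "M = image_mset Suc (?f M) + replicate_mset (size M - size (?f M)) 1" using add by simp
  show ?case
  proof (cases "x = 1")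
    case True
    have "size (add_mset x M) - size (?f (add_mset x M)) = Suc (size M - size (?f M))"
      using le by (simp add: True Suc_diff_le)
    then show ?thesis using IH True by simp
  next
    case False
    then have "?f (add_mset x M) = add_mset (x - 1) (?f M)" "Suc (x - 1) = x" using add.prems by auto
    then show ?thesis using IH by simp
  qed
qed simp

lemma ptn_norm_superset:
  assumes "finite S" "{f. lam f \<noteq> {#}} \<subseteq> S"
  shows "ptn_norm lam = (\<Sum>f\<in>S. degree f * \<Sum>\<^sub># (lam f))"
  unfolding ptn_norm_def by (rule sum.mono_neutral_left[OF assms]) auto

lemma ptn_norm_modify:
  assumes lam: "lam \<in> ptn_funs"
  shows "ptn_norm lam = ptn_norm (modify lam) + size (lam t_minus_1)"
proof -
  define S where "S = insert t_minus_1 {f. lam f \<noteq> {#}}"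
  have S: "finite S" "{f. lam f \<noteq> {#}} \<subseteq> S" "{f. modify lam f \<noteq> {#}} \<subseteq> S"
    using lam by (auto simp: ptn_funs_def S_def modify_def)
  have "degree f * \<Sum>\<^sub># (lam f) = degree f * \<Sum>\<^sub># (modify lam f) + (if f = t_minus_1 then size (lam f) else 0)" for f
  proof (cases "f = t_minus_1")
    case True
    have "0 \<notin># lam t_minus_1" using lam by (simp add: ptn_funs_def)
    then show ?thesis using modify_t_minus_1_sum[of "lam t_minus_1"] by (simp add: True modify_def)
  qed (simp add: modify_def)
  then have "(\<Sum>f\<in>S. degree f * \<Sum>\<^sub># (lam f)) = (\<Sum>f\<in>S. degree f * \<Sum>\<^sub># (modify lam f)) + size (lam t_minus_1)"
    using S(1) by (simp add: sum.distrib S_def)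
  then show ?thesis using ptn_norm_superset[OF S(1,2)] ptn_norm_superset[OF S(1,3)] by simp
qed

lemma modify_inject:
  assumes "lam \<in> ptn_funs" "lam' \<in> ptn_funs" "ptn_norm lam = ptn_norm lam'" "modify lam = modify lam'"
  shows "lam = lam'"
proof
  fix f
  show "lam f = lam' f"
  proof (cases "f = t_minus_1")
    case False
    then show ?thesis using fun_cong[OF assms(4), of f] by (simp add: modify_def)
  next
    case True
    have size: "size (lam t_minus_1) = size (lam' t_minus_1)"
      using ptn_norm_modify[OF assms(1)] ptn_norm_modify[OF assms(2)] assms(3,4) by simp
    have zero: "0 \<notin># lam t_minus_1" "0 \<notin># lam' t_minus_1" using assms(1,2) by (auto simp: ptn_funs_def)
    have "filter_mset (\<lambda>i. 0 < i) (image_mset (\<lambda>i. i - 1) (lam t_minus_1))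
        = filter_mset (\<lambda>i. 0 < i) (image_mset (\<lambda>i. i - 1) (lam' t_minus_1))"
      using fun_cong[OF assms(4), of t_minus_1] by (simp add: modify_def)
    then show ?thesis
      using multiset_from_decrements[OF zero(1)] multiset_from_decrements[OF zero(2)] size
      unfolding True by metis
  qed
qed

lemma modify_in_affine_types:
  assumes "lam \<in> ptn_funs" "k = 0 \<or> k \<in># lam t_minus_1"
  shows "(modify lam, k) \<in> affine_types"
proof -
  have "{f. modify lam f \<noteq> {#}} \<subseteq> {f. lam f \<noteq> {#}}" by (auto simp: modify_def)
  moreover have "finite {f. lam f \<noteq> {#}}" using assms(1) by (simp add: ptn_funs_def)
  ultimately have "finite {f. modify lam f \<noteq> {#}}" by (rule finite_subset)
  moreover have "0 \<notin># modify lam f" for f using assms(1) by (simp add: ptn_funs_def modify_def)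
  moreover have "modify lam f = {#}" if "f \<notin> Phi" for f
    using that assms(1) t_minus_1_in_Phi unfolding ptn_funs_def modify_def by auto
  ultimately have "modify lam \<in> ptn_funs" unfolding ptn_funs_def by blast
  moreover have "k - 1 = 0 \<or> k - 1 \<in># modify lam t_minus_1" if "1 \<le> k"
    using assms(2) that by (auto simp: modify_def)
  ultimately show ?thesis by (auto simp: affine_types_def)
qed

lemma has_typeD:
  assumes "has_type n A (lam, k)"
  shows "lam \<in> ptn_funs" "ptn_norm lam = n - 1" "A \<in> GA n"
    "\<exists>P \<in> GA n. \<exists>Q \<in> GA n. similar_mat_wit A (J_affine (lam, k)) P Q"
  using assms unfolding has_type_def prod.case ptn_funs_of_norm_def GA_conjugate_def by blast+

lemma has_modified_type_unique:
  fixes A :: "'a::{field,finite} mat"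
  assumes "1 \<le> n" "has_modified_type n A N" "has_modified_type n A N'"
  shows "N = N'"
proof -
  obtain lam k where N: "N = (modify lam, k)" and 1: "has_type n A (lam, k)"
    using assms(2) by (cases N) (auto simp: has_modified_type_def)
  obtain lam' k' where N': "N' = (modify lam', k')" and 2: "has_type n A (lam', k')"
    using assms(3) by (cases N') (auto simp: has_modified_type_def)
  show ?thesis using has_type_unique[OF assms(1) 1 2] by (simp add: N N')
qed

lemma has_modified_type_exists:
  fixes A :: "'a::{field,finite} mat"
  assumes "1 \<le> n" "A \<in> GA n"
  shows "\<exists>N. has_modified_type n A N"
  using has_type_exists[OF assms] by (auto simp: has_modified_type_def)

lemma has_modified_type_in_affine_types:
  assumes "has_modified_type n A N"
  shows "N \<in> affine_types"
  using assms modify_in_affine_types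
  by (cases N) (auto simp: has_modified_type_def has_type_def ptn_funs_of_norm_def)

lemma has_modified_type_GA: "has_modified_type n A N \<Longrightarrow> A \<in> GA n"
  by (cases N) (auto simp: has_modified_type_def has_type_def)

section \<open>The norm of a type is a rank\<close>

definition fixed_rows :: "nat \<Rightarrow> 'a::comm_ring_1 mat \<Rightarrow> (nat \<Rightarrow> 'a) set" where
  "fixed_rows n A = {v \<in> row_space n. row_act A v = v}"

definition moved_rows :: "nat \<Rightarrow> 'a::comm_ring_1 mat \<Rightarrow> (nat \<Rightarrow> 'a) set" where
  "moved_rows n A = (\<lambda>v. row_act A v - v) ` row_space n"

lemma row_space_diff: "v \<in> row_space n \<Longrightarrow> w \<in> row_space n \<Longrightarrow> v - w \<in> row_space n"
  for v w :: "nat \<Rightarrow> 'a::ab_group_add"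
  by (simp add: row_space_def)

text \<open>
  The rows fixed by \<open>A\<close> form the kernel of \<open>t - 1\<close>, to which each block of \<open>t - 1\<close> in the row space contributes one
  dimension, whereas the modified type subtracts one for each part of \<open>lam (t - 1)\<close>. For \<open>k > 0\<close> there are as many
  blocks as parts, but \<open>lam\<close> describes a space of dimension \<open>n - 1\<close>; this is the summand \<open>1\<close> of the norm. For \<open>k = 0\<close>
  the marked vector is one more block, which makes up for the missing dimension. In both cases
  \<open>affine_norm N\<close> is the rank of \<open>A - 1\<close>.
\<close>

lemma card_fixed_rows:
  fixes A :: "'a::{field,finite} mat"
  assumes n: "1 \<le> n" and type: "has_modified_type n A N"
  obtains c where "n = affine_norm N + c" "card (fixed_rows n A) = CARD('a) ^ c"
proof -
  interpret poly_module "poly_act A" by (rule poly_module_poly_act)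
  obtain lam k where N: "N = (modify lam, k)" and ht: "has_type n A (lam, k)"
    using type by (cases N) (auto simp: has_modified_type_def)
  have lam: "lam \<in> ptn_funs" "ptn_norm lam = n - 1" using ht by (auto simp: has_type_def ptn_funs_of_norm_def)
  obtain v ds where ds: "affine_sum k v ds (row_space n) (unit_row 0)"
    and bl: "mset (blocks ds) + mset (special k) = mset (block_list lam)"
    using has_type_imp_affine_type[OF n ht] by (auto simp: affine_type_def)
  define c where "c = size (parts_of t_minus_1 (mset (blocks ds)))"
  have "parts_of t_minus_1 (mset (block_list lam))
      = parts_of t_minus_1 (mset (blocks ds)) + parts_of t_minus_1 (mset (special k :: ('a poly \<times> nat) list))"
    unfolding bl[symmetric] by (simp only: parts_of_def filter_union_mset image_mset_union)
  then have "size (lam t_minus_1) = c + (if k = 0 then 0 else 1)"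
    unfolding parts_of_block_list[OF lam(1)] c_def by (simp add: special_def)
  then have "n = affine_norm N + (1 + c)"
    using ptn_norm_modify[OF lam(1)] lam(2) n by (cases "k = 0") (simp_all add: N affine_norm_def)
  moreover have "fixed_rows n A = {u \<in> row_space n. poly_act A t_minus_1 u = 0}"
    unfolding fixed_rows_def t_minus_1_scale poly_act_var by simp
  then have "card (fixed_rows n A) = CARD('a) ^ (1 + c)"
    using card_fixed_affine_sum[OF ds] by (simp add: c_def)
  ultimately show ?thesis by (rule that)
qed

lemma card_moved_rows:
  fixes A :: "'a::{field,finite} mat"
  assumes n: "1 \<le> n" and type: "has_modified_type n A N"
  shows "card (moved_rows n A) = CARD('a) ^ affine_norm N"
proof -
  obtain c where c: "n = affine_norm N + c" "card (fixed_rows n A) = CARD('a) ^ c"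
    by (rule card_fixed_rows[OF n type])
  have "card (row_space n :: (nat \<Rightarrow> 'a) set)
      = card {v \<in> row_space n. row_act A v - v = 0} * card (moved_rows n A)"
    unfolding moved_rows_def
    by (rule card_kernel_times_card_image) (simp_all only: card_row_space row_space_diff row_act_diff algebra_simps)
  also have "{v \<in> row_space n. row_act A v - v = 0} = fixed_rows n A" by (simp add: fixed_rows_def)
  finally have "CARD('a) ^ (c + affine_norm N) = CARD('a) ^ c * card (moved_rows n A)"
    using c by (simp only: card_row_space add.commute)
  then show ?thesis by (simp add: power_add)
qed

lemma moved_rows_mult:
  fixes A B :: "'a::comm_ring_1 mat"
  assumes "A \<in> carrier_mat n n" "B \<in> carrier_mat n n"
  shows "moved_rows n (A * B) \<subseteq> (\<lambda>(x, y). x + y) ` (moved_rows n A \<times> moved_rows n B)"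
proof
  fix x assume "x \<in> moved_rows n (A * B)"
  then obtain v where v: "v \<in> row_space n" "x = row_act (A * B) v - v" by (auto simp: moved_rows_def)
  have "row_act A v \<in> row_space n" using row_act_row_space[OF assms(1) _ v(1)] by simp
  then have "row_act A v - v \<in> moved_rows n A" "row_act B (row_act A v) - row_act A v \<in> moved_rows n B"
    using v(1) unfolding moved_rows_def by blast+
  moreover have "x = (row_act A v - v) + (row_act B (row_act A v) - row_act A v)"
    unfolding v(2) row_act_mult[OF assms] by simp
  ultimately show "x \<in> (\<lambda>(x, y). x + y) ` (moved_rows n A \<times> moved_rows n B)" by blast
qed

text \<open>
  Writing \<open>A B - 1\<close> as \<open>(A - 1) + A (B - 1)\<close> bounds its image by the sum of the images of \<open>A - 1\<close> and \<open>B - 1\<close>, and so its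
  rank by the sum of the ranks. If the ranks add up, the image is the whole sum, and the kernel, which always contains
  the intersection of the two kernels, equals this intersection.
\<close>

lemma affine_norm_subadditive:
  fixes A B :: "'a::{field,finite} mat"
  assumes n: "1 \<le> n" and types: "has_modified_type n A L" "has_modified_type n B M" "has_modified_type n (A * B) N"
  shows "affine_norm N \<le> affine_norm L + affine_norm M"
    "affine_norm N = affine_norm L + affine_norm M \<Longrightarrow>
      moved_rows n A \<subseteq> moved_rows n (A * B) \<and> moved_rows n B \<subseteq> moved_rows n (A * B) \<and>
      fixed_rows n (A * B) \<subseteq> fixed_rows n A \<and> fixed_rows n (A * B) \<subseteq> fixed_rows n B"
proof -
  let ?q = "CARD('a)" and ?S = "(\<lambda>(x, y). x + y) ` (moved_rows n A \<times> moved_rows n B)"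
  note card = card_moved_rows[OF n types(1)] card_moved_rows[OF n types(2)] card_moved_rows[OF n types(3)]
  have c: "A \<in> carrier_mat n n" "B \<in> carrier_mat n n"
    using types n by (auto intro: GA_carrier dest: has_modified_type_GA)
  have fin: "finite (moved_rows n A)" "finite (moved_rows n B)" "finite ?S"
    by (simp_all add: moved_rows_def card_row_space)
  have sub: "moved_rows n (A * B) \<subseteq> ?S" by (rule moved_rows_mult[OF c])
  have "card ?S \<le> card (moved_rows n A \<times> moved_rows n B)" using fin by (intro card_image_le) simp
  then have le: "card ?S \<le> ?q ^ (affine_norm L + affine_norm M)"
    by (simp add: card_cartesian_product card power_add)
  have "?q ^ affine_norm N \<le> ?q ^ (affine_norm L + affine_norm M)"
    using card_mono[OF fin(3) sub] le card(3) by simp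
  then show "affine_norm N \<le> affine_norm L + affine_norm M"
    by (rule power_le_imp_le_exp[OF card_field_gt_1])
  assume eq: "affine_norm N = affine_norm L + affine_norm M"
  have image: "moved_rows n (A * B) = ?S"
    using sub le card(3) eq by (intro card_seteq[OF fin(3)]) simp_all
  have zero: "0 \<in> moved_rows n X" for X :: "'a mat"
    unfolding moved_rows_def by (rule image_eqI[of _ _ 0]) (simp_all add: row_act_zero row_space_def)
  have 1: "moved_rows n A \<subseteq> moved_rows n (A * B)" "moved_rows n B \<subseteq> moved_rows n (A * B)"
  proof -
    have "x \<in> ?S" if "x \<in> moved_rows n A" for x
      by (rule image_eqI[of _ _ "(x, 0)"]) (simp_all only: prod.case add_0_right mem_Sigma_iff that zero simp_thms)
    moreover have "x \<in> ?S" if "x \<in> moved_rows n B" for x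
      by (rule image_eqI[of _ _ "(0, x)"]) (simp_all only: prod.case add_0_left mem_Sigma_iff that zero simp_thms)
    ultimately show "moved_rows n A \<subseteq> moved_rows n (A * B)" "moved_rows n B \<subseteq> moved_rows n (A * B)"
      unfolding image by blast+
  qed
  \<comment> \<open>\<open>B - 1\<close> maps \<open>fixed_rows n A\<close> into \<open>moved_rows n B\<close> with kernel \<open>?I\<close>, so \<open>?I\<close> has dimension at least
      \<open>n - affine_norm L - affine_norm M\<close>, which is the dimension of the rows fixed by \<open>A * B\<close>.\<close>
  let ?I = "fixed_rows n A \<inter> fixed_rows n B"
  obtain a where a: "n = affine_norm L + a" "card (fixed_rows n A) = ?q ^ a"
    by (rule card_fixed_rows[OF n types(1)])
  obtain d where d: "n = affine_norm N + d" "card (fixed_rows n (A * B)) = ?q ^ d"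
    by (rule card_fixed_rows[OF n types(3)])
  have finF: "finite (fixed_rows n X)" for X :: "'a mat"
    by (rule finite_subset[OF _ card_row_space(1)]) (auto simp: fixed_rows_def)
  have "card (fixed_rows n A) = card {v \<in> fixed_rows n A. row_act B v - v = 0}
      * card ((\<lambda>v. row_act B v - v) ` fixed_rows n A)"
  proof (rule card_kernel_times_card_image[OF finF])
    fix u v assume "u \<in> fixed_rows n A" "v \<in> fixed_rows n A"
    then show "u - v \<in> fixed_rows n A" by (simp only: fixed_rows_def mem_Collect_eq row_space_diff row_act_diff simp_thms)
    show "row_act B (u - v) - (u - v) = row_act B u - u - (row_act B v - v)"
      by (simp only: row_act_diff algebra_simps)
  qed
  also have "{v \<in> fixed_rows n A. row_act B v - v = 0} = ?I" by (auto simp: fixed_rows_def)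
  also have "card ?I * card ((\<lambda>v. row_act B v - v) ` fixed_rows n A) \<le> card ?I * card (moved_rows n B)"
    by (intro mult_left_mono card_mono fin) (auto simp: moved_rows_def fixed_rows_def)
  finally have "?q ^ a \<le> card ?I * ?q ^ affine_norm M" using a card(2) by simp
  moreover have "a = d + affine_norm M" using a(1) d(1) eq by simp
  ultimately have "?q ^ d \<le> card ?I" by (simp add: power_add)
  moreover have "?I \<subseteq> fixed_rows n (A * B)" by (auto simp: fixed_rows_def row_act_mult[OF c])
  ultimately have "?I = fixed_rows n (A * B)"
    using d(2) by (intro card_seteq[OF finF]) simp_all
  then show "moved_rows n A \<subseteq> moved_rows n (A * B) \<and> moved_rows n B \<subseteq> moved_rows n (A * B) \<and>
      fixed_rows n (A * B) \<subseteq> fixed_rows n A \<and> fixed_rows n (A * B) \<subseteq> fixed_rows n B"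
    using 1 by blast
qed

section \<open>Stability\<close>

definition extend_mat :: "nat \<Rightarrow> nat \<Rightarrow> 'a::comm_ring_1 mat \<Rightarrow> 'a mat" where
  "extend_mat n n' A = four_block_mat A (0\<^sub>m n (n' - n)) (0\<^sub>m (n' - n) n) (1\<^sub>m (n' - n))"

lemma extend_mat_carrier: "A \<in> carrier_mat n n \<Longrightarrow> n \<le> n' \<Longrightarrow> extend_mat n n' A \<in> carrier_mat n' n'"
  using four_block_carrier_mat[of A n n "1\<^sub>m (n' - n)" "n' - n" "n' - n"] by (simp add: extend_mat_def)

lemma row_act_extend_mat:
  assumes A: "A \<in> carrier_mat n n" and n: "n \<le> n'"
  shows "row_act (extend_mat n n' A) = row_act A"
proof (rule ext, rule ext)
  fix v j
  have dim: "dim_row (extend_mat n n' A) = n'" "dim_row A = n" using extend_mat_carrier[OF assms] A by auto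
  have split: "(\<Sum>i<n'. g i) = (\<Sum>i<n. g i) + (\<Sum>i<n' - n. g (n + i))" for g :: "nat \<Rightarrow> 'a"
    using sum_lessThan_split[of g n "n' - n"] n by simp
  show "row_act (extend_mat n n' A) v j = row_act A v j"
  proof (cases "j < n")
    case True
    have "(\<Sum>i<n. v i * extend_mat n n' A $$ (i, j)) = (\<Sum>i<n. v i * A $$ (i, j))"
      using True A n by (intro sum.cong) (auto simp: extend_mat_def)
    moreover have "(\<Sum>i<n' - n. v (n + i) * extend_mat n n' A $$ (n + i, j)) = 0"
      using True A n by (intro sum.neutral) (auto simp: extend_mat_def)
    ultimately show ?thesis using True n by (simp add: row_act_def dim split)
  next
    case False
    show ?thesis
    proof (cases "j < n'")
      case True
      have "(\<Sum>i<n. v i * extend_mat n n' A $$ (i, j)) = 0"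
        using True False A n by (intro sum.neutral) (auto simp: extend_mat_def)
      moreover have "(\<Sum>i<n' - n. v (n + i) * extend_mat n n' A $$ (n + i, j))
          = (\<Sum>i<n' - n. if i = j - n then v (n + i) else 0)"
        using True False A n by (intro sum.cong) (auto simp: extend_mat_def)
      ultimately show ?thesis using True False n by (simp add: row_act_def dim split)
    qed (use False in \<open>simp add: row_act_def dim\<close>)
  qed
qed

lemma poly_act_extend_mat:
  "A \<in> carrier_mat n n \<Longrightarrow> n \<le> n' \<Longrightarrow> poly_act (extend_mat n n' A) = poly_act A"
  by (rule ext) (simp add: poly_act_def row_act_extend_mat)

lemma extend_mat_GA_iff:
  fixes A :: "'a::field mat"
  assumes n: "1 \<le> n" "n \<le> n'" and A: "A \<in> carrier_mat n n"
  shows "extend_mat n n' A \<in> GA n' \<longleftrightarrow> A \<in> GA n"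
proof -
  note c = extend_mat_carrier[OF A n(2)]
  have "det (extend_mat n n' A) = det A * det (1\<^sub>m (n' - n) :: 'a mat)"
    unfolding extend_mat_def by (rule det_four_block_mat_upper_right_zero[OF A refl zero_carrier_mat one_carrier_mat])
  then show ?thesis
    using n A c by (simp add: GA_iff invertible_iff_det[OF A] invertible_iff_det[OF c] row_act_extend_mat)
qed

lemma extend_mat_inject:
  fixes A B :: "'a::field mat"
  assumes "A \<in> carrier_mat n n" "B \<in> carrier_mat n n" "n \<le> n'" "extend_mat n n' A = extend_mat n n' B"
  shows "A = B"
  by (rule mat_eq_if_row_act_eq[OF assms(1,2)]) (metis assms row_act_extend_mat)

lemma extend_mat_mult:
  fixes A B :: "'a::field mat"
  assumes "A \<in> carrier_mat n n" "B \<in> carrier_mat n n" "n \<le> n'"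
  shows "extend_mat n n' A * extend_mat n n' B = extend_mat n n' (A * B)"
proof (rule mat_eq_if_row_act_eq[where n = n'])
  note c = extend_mat_carrier[OF assms(1,3)] extend_mat_carrier[OF assms(2,3)]
  show "extend_mat n n' A * extend_mat n n' B \<in> carrier_mat n' n'" using c by simp
  have AB: "A * B \<in> carrier_mat n n" using assms by simp
  show "extend_mat n n' (A * B) \<in> carrier_mat n' n'" by (rule extend_mat_carrier[OF AB assms(3)])
  fix i
  show "row_act (extend_mat n n' A * extend_mat n n' B) (unit_row i) = row_act (extend_mat n n' (A * B)) (unit_row i)"
    unfolding row_act_mult[OF c] row_act_extend_mat[OF assms(1,3)] row_act_extend_mat[OF assms(2,3)]
      row_act_extend_mat[OF AB assms(3)] row_act_mult[OF assms(1,2)] ..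
qed

text \<open>
  A new fixed vector contributes a block of size \<open>1\<close> for \<open>t - 1\<close>, which the modified type does not see.
\<close>

lemma (in poly_module) affine_type_add_fixed_vector:
  assumes type: "affine_type V e lam k" and w: "[:0, 1:] *s w = w"
    and V': "V' = span (insert w V)" "card V' = CARD('a) * card V"
  shows "\<exists>lam'. affine_type V' e lam' k \<and> modify lam' = modify lam"
proof -
  obtain v ds where lam: "lam \<in> ptn_funs" and ds: "affine_sum k v ds V e"
    and bl: "mset (blocks ds) + mset (special k) = mset (block_list lam)"
    using type by (auto simp: affine_type_def)
  have s: "cyclic_sum ((t_minus_1, k + 1, v) # ds) V" using ds by (simp add: affine_sum_def)
  then have V: "V = span (insert v (gens ds))" by (simp add: cyclic_sum_def)
  have "V' = span (insert v (gens ((t_minus_1, 1, w) # ds)))"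
  proof -
    have "span ({w} \<union> V) = span ({w} \<union> insert v (gens ds))"
      by (rule span_Un_cong) (simp_all add: V span_span)
    then show ?thesis unfolding V'(1) by (simp add: insert_commute)
  qed
  moreover have "card V' = CARD('a) ^ total_dim (blocks ((t_minus_1, k + 1, v) # (t_minus_1, 1, w) # ds))"
  proof -
    have "card V = CARD('a) ^ total_dim (blocks ((t_minus_1, k + 1, v) # ds))"
      using s unfolding cyclic_sum_def by blast
    then show ?thesis unfolding V'(2) by (simp flip: power_Suc)
  qed
  moreover have "t_minus_1 ^ 1 *s w = 0" using w t_minus_1_scale[of w] by simp
  moreover have "\<forall>(f, m, v) \<in> set ((t_minus_1, k + 1, v) # ds). f \<noteq> 0 \<and> f ^ m *s v = 0"
    using s unfolding cyclic_sum_def by blast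
  ultimately have "cyclic_sum ((t_minus_1, k + 1, v) # (t_minus_1, 1, w) # ds) V'"
    unfolding cyclic_sum_def by auto
  then have s': "affine_sum k v ((t_minus_1, 1, w) # ds) V' e"
    using ds t_minus_1_in_Phi by (auto simp: affine_sum_def)
  define lam' where "lam' = lam(t_minus_1 := add_mset 1 (lam t_minus_1))"
  have lam': "lam' \<in> ptn_funs"
  proof -
    have "{f. lam' f \<noteq> {#}} \<subseteq> insert t_minus_1 {f. lam f \<noteq> {#}}" by (auto simp: lam'_def)
    moreover have "finite (insert t_minus_1 {f. lam f \<noteq> {#}})" using lam by (simp add: ptn_funs_def)
    ultimately have "finite {f. lam' f \<noteq> {#}}" by (rule finite_subset)
    then show ?thesis using lam t_minus_1_in_Phi by (auto simp: ptn_funs_def lam'_def)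
  qed
  have "mset (block_list lam') = add_mset (t_minus_1, 1) (mset (block_list lam))"
  proof (rule parts_of_inject)
    fix f
    show "parts_of f (mset (block_list lam')) = parts_of f (add_mset (t_minus_1, 1) (mset (block_list lam)))"
      unfolding parts_of_add_mset parts_of_block_list[OF lam] parts_of_block_list[OF lam']
      by (auto simp: lam'_def)
  qed
  then have "affine_type V' e lam' k"
    unfolding affine_type_def using lam' s' bl by (intro conjI exI[of _ v] exI[of _ "(t_minus_1, 1, w) # ds"]) auto
  moreover have "modify lam' = modify lam" by (auto simp: modify_def lam'_def)
  ultimately show ?thesis by blast
qed

lemma affine_type_row_space_mono:
  fixes A :: "'a::{field,finite} mat"
  assumes n: "1 \<le> n" "n \<le> n'" and A: "A \<in> carrier_mat n n"
    and type: "poly_module.affine_type (poly_act A) (row_space n) (unit_row 0) lam k"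
  shows "\<exists>lam'. poly_module.affine_type (poly_act A) (row_space n') (unit_row 0) lam' k \<and> modify lam' = modify lam"
  using n(2)
proof (induction n' rule: dec_induct)
  case base
  then show ?case using type by blast
next
  case (step m)
  interpret poly_module "poly_act A" by (rule poly_module_poly_act)
  obtain lam' where lam': "affine_type (row_space m) (unit_row 0) lam' k" "modify lam' = modify lam"
    using step.IH by blast
  have "\<exists>lam''. affine_type (row_space (Suc m)) (unit_row 0) lam'' k \<and> modify lam'' = modify lam'"
  proof (rule affine_type_add_fixed_vector[OF lam'(1)])
    show "poly_act A [:0, 1:] (unit_row m) = unit_row m"
      using A step.hyps by (auto simp: poly_act_var row_act_def unit_row_def fun_eq_iff intro!: sum.neutral)
    show "card (row_space (Suc m) :: (nat \<Rightarrow> 'a) set) = CARD('a) * card (row_space m :: (nat \<Rightarrow> 'a) set)"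
      by (simp add: card_row_space)
    show "row_space (Suc m) = span (insert (unit_row m) (row_space m))"
    proof
      show "span (insert (unit_row m) (row_space m)) \<subseteq> row_space (Suc m)"
        using row_space_subspace[OF A, of "Suc m"] step.hyps row_space_mono[of m "Suc m"]
        by (intro span_minimal) (auto simp: unit_row_in_row_space)
      show "row_space (Suc m) \<subseteq> span (insert (unit_row m) (row_space m))"
      proof
        fix v :: "nat \<Rightarrow> 'a" assume v: "v \<in> row_space (Suc m)"
        define u where "u = (\<lambda>i. if i < m then v i else 0)"
        have "v = poly_act A [:v m:] (unit_row m) + u"
        proof
          fix i
          have "v i = 0" if "m < i" using v that by (simp add: row_space_def)
          then show "v i = (poly_act A [:v m:] (unit_row m) + u) i"
            by (cases i m rule: linorder_cases) (simp_all add: poly_act_const unit_row_def u_def)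
        qed
        moreover have "u \<in> row_space m" by (simp add: u_def row_space_def)
        ultimately show "v \<in> span (insert (unit_row m) (row_space m))"
          by (metis insertI1 insertI2 span_add span_base span_scale)
      qed
    qed
  qed
  then show ?case using lam'(2) by auto
qed

lemma has_modified_type_extend_mat:
  fixes A :: "'a::{field,finite} mat"
  assumes n: "1 \<le> n" "n \<le> n'" and type: "has_modified_type n A N"
  shows "has_modified_type n' (extend_mat n n' A) N"
proof -
  obtain lam k where N: "N = (modify lam, k)" and ht: "has_type n A (lam, k)"
    using type by (cases N) (auto simp: has_modified_type_def)
  have GA: "A \<in> GA n" using type by (rule has_modified_type_GA)
  have A: "A \<in> carrier_mat n n" using GA_carrier[OF n(1) GA] .
  obtain lam' where lam': "poly_module.affine_type (poly_act A) (row_space n') (unit_row 0) lam' k"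
    "modify lam' = modify lam"
    using affine_type_row_space_mono[OF n A has_type_imp_affine_type[OF n(1) ht]] by blast
  have "has_type n' (extend_mat n n' A) (lam', k)"
    using n GA A lam'(1)
    by (intro affine_type_imp_has_type) (simp_all add: extend_mat_GA_iff poly_act_extend_mat)
  then show ?thesis using lam'(2) by (auto simp: has_modified_type_def N)
qed

lemma has_modified_type_extend_mat_iff:
  fixes A :: "'a::{field,finite} mat"
  assumes n: "1 \<le> n" "n \<le> n'" and A: "A \<in> GA n"
  shows "has_modified_type n' (extend_mat n n' A) N \<longleftrightarrow> has_modified_type n A N"
proof
  assume *: "has_modified_type n' (extend_mat n n' A) N"
  obtain N' where N': "has_modified_type n A N'" using has_modified_type_exists[OF n(1) A] by blast
  have "N = N'"
    using has_modified_type_unique[OF _ * has_modified_type_extend_mat[OF n N']] n by simp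
  then show "has_modified_type n A N" using N' by simp
qed (rule has_modified_type_extend_mat[OF n])

text \<open>
  Fixing the last unit rows determines the last rows of \<open>A\<close>, and moving vectors only within the first \<open>n\<close> coordinates
  determines its last columns.
\<close>

lemma extend_mat_if_small_support:
  fixes A :: "'a::field mat"
  assumes n: "1 \<le> n" "n \<le> n'" and A: "A \<in> GA n'"
    and fixed: "\<And>i. n \<le> i \<Longrightarrow> i < n' \<Longrightarrow> unit_row i \<in> fixed_rows n' A"
    and move: "moved_rows n' A \<subseteq> row_space n"
  shows "\<exists>A0 \<in> GA n. A = extend_mat n n' A0"
proof -
  have c: "A \<in> carrier_mat n' n'" using A n by (simp add: GA_carrier)
  define A0 where "A0 = mat n n (\<lambda>(i, j). A $$ (i, j))"
  have A0: "A0 \<in> carrier_mat n n" by (simp add: A0_def)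
  have "A = extend_mat n n' A0"
  proof (rule eq_matI)
    fix i j assume "i < dim_row (extend_mat n n' A0)" "j < dim_col (extend_mat n n' A0)"
    then have i: "i < n'" and j: "j < n'" using extend_mat_carrier[OF A0 n(2)] by auto
    have row: "row_act A (unit_row i) j = A $$ (i, j)" using row_act_unit_row[OF c i] j by simp
    show "A $$ (i, j) = extend_mat n n' A0 $$ (i, j)"
    proof (cases "i < n")
      case False
      then have "row_act A (unit_row i) = unit_row i" using fixed[of i] i by (simp add: fixed_rows_def)
      then have "A $$ (i, j) = unit_row i j" using row by simp
      then show ?thesis using False i j n A0 by (auto simp: extend_mat_def unit_row_def)
    next
      case True
      show ?thesis
      proof (cases "j < n")
        case False
        have "row_act A (unit_row i) - unit_row i \<in> row_space n"
          using move unit_row_in_row_space[OF i] unfolding moved_rows_def by blast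
        then have "(row_act A (unit_row i) - unit_row i) j = 0" using False by (simp add: row_space_def)
        then have "A $$ (i, j) = 0" using row True False by (simp add: unit_row_def)
        then show ?thesis using True False i j n A0 by (simp add: extend_mat_def)
      qed (use True n A0 in \<open>simp add: extend_mat_def A0_def\<close>)
    qed
  qed (use c extend_mat_carrier[OF A0 n(2)] in auto)
  then show ?thesis using A extend_mat_GA_iff[OF n A0] by blast
qed

definition factorizations ::
    "nat \<Rightarrow> 'a::field ptn_fun \<times> nat \<Rightarrow> 'a ptn_fun \<times> nat \<Rightarrow> 'a mat \<Rightarrow> ('a mat \<times> 'a mat) set" where
  "factorizations n L M C = {(A, B). has_modified_type n A L \<and> has_modified_type n B M \<and> A * B = C}"

text \<open>
  Stability. In a factorization of the extended matrix with additive norms both factors fix what the product fixes,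
  in particular the added unit rows, and they move vectors only into the image of the product minus \<open>1\<close>, which lies in
  the first \<open>n\<close> coordinates. So both factors are extended matrices themselves.
\<close>

lemma factorizations_extend_mat:
  fixes C :: "'a::{field,finite} mat"
  assumes n: "1 \<le> n" "n \<le> n'" and C: "has_modified_type n C N"
    and norm: "affine_norm N = affine_norm L + affine_norm M"
  shows "factorizations n' L M (extend_mat n n' C)
    = (\<lambda>(A, B). (extend_mat n n' A, extend_mat n n' B)) ` factorizations n L M C"
proof (intro equalityI subsetI)
  have n': "1 \<le> n'" using n by simp
  have C': "has_modified_type n' (extend_mat n n' C) N" by (rule has_modified_type_extend_mat[OF n C])
  have cC: "C \<in> carrier_mat n n" using C n by (auto intro: GA_carrier dest: has_modified_type_GA)
  fix x assume "x \<in> factorizations n' L M (extend_mat n n' C)"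
  then obtain A B where x: "x = (A, B)" and AB: "has_modified_type n' A L" "has_modified_type n' B M"
    "A * B = extend_mat n n' C" by (auto simp: factorizations_def)
  have GA: "A \<in> GA n'" "B \<in> GA n'" using AB by (auto dest: has_modified_type_GA)
  have sub: "moved_rows n' A \<subseteq> moved_rows n' (extend_mat n n' C)" "moved_rows n' B \<subseteq> moved_rows n' (extend_mat n n' C)"
    "fixed_rows n' (extend_mat n n' C) \<subseteq> fixed_rows n' A" "fixed_rows n' (extend_mat n n' C) \<subseteq> fixed_rows n' B"
    using affine_norm_subadditive(2)[OF n' AB(1,2) _ norm] C' unfolding AB(3) by blast+
  have move: "moved_rows n' (extend_mat n n' C) \<subseteq> row_space n"
    using cC by (auto simp: moved_rows_def row_act_extend_mat[OF cC n(2)] row_act_def row_space_def)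
  have "unit_row i \<in> fixed_rows n' (extend_mat n n' C)" if "n \<le> i" "i < n'" for i
  proof -
    have "row_act C (unit_row i) = unit_row i"
      using that cC by (auto simp: row_act_def unit_row_def fun_eq_iff intro!: sum.neutral)
    then show ?thesis
      using unit_row_in_row_space[OF that(2)] by (simp add: fixed_rows_def row_act_extend_mat[OF cC n(2)])
  qed
  then obtain A0 B0 where A0: "A0 \<in> GA n" "A = extend_mat n n' A0" and B0: "B0 \<in> GA n" "B = extend_mat n n' B0"
    using extend_mat_if_small_support[OF n GA(1)] extend_mat_if_small_support[OF n GA(2)] sub move
    by (meson subset_iff subset_trans)
  have c: "A0 \<in> carrier_mat n n" "B0 \<in> carrier_mat n n" using A0 B0 n by (auto intro: GA_carrier)
  have "extend_mat n n' (A0 * B0) = extend_mat n n' C"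
    using AB(3) extend_mat_mult[OF c n(2)] A0 B0 by simp
  then have "A0 * B0 = C" using extend_mat_inject[of "A0 * B0" n C n'] c cC n(2) by simp
  then have "(A0, B0) \<in> factorizations n L M C"
    using AB A0 B0 n by (simp add: factorizations_def has_modified_type_extend_mat_iff)
  then show "x \<in> (\<lambda>(A, B). (extend_mat n n' A, extend_mat n n' B)) ` factorizations n L M C"
    using x A0 B0 by force
next
  fix x assume "x \<in> (\<lambda>(A, B). (extend_mat n n' A, extend_mat n n' B)) ` factorizations n L M C"
  then obtain A B where x: "x = (extend_mat n n' A, extend_mat n n' B)"
    and AB: "has_modified_type n A L" "has_modified_type n B M" "A * B = C"
    by (auto simp: factorizations_def)
  have "A \<in> carrier_mat n n" "B \<in> carrier_mat n n"
    using AB n by (auto intro: GA_carrier dest: has_modified_type_GA)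
  then show "x \<in> factorizations n' L M (extend_mat n n' C)"
    using AB n by (simp add: x factorizations_def extend_mat_mult has_modified_type_extend_mat)
qed

lemma card_factorizations_extend_mat:
  fixes C :: "'a::{field,finite} mat"
  assumes n: "1 \<le> n" "n \<le> n'" and C: "has_modified_type n C N"
    and norm: "affine_norm N = affine_norm L + affine_norm M"
  shows "card (factorizations n' L M (extend_mat n n' C)) = card (factorizations n L M C)"
proof -
  have "inj_on (\<lambda>(A, B). (extend_mat n n' A, extend_mat n n' B)) (factorizations n L M C)"
  proof (rule inj_onI)
    fix x y :: "'a mat \<times> 'a mat"
    assume xy: "x \<in> factorizations n L M C" "y \<in> factorizations n L M C"
      "(\<lambda>(A, B). (extend_mat n n' A, extend_mat n n' B)) x = (\<lambda>(A, B). (extend_mat n n' A, extend_mat n n' B)) y"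
    obtain A B A' B' where eq: "x = (A, B)" "y = (A', B')" by (cases x; cases y)
    have "A \<in> carrier_mat n n" "B \<in> carrier_mat n n" "A' \<in> carrier_mat n n" "B' \<in> carrier_mat n n"
      using xy(1,2) n unfolding eq
      by (auto simp: factorizations_def intro!: GA_carrier dest: has_modified_type_GA)
    then show "x = y" using xy(3) extend_mat_inject n(2) unfolding eq by auto
  qed
  then show ?thesis by (simp add: factorizations_extend_mat[OF assms] card_image)
qed

section \<open>Structure constants count factorizations\<close>

lemma has_modified_type_conjugate:
  fixes A :: "'a::field mat"
  assumes n: "1 \<le> n" and A: "has_modified_type n A N"
    and U: "U \<in> GA n" "U' \<in> GA n" "U * U' = 1\<^sub>m n" "U' * U = 1\<^sub>m n"
  shows "has_modified_type n (U * A * U') N"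
proof -
  obtain lam k where N: "N = (modify lam, k)" and ht: "has_type n A (lam, k)"
    using A by (cases N) (auto simp: has_modified_type_def)
  obtain P Q where PQ: "P \<in> GA n" "Q \<in> GA n" "similar_mat_wit A (J_affine (lam, k)) P Q"
    using has_typeD(4)[OF ht] by blast
  have GA: "A \<in> GA n" using A by (rule has_modified_type_GA)
  have c: "A \<in> carrier_mat n n" "U \<in> carrier_mat n n" "U' \<in> carrier_mat n n"
    using GA U n by (auto intro: GA_carrier)
  have "similar_mat_wit (U * A * U') A U U'"
    using c U by (intro similar_mat_witI[of _ _ n]) simp_all
  then have "similar_mat_wit (U * A * U') (J_affine (lam, k)) (U * P) (Q * U')"
    using similar_mat_wit_trans PQ(3) by blast
  then have "has_type n (U * A * U') (lam, k)"
    using ht GA_mult[OF n GA_mult[OF n U(1) GA] U(2)] GA_mult[OF n U(1) PQ(1)] GA_mult[OF n PQ(2) U(2)]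
    unfolding has_type_def GA_conjugate_def prod.case by blast
  then show ?thesis by (auto simp: has_modified_type_def N)
qed

lemma same_modified_type_conjugate:
  fixes A B :: "'a::field mat"
  assumes n: "1 \<le> n" and types: "has_modified_type n A N" "has_modified_type n B N"
  obtains U U' where "U \<in> GA n" "U' \<in> GA n" "U * U' = 1\<^sub>m n" "U' * U = 1\<^sub>m n" "A = U * B * U'"
proof -
  obtain lam k where N: "N = (modify lam, k)" and A: "has_type n A (lam, k)"
    using types(1) by (cases N) (auto simp: has_modified_type_def)
  obtain lam' where N': "modify lam = modify lam'" and B: "has_type n B (lam', k)"
    using types(2) by (auto simp: has_modified_type_def N)
  have "lam = lam'"
    by (rule modify_inject[OF has_typeD(1)[OF A] has_typeD(1)[OF B] _ N'])
      (simp only: has_typeD(2)[OF A] has_typeD(2)[OF B])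
  then obtain P Q P' Q' where PQ: "P \<in> GA n" "Q \<in> GA n" "similar_mat_wit A (J_affine (lam, k)) P Q"
    and PQ': "P' \<in> GA n" "Q' \<in> GA n" "similar_mat_wit B (J_affine (lam, k)) P' Q'"
    using has_typeD(4)[OF A] has_typeD(4)[OF B] by blast
  have w: "similar_mat_wit A B (P * Q') (P' * Q)"
    using similar_mat_wit_trans[OF PQ(3) similar_mat_wit_sym[OF PQ'(3)]] .
  have c: "A \<in> carrier_mat n n" using types(1) n by (auto intro: GA_carrier dest: has_modified_type_GA)
  show ?thesis
    by (rule that[of "P * Q'" "P' * Q"])
      (use GA_mult[OF n] PQ PQ' similar_mat_witD2[OF c w] in auto)
qed

lemma finite_factorizations: "finite (factorizations n L M C)"
  for C :: "'a::{field,finite} mat"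
proof (rule finite_subset)
  show "factorizations n L M C \<subseteq> GA n \<times> GA n"
    by (auto simp: factorizations_def dest: has_modified_type_GA)
qed (simp add: finite_GA)

text \<open>
  Elements with the same modified type are conjugate, and conjugation carries factorizations to factorizations.
\<close>

lemma card_factorizations_class_function:
  fixes C D :: "'a::{field,finite} mat"
  assumes n: "1 \<le> n" and types: "has_modified_type n C N" "has_modified_type n D N"
  shows "card (factorizations n L M C) = card (factorizations n L M D)"
proof -
  have le: "card (factorizations n L M D) \<le> card (factorizations n L M C)"
    if CD: "has_modified_type n C N" "has_modified_type n D N" for C D :: "'a mat"
  proof -
    obtain U U' where U: "U \<in> GA n" "U' \<in> GA n" "U * U' = 1\<^sub>m n" "U' * U = 1\<^sub>m n" "C = U * D * U'"
      by (rule same_modified_type_conjugate[OF n CD])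
    have c: "U \<in> carrier_mat n n" "U' \<in> carrier_mat n n" using U n by (auto intro: GA_carrier)
    have cancel: "U' * (U * X * U') * U = X" if X: "X \<in> carrier_mat n n" for X
    proof -
      have "U' * (U * X * U') * U = (U' * U) * X * (U' * U)"
        using c X by (simp add: assoc_mult_mat[of _ n n _ n _ n])
      then show ?thesis using X U by simp
    qed
    have carrier: "X \<in> carrier_mat n n" if "has_modified_type n X K" for X :: "'a mat" and K
      using that n by (auto intro: GA_carrier dest: has_modified_type_GA)
    let ?h = "\<lambda>(A, B). (U * A * U', U * B * U')"
    have "inj_on ?h (factorizations n L M D)"
    proof (rule inj_onI)
      fix x y assume xy: "x \<in> factorizations n L M D" "y \<in> factorizations n L M D" "?h x = ?h y"
      obtain A B A' B' where eq: "x = (A, B)" "y = (A', B')" by (cases x; cases y)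
      have "A \<in> carrier_mat n n" "B \<in> carrier_mat n n" "A' \<in> carrier_mat n n" "B' \<in> carrier_mat n n"
        using xy(1,2) carrier unfolding eq factorizations_def by blast+
      moreover have "U * A * U' = U * A' * U'" "U * B * U' = U * B' * U'" using xy(3) unfolding eq by simp_all
      ultimately show "x = y" unfolding eq by (metis cancel)
    qed
    moreover have "?h ` factorizations n L M D \<subseteq> factorizations n L M C"
    proof clarify
      fix A B assume "(A, B) \<in> factorizations n L M D"
      then have AB: "has_modified_type n A L" "has_modified_type n B M" "A * B = D"
        by (auto simp: factorizations_def)
      note cAB = carrier[OF AB(1)] carrier[OF AB(2)]
      have "(U * A * U') * (U * B * U') = U * A * (U' * U) * B * U'"
        using c cAB by (simp add: assoc_mult_mat[of _ n n _ n _ n])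
      also have "\<dots> = U * A * B * U'" using c cAB U(4) by simp
      also have "\<dots> = C" using c cAB U(5) AB(3) by (simp add: assoc_mult_mat[of _ n n _ n _ n])
      finally show "(U * A * U', U * B * U') \<in> factorizations n L M C"
        unfolding factorizations_def
        using has_modified_type_conjugate[OF n AB(1) U(1-4)] has_modified_type_conjugate[OF n AB(2) U(1-4)] by simp
    qed
    ultimately show ?thesis by (rule card_inj_on_le[OF _ _ finite_factorizations])
  qed
  show ?thesis using le[OF types] le[OF types(2,1)] by simp
qed

lemma gr_mult_class_sum:
  fixes C :: "'a::{field,finite} mat"
  shows "gr_mult n (class_sum L n) (class_sum M n) C = int (card (factorizations n L M C))"
proof -
  let ?S = "{(A, B). A \<in> GA n \<and> B \<in> GA n \<and> A * B = C}"
  have fin: "finite ?S" by (rule finite_subset[of _ "GA n \<times> GA n"]) (auto simp: finite_GA)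
  have "gr_mult n (class_sum L n) (class_sum M n) C
      = (\<Sum>x \<in> ?S. if x \<in> factorizations n L M C then 1 else 0)"
    unfolding gr_mult_def
  proof (intro sum.cong refl)
    fix x assume "x \<in> ?S"
    then obtain A B where "x = (A, B)" "A \<in> GA n" "B \<in> GA n" "A * B = C" by auto
    then show "(case x of (A, B) \<Rightarrow> class_sum L n A * class_sum M n B)
        = (if x \<in> factorizations n L M C then 1 else 0)"
      by (simp add: class_sum_def factorizations_def)
  qed
  also have "\<dots> = int (card (?S \<inter> factorizations n L M C))"
    using fin by (simp add: sum.If_cases)
  also have "?S \<inter> factorizations n L M C = factorizations n L M C"
    by (auto simp: factorizations_def dest: has_modified_type_GA)
  finally show ?thesis .
qed

lemma class_sum_alt: "class_sum N n A = (if has_modified_type n A N then 1 else 0)"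
  by (auto simp: class_sum_def dest: has_modified_type_GA)

lemma class_sum_nonzero_iff: "class_sum N n \<noteq> (\<lambda>_. 0) \<longleftrightarrow> (\<exists>A. has_modified_type n A N)"
  by (auto simp: class_sum_alt fun_eq_iff)

lemma finite_occurring_types:
  assumes "1 \<le> n"
  shows "finite (occurring_types n :: ('a::{field,finite} ptn_fun \<times> nat) set)"
proof (rule finite_subset)
  show "occurring_types n \<subseteq> (\<lambda>A :: 'a mat. THE N. has_modified_type n A N) ` GA n"
  proof
    fix N :: "'a ptn_fun \<times> nat" assume "N \<in> occurring_types n"
    then obtain A where A: "has_modified_type n A N"
      unfolding occurring_types_def class_sum_nonzero_iff by blast
    then have "(THE N. has_modified_type n A N) = N"
      using has_modified_type_unique[OF assms] by blast
    then show "N \<in> (\<lambda>A :: 'a mat. THE N. has_modified_type n A N) ` GA n"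
      using has_modified_type_GA[OF A] by force
  qed
qed (simp add: finite_GA)

lemma sum_class_sums:
  fixes A :: "'a::{field,finite} mat" and p :: "'a ptn_fun \<times> nat \<Rightarrow> int"
  assumes n: "1 \<le> n" and A: "has_modified_type n A N"
  shows "(\<Sum>N' \<in> occurring_types n. p N' * class_sum N' n A) = p N"
proof -
  have N: "N \<in> occurring_types n"
    unfolding occurring_types_def class_sum_nonzero_iff using A has_modified_type_in_affine_types by blast
  have "has_modified_type n A N' \<longleftrightarrow> N' = N" for N'
    using has_modified_type_unique[OF n A] A by blast
  then have "(\<Sum>N' \<in> occurring_types n. p N' * class_sum N' n A)
      = (\<Sum>N' \<in> occurring_types n. if N' = N then p N' else 0)"
    by (intro sum.cong refl) (simp add: class_sum_alt)
  also have "\<dots> = p N"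
    using sum.delta[OF finite_occurring_types[OF n], of N p] N by (simp only: if_True)
  finally show ?thesis .
qed

text \<open>
  Every element of the group has exactly one modified type, so the class sums are indicator functions of the parts of a
  partition of the group, and the coefficient of a class function at a class sum is its value on that class.
\<close>

lemma structure_constant_eq:
  fixes C :: "'a::{field,finite} mat"
  assumes n: "1 \<le> n" and C: "has_modified_type n C N"
  shows "structure_constant L M N n = int (card (factorizations n L M C))"
proof -
  define p where "p N' = int (card (factorizations n L M (SOME A. has_modified_type n A N')))" for N'
  have p: "p N' = int (card (factorizations n L M A))" if "has_modified_type n A N'" for A N'
    unfolding p_def using card_factorizations_class_function[OF n _ that] someI[of "\<lambda>A. has_modified_type n A N'", OF that]
    by simp
  have "gr_mult n (class_sum L n) (class_sum M n) = (\<lambda>A. \<Sum>N' \<in> occurring_types n. p N' * class_sum N' n A)"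
  proof
    fix A :: "'a mat"
    show "gr_mult n (class_sum L n) (class_sum M n) A = (\<Sum>N' \<in> occurring_types n. p N' * class_sum N' n A)"
    proof (cases "A \<in> GA n")
      case True
      then obtain K where "has_modified_type n A K" using has_modified_type_exists[OF n] by blast
      then show ?thesis by (simp add: gr_mult_class_sum sum_class_sums[OF n] p)
    next
      case False
      then have "factorizations n L M A = {}"
        using GA_mult[OF n] by (auto simp: factorizations_def dest: has_modified_type_GA)
      moreover have "class_sum K n A = 0" for K using False by (simp add: class_sum_def)
      ultimately show ?thesis by (simp add: gr_mult_class_sum)
    qed
  qed
  note expansion = this
  have unique: "p' N = int (card (factorizations n L M C))"
    if "gr_mult n (class_sum L n) (class_sum M n) = (\<lambda>A. \<Sum>N' \<in> occurring_types n. p' N' * class_sum N' n A)" for p'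
    using fun_cong[OF that, of C] by (simp add: gr_mult_class_sum sum_class_sums[OF n C])
  show ?thesis
    unfolding structure_constant_def
  proof (rule the_equality)
    show "\<exists>p. gr_mult n (class_sum L n) (class_sum M n)
        = (\<lambda>A. \<Sum>N' \<in> occurring_types n. p N' * class_sum N' n A) \<and> int (card (factorizations n L M C)) = p N"
      by (rule exI[of _ p]) (rule conjI[OF expansion p[OF C, symmetric]])
    fix c assume "\<exists>p. gr_mult n (class_sum L n) (class_sum M n)
        = (\<lambda>A. \<Sum>N' \<in> occurring_types n. p N' * class_sum N' n A) \<and> c = p N"
    then show "c = int (card (factorizations n L M C))" using unique by blast
  qed
qed

theorem theorem1p1:
  fixes lam mu nu :: "'a::{field,finite} ptn_fun" and k s t :: nat
  assumes "(lam, k) \<in> affine_types" and "(mu, s) \<in> affine_types" and "(nu, t) \<in> affine_types"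
  shows "(\<forall>n. sc_defined (lam, k) (mu, s) (nu, t) n \<longrightarrow>
            \<not> affine_norm (nu, t) \<le> affine_norm (lam, k) + affine_norm (mu, s) \<longrightarrow>
            structure_constant (lam, k) (mu, s) (nu, t) n = 0) \<and>
         (affine_norm (nu, t) = affine_norm (lam, k) + affine_norm (mu, s) \<longrightarrow>
            (\<forall>n n'. sc_defined (lam, k) (mu, s) (nu, t) n \<longrightarrow>
                    sc_defined (lam, k) (mu, s) (nu, t) n' \<longrightarrow>
                    structure_constant (lam, k) (mu, s) (nu, t) n
                      = structure_constant (lam, k) (mu, s) (nu, t) n'))"
proof (intro conjI allI impI)
  fix n
  assume def: "sc_defined (lam, k) (mu, s) (nu, t) n"
    and norm: "\<not> affine_norm (nu, t) \<le> affine_norm (lam, k) + affine_norm (mu, s)"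
  obtain C :: "'a mat" where n: "1 \<le> n" and C: "has_modified_type n C (nu, t)"
    using def unfolding sc_defined_def class_sum_nonzero_iff by blast
  have "factorizations n (lam, k) (mu, s) C = {}"
  proof (rule equals0I)
    fix x assume "x \<in> factorizations n (lam, k) (mu, s) C"
    then obtain A B where AB: "has_modified_type n A (lam, k)" "has_modified_type n B (mu, s)" "A * B = C"
      unfolding factorizations_def by blast
    show False using affine_norm_subadditive(1)[OF n AB(1,2) C[folded AB(3)]] norm by contradiction
  qed
  then show "structure_constant (lam, k) (mu, s) (nu, t) n = 0"
    by (simp add: structure_constant_eq[OF n C])
next
  fix n n'
  assume norm: "affine_norm (nu, t) = affine_norm (lam, k) + affine_norm (mu, s)"
    and def: "sc_defined (lam, k) (mu, s) (nu, t) n" "sc_defined (lam, k) (mu, s) (nu, t) n'"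
  have mono: "structure_constant (lam, k) (mu, s) (nu, t) n' = structure_constant (lam, k) (mu, s) (nu, t) n"
    if def: "sc_defined (lam, k) (mu, s) (nu, t) n" and le: "n \<le> n'" for n n'
  proof -
    obtain C :: "'a mat" where n: "1 \<le> n" and C: "has_modified_type n C (nu, t)"
      using def unfolding sc_defined_def class_sum_nonzero_iff by blast
    have n': "1 \<le> n'" using n le by simp
    show ?thesis
      unfolding structure_constant_eq[OF n C] structure_constant_eq[OF n' has_modified_type_extend_mat[OF n le C]]
        card_factorizations_extend_mat[OF n le C norm] ..
  qed
  show "structure_constant (lam, k) (mu, s) (nu, t) n = structure_constant (lam, k) (mu, s) (nu, t) n'"
    using mono[OF def(1), of n'] mono[OF def(2), of n] by (cases "n \<le> n'") simp_all
qed

end
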